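(* Let $\varphi\colon \mathbb{D}\to\mathbb{D}$ be an analytic map. Then the following conditions are equivalent: (i) $C_\varphi\colon \mathit{BMOA}\to \mathit{BMOA}$ is compact. (ii) $C_\varphi\colon \mathit{BMOA}\to \mathit{BMOA}$ is weakly compact. (iii) $\displaystyle \lim_{|\varphi(a)|\to 1}\ \sup_{0<|w|<1} |w|^2 N(\sigma_{\varphi(a)}\circ\varphi\circ\sigma_a, w)=0$. (iv) $\displaystyle \lim_{|\varphi(a)|\to 1} \|\sigma_{\varphi(a)}\circ\varphi\circ\sigma_a\|_{H^2}=0$.
   Context: $\mathbb{D}$ is the open unit disc in $\mathbb{C}$, $\|\cdot\|_{H^2}$ is the standard norm of the Hardy space $H^2$ on $\mathbb{D}$, and for $a\in\mathbb{D}$, $\sigma_a(z)=(a-z)/(1-\bar a z)$. $\mathit{BMOA}$ is the Banach space of analytic $f\colon\mathbb{D}\to\mathbb{C}$ with $|f|_*=\sup_{a\in\mathbb{D}}\|f\circ\sigma_a-f(a)\|_{H^2}<\infty$, normed by $\|f\|_*=|f(0)|+|f|_*$. $C_\varphi f=f\circ\varphi$; it is always a bounded operator on $\mathit{BMOA}$. A linear operator is (weakly) compact if it maps bounded sets to sets whose closure is compact in the norm (respectively weak) topology. For an analytic self-map $\psi$ of $\mathbb{D}$ and $w\in\mathbb{D}\setminus\{\psi(0)\}$, $N(\psi,w)=\sum_{z\in\psi^{-1}(w)}\log(1/|z|)$ is the Nevanlinna counting function, with preimages counted according to multiplicity (and value $0$ if there are none). A statement $\lim_{|\varphi(a)|\to1}F(a)=0$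 means: for every $\varepsilon>0$ there is $\eta<1$ such that $|F(a)|<\varepsilon$ for all $a\in\mathbb{D}$ with $|\varphi(a)|>\eta$ (vacuously true if $\sup_{\mathbb{D}}|\varphi|<1$). *)

theory Defs
  imports "HOL-Complex_Analysis.Complex_Analysis"
begin

abbreviation disc :: "complex set" (\<open>\<bbbD>\<close>) where
  "\<bbbD> \<equiv> ball 0 1"

definition disc_aut :: "complex \<Rightarrow> complex \<Rightarrow> complex" (\<open>\<sigma>\<close>) where
  "\<sigma> a z = (a - z) / (1 - cnj a * z)"

definition circle_mean2 :: "(complex \<Rightarrow> complex) \<Rightarrow> real \<Rightarrow> real" where
  "circle_mean2 f r =
     sqrt (1 / (2 * pi) * integral {0..2*pi} (\<lambda>t. (norm (f (of_real r * cis t)))\<^sup>2))"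

definition h2_norm :: "(complex \<Rightarrow> complex) \<Rightarrow> ennreal" where
  "h2_norm f = (SUP r\<in>{0<..<1}. ennreal (circle_mean2 f r))"

definition bmoa_seminorm :: "(complex \<Rightarrow> complex) \<Rightarrow> ennreal" where
  "bmoa_seminorm f = (SUP a\<in>\<bbbD>. h2_norm (\<lambda>z. (f \<circ> \<sigma> a) z - f a))"

(* Functions on the disc are represented by total functions vanishing off the disc, so that
   distinct elements of bmoa are distinct functions on the disc and bmoa is closed under
   pointwise linear combinations. *)
definition bmoa :: "(complex \<Rightarrow> complex) set" where
  "bmoa = {f. f holomorphic_on \<bbbD> \<and> (\<forall>z. z \<notin> \<bbbD> \<longrightarrow> f z = 0) \<and> bmoa_seminorm f < \<infinity>}"

definition bmoa_norm :: "(complex \<Rightarrow> complex) \<Rightarrow> real" where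
  "bmoa_norm f = norm (f 0) + enn2real (bmoa_seminorm f)"

definition bmoa_dist :: "(complex \<Rightarrow> complex) \<Rightarrow> (complex \<Rightarrow> complex) \<Rightarrow> real" where
  "bmoa_dist f g = bmoa_norm (\<lambda>z. f z - g z)"

lemma disc_aut_in_disc:
  assumes "a \<in> \<bbbD>" "z \<in> \<bbbD>"
  shows "1 - cnj a * z \<noteq> 0" "\<sigma> a z \<in> \<bbbD>"
proof -
  have "norm (cnj a * z) < 1"
    using assms by (simp add: norm_mult) (metis mult_strict_mono' norm_ge_zero mult_1)
  then show nz: "1 - cnj a * z \<noteq> 0" by auto
  have "(norm (1 - cnj a * z))\<^sup>2 - (norm (a - z))\<^sup>2 = (1 - (norm a)\<^sup>2) * (1 - (norm z)\<^sup>2)"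
    unfolding cmod_power2 by (simp add: algebra_simps power2_eq_square)
  moreover have "(1 - (norm a)\<^sup>2) * (1 - (norm z)\<^sup>2) > 0"
    using assms by (simp add: abs_square_less_1)
  ultimately have "(norm (a - z))\<^sup>2 < (norm (1 - cnj a * z))\<^sup>2" by linarith
  then have "norm (a - z) < norm (1 - cnj a * z)"
    using norm_ge_zero power2_less_imp_less by blast
  then show "\<sigma> a z \<in> \<bbbD>"
    using nz by (simp add: disc_aut_def norm_divide divide_simps)
qed

lemma disc_aut_holomorphic: "a \<in> \<bbbD> \<Longrightarrow> \<sigma> a holomorphic_on \<bbbD>"
  unfolding disc_aut_def[abs_def]
  by (intro holomorphic_intros) (use disc_aut_in_disc(1) in blast)

lemma holomorphic_compose_disc_aut:
  assumes "f holomorphic_on \<bbbD>" "a \<in> \<bbbD>"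
  shows "(\<lambda>z. (f \<circ> \<sigma> a) z - f a) holomorphic_on \<bbbD>"
proof -
  have "f \<circ> \<sigma> a holomorphic_on \<bbbD>"
    using holomorphic_on_compose_gen[OF disc_aut_holomorphic assms(1)] disc_aut_in_disc(2) assms(2)
    by blast
  then show ?thesis by (intro holomorphic_intros)
qed

lemma continuous_on_circle:
  assumes "f holomorphic_on \<bbbD>" "r \<in> {0<..<1}"
  shows "continuous_on {0..2*pi} (\<lambda>t. f (of_real r * cis t))"
proof (rule continuous_on_compose2[of \<bbbD> f])
  show "continuous_on \<bbbD> f" using assms holomorphic_on_imp_continuous_on by blast
  show "continuous_on {0..2*pi} (\<lambda>t. of_real r * cis t)" by (intro continuous_intros)
  show "(\<lambda>t. of_real r * cis t) ` {0..2*pi} \<subseteq> \<bbbD>" using assms by (auto simp: norm_mult)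
qed

lemma circle_mean2_triangle:
  assumes f: "f holomorphic_on \<bbbD>" and g: "g holomorphic_on \<bbbD>" and r: "r \<in> {0<..<1}"
  shows "circle_mean2 (\<lambda>z. f z + g z) r \<le> circle_mean2 f r + circle_mean2 g r"
proof -
  define I where "I h = 1 / (2 * pi) * integral {0..2*pi} (\<lambda>t. (norm (h (of_real r * cis t)))\<^sup>2)"
    for h :: "complex \<Rightarrow> complex"
  have int: "(\<lambda>t. (norm (h (of_real r * cis t)))\<^sup>2) integrable_on {0..2*pi}"
    if "h holomorphic_on \<bbbD>" for h
    by (intro integrable_continuous_interval continuous_intros continuous_on_circle that r)
  have I0: "I h \<ge> 0" if "h holomorphic_on \<bbbD>" for h
    unfolding I_def using integral_nonneg[OF int[OF that]] by simp
  have key: "sqrt (I (\<lambda>z. f z + g z)) \<le> \<alpha> + \<beta>"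
    if a: "\<alpha> > sqrt (I f)" and b: "\<beta> > sqrt (I g)" for \<alpha> \<beta>
  proof -
    have pos: "\<alpha> > 0" "\<beta> > 0" using a b I0[OF f] I0[OF g] real_sqrt_ge_zero
      by (meson le_less_trans)+
    have Ia: "I f \<le> \<alpha>\<^sup>2" using a pos by (meson less_eq_real_def sqrt_le_D)
    have Ib: "I g \<le> \<beta>\<^sup>2" using b pos by (meson less_eq_real_def sqrt_le_D)
    have pt: "(norm (x + y))\<^sup>2 \<le> (1 + \<beta>/\<alpha>) * (norm x)\<^sup>2 + (1 + \<alpha>/\<beta>) * (norm y)\<^sup>2"
      for x y :: complex
    proof -
      have "(norm (x + y))\<^sup>2 \<le> (norm x + norm y)\<^sup>2"
        by (simp add: norm_triangle_ineq power_mono)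
      also have "\<dots> = (1 + \<beta>/\<alpha>) * (norm x)\<^sup>2 + (1 + \<alpha>/\<beta>) * (norm y)\<^sup>2
                    - (\<beta> * norm x - \<alpha> * norm y)\<^sup>2 / (\<alpha> * \<beta>)"
        using pos by (simp add: field_simps power2_eq_square)
      also have "\<dots> \<le> (1 + \<beta>/\<alpha>) * (norm x)\<^sup>2 + (1 + \<alpha>/\<beta>) * (norm y)\<^sup>2"
        using pos by simp
      finally show ?thesis .
    qed
    let ?F = "\<lambda>t. (norm (f (of_real r * cis t)))\<^sup>2"
    let ?G = "\<lambda>t. (norm (g (of_real r * cis t)))\<^sup>2"
    have "integral {0..2*pi} (\<lambda>t. (norm (f (of_real r * cis t) + g (of_real r * cis t)))\<^sup>2)
          \<le> integral {0..2*pi} (\<lambda>t. (1 + \<beta>/\<alpha>) * ?F t + (1 + \<alpha>/\<beta>) * ?G t)"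
      by (rule integral_le)
        (use int[of "\<lambda>z. f z + g z"] int[OF f] int[OF g] f g pt in
          \<open>auto intro!: holomorphic_intros integrable_add integrable_on_mult_right\<close>)
    also have "\<dots> = (1 + \<beta>/\<alpha>) * integral {0..2*pi} ?F + (1 + \<alpha>/\<beta>) * integral {0..2*pi} ?G"
      using int[OF f] int[OF g]
      by (subst integral_add) (auto intro!: integrable_on_mult_right)
    finally have "I (\<lambda>z. f z + g z) \<le>
      1 / (2 * pi) * ((1 + \<beta>/\<alpha>) * integral {0..2*pi} ?F + (1 + \<alpha>/\<beta>) * integral {0..2*pi} ?G)"
      unfolding I_def by (intro mult_left_mono) auto
    also have "\<dots> = (1 + \<beta>/\<alpha>) * I f + (1 + \<alpha>/\<beta>) * I g"
      unfolding I_def by (simp add: add_divide_distrib)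
    also have "\<dots> \<le> (1 + \<beta>/\<alpha>) * \<alpha>\<^sup>2 + (1 + \<alpha>/\<beta>) * \<beta>\<^sup>2"
      using Ia Ib pos by (intro add_mono mult_left_mono) auto
    also have "\<dots> = (\<alpha> + \<beta>)\<^sup>2"
      using pos by (simp add: field_simps power2_eq_square)
    finally show ?thesis using pos by (intro real_le_lsqrt) auto
  qed
  have "sqrt (I (\<lambda>z. f z + g z)) \<le> sqrt (I f) + sqrt (I g)"
  proof (rule field_le_epsilon)
    fix e :: real assume "e > 0"
    then show "sqrt (I (\<lambda>z. f z + g z)) \<le> sqrt (I f) + sqrt (I g) + e"
      using key[of "sqrt (I f) + e/2" "sqrt (I g) + e/2"] by simp
  qed
  then show ?thesis unfolding circle_mean2_def I_def by simp
qed

lemma circle_mean2_nonneg: "circle_mean2 f r \<ge> 0"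
  unfolding circle_mean2_def
  by (cases "(\<lambda>t. (norm (f (of_real r * cis t)))\<^sup>2) integrable_on {0..2*pi}")
     (auto simp: not_integrable_integral intro!: integral_nonneg divide_nonneg_pos)

lemma h2_norm_triangle:
  assumes "f holomorphic_on \<bbbD>" "g holomorphic_on \<bbbD>"
  shows "h2_norm (\<lambda>z. f z + g z) \<le> h2_norm f + h2_norm g"
  unfolding h2_norm_def
proof (rule SUP_least)
  fix r :: real assume r: "r \<in> {0<..<1}"
  have "ennreal (circle_mean2 (\<lambda>z. f z + g z) r) \<le> ennreal (circle_mean2 f r + circle_mean2 g r)"
    using circle_mean2_triangle[OF assms r] by (rule ennreal_leI)
  also have "\<dots> = ennreal (circle_mean2 f r) + ennreal (circle_mean2 g r)"
    by (simp add: circle_mean2_nonneg)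
  also have "\<dots> \<le> (SUP r\<in>{0<..<1}. ennreal (circle_mean2 f r)) + (SUP r\<in>{0<..<1}. ennreal (circle_mean2 g r))"
    using r by (intro add_mono SUP_upper)
  finally show "ennreal (circle_mean2 (\<lambda>z. f z + g z) r) \<le> \<dots>" .
qed

lemma bmoa_seminorm_triangle:
  assumes f: "f holomorphic_on \<bbbD>" and g: "g holomorphic_on \<bbbD>"
  shows "bmoa_seminorm (\<lambda>z. f z + g z) \<le> bmoa_seminorm f + bmoa_seminorm g"
  unfolding bmoa_seminorm_def
proof (rule SUP_least)
  fix a :: complex assume a: "a \<in> \<bbbD>"
  have "h2_norm (\<lambda>z. ((\<lambda>z. f z + g z) \<circ> \<sigma> a) z - (f a + g a))
      = h2_norm (\<lambda>z. ((f \<circ> \<sigma> a) z - f a) + ((g \<circ> \<sigma> a) z - g a))"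
    by (simp add: algebra_simps)
  also have "\<dots> \<le> h2_norm (\<lambda>z. (f \<circ> \<sigma> a) z - f a) + h2_norm (\<lambda>z. (g \<circ> \<sigma> a) z - g a)"
    by (intro h2_norm_triangle holomorphic_compose_disc_aut f g a)
  also have "\<dots> \<le> (SUP a\<in>\<bbbD>. h2_norm (\<lambda>z. (f \<circ> \<sigma> a) z - f a)) +
                  (SUP a\<in>\<bbbD>. h2_norm (\<lambda>z. (g \<circ> \<sigma> a) z - g a))"
    using a by (intro add_mono SUP_upper)
  finally show "h2_norm (\<lambda>z. ((\<lambda>z. f z + g z) \<circ> \<sigma> a) z - (f a + g a)) \<le> \<dots>" .
qed

lemma bmoa_seminorm_uminus: "bmoa_seminorm (\<lambda>z. - f z) = bmoa_seminorm f"
proof -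
  have "norm (- (x::complex) + y) = norm (x - y)" for x y
    by (metis norm_minus_commute uminus_add_conv_diff)
  then show ?thesis
    by (simp add: bmoa_seminorm_def h2_norm_def circle_mean2_def)
qed

lemma bmoa_norm_triangle:
  assumes "f \<in> bmoa" "g \<in> bmoa"
  shows "(\<lambda>z. f z + g z) \<in> bmoa" "bmoa_norm (\<lambda>z. f z + g z) \<le> bmoa_norm f + bmoa_norm g"
proof -
  have fin: "bmoa_seminorm f < \<infinity>" "bmoa_seminorm g < \<infinity>"
    and hol: "f holomorphic_on \<bbbD>" "g holomorphic_on \<bbbD>"
    using assms by (auto simp: bmoa_def)
  have tri: "bmoa_seminorm (\<lambda>z. f z + g z) \<le> bmoa_seminorm f + bmoa_seminorm g"
    using hol by (rule bmoa_seminorm_triangle)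
  have fin': "bmoa_seminorm f + bmoa_seminorm g < \<infinity>" using fin by simp
  show "(\<lambda>z. f z + g z) \<in> bmoa"
    using assms tri fin' by (auto simp: bmoa_def intro!: holomorphic_intros intro: le_less_trans)
  have "enn2real (bmoa_seminorm (\<lambda>z. f z + g z)) \<le> enn2real (bmoa_seminorm f + bmoa_seminorm g)"
    using tri fin' by (intro enn2real_mono) auto
  also have "\<dots> = enn2real (bmoa_seminorm f) + enn2real (bmoa_seminorm g)"
    using fin by (intro enn2real_plus) auto
  finally show "bmoa_norm (\<lambda>z. f z + g z) \<le> bmoa_norm f + bmoa_norm g"
    unfolding bmoa_norm_def using norm_triangle_ineq[of "f 0" "g 0"] by linarith
qed

lemma bmoa_uminus:
  "f \<in> bmoa \<Longrightarrow> (\<lambda>z. - f z) \<in> bmoa" "bmoa_norm (\<lambda>z. - f z) = bmoa_norm f"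
  by (auto simp: bmoa_def bmoa_norm_def bmoa_seminorm_uminus intro!: holomorphic_intros)

lemma bmoa_diff: "f \<in> bmoa \<Longrightarrow> g \<in> bmoa \<Longrightarrow> (\<lambda>z. f z - g z) \<in> bmoa"
  using bmoa_norm_triangle(1)[of f "\<lambda>z. - g z"] bmoa_uminus(1)[of g] by simp

lemma bmoa_norm_eq_0D:
  assumes f: "f \<in> bmoa" and 0: "bmoa_norm f = 0"
  shows "f = (\<lambda>_. 0)"
proof
  fix z
  have hol: "f holomorphic_on \<bbbD>" and fin: "bmoa_seminorm f < \<infinity>"
    using f by (auto simp: bmoa_def)
  have "norm (f 0) = 0" and "enn2real (bmoa_seminorm f) = 0"
    using 0 enn2real_nonneg[of "bmoa_seminorm f"] norm_ge_zero[of "f 0"]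
    unfolding bmoa_norm_def by linarith+
  then have f0: "f 0 = 0" and s0: "bmoa_seminorm f = 0"
    using fin by (auto simp: enn2real_eq_0_iff)
  have "h2_norm (\<lambda>z. (f \<circ> \<sigma> 0) z - f 0) \<le> bmoa_seminorm f"
    unfolding bmoa_seminorm_def by (rule SUP_upper) simp
  moreover have "(\<lambda>z. (f \<circ> \<sigma> 0) z - f 0) = (\<lambda>z. f (- z))"
    by (auto simp: disc_aut_def f0)
  ultimately have h0: "h2_norm (\<lambda>z. f (- z)) = 0" using s0 by simp
  show "f z = 0"
  proof (cases "z \<in> \<bbbD> \<and> z \<noteq> 0")
    case False
    then show ?thesis using f f0 by (auto simp: bmoa_def)
  next
    case True
    define r where "r = norm z"
    have r: "r \<in> {0<..<1}" using True by (auto simp: r_def)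
    have "ennreal (circle_mean2 (\<lambda>z. f (- z)) r) \<le> h2_norm (\<lambda>z. f (- z))"
      unfolding h2_norm_def using r by (rule SUP_upper)
    then have "circle_mean2 (\<lambda>z. f (- z)) r = 0"
      using h0 circle_mean2_nonneg[of "\<lambda>z. f (- z)" r] by (simp add: ennreal_eq_0_iff)
    then have i0: "integral {0..2*pi} (\<lambda>t. (norm (f (- (of_real r * cis t))))\<^sup>2) = 0"
      by (simp add: circle_mean2_def)
    have hol': "(\<lambda>z. f (- z)) holomorphic_on \<bbbD>"
      using holomorphic_on_compose_gen[of uminus \<bbbD> f \<bbbD>] hol
      by (simp add: o_def image_subset_iff holomorphic_on_minus)
    have cont: "continuous_on {0..2*pi} (\<lambda>t. (norm (f (- (of_real r * cis t))))\<^sup>2)"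
      using continuous_on_circle[OF hol' r] by (intro continuous_intros)
    obtain t where t: "t \<in> {0..2*pi}" "- z = of_real r * cis t"
    proof
      show "Arg2pi (- z) \<in> {0..2*pi}" using Arg2pi[of "- z"] by auto
      show "- z = of_real r * cis (Arg2pi (- z))"
        using Arg2pi_eq[of "- z"] by (simp add: r_def cis_conv_exp)
    qed
    have "(norm (f (- (of_real r * cis t))))\<^sup>2 = 0"
    proof (rule has_integral_0_cbox_imp_0[of 0 "2*pi" "\<lambda>t. (norm (f (- (of_real r * cis t))))\<^sup>2"])
      show "continuous_on (cbox 0 (2*pi)) (\<lambda>t. (norm (f (- (of_real r * cis t))))\<^sup>2)"
        using cont by simp
      show "((\<lambda>t. (norm (f (- (of_real r * cis t))))\<^sup>2) has_integral 0) (cbox 0 (2*pi))"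
        using integrable_integral[OF integrable_continuous_interval[OF cont]] i0 by simp
    qed (use t pi_gt_zero in \<open>auto simp: not_le\<close>)
    then show ?thesis using t(2) by (metis add.inverse_inverse norm_eq_zero zero_eq_power2)
  qed
qed

lemma Metric_space_bmoa: "Metric_space bmoa bmoa_dist"
proof
  fix f g h
  show "0 \<le> bmoa_dist f g"
    unfolding bmoa_dist_def bmoa_norm_def by simp
  show "bmoa_dist f g = bmoa_dist g f"
    using bmoa_uminus(2)[of "\<lambda>z. f z - g z"] by (simp add: bmoa_dist_def)
  assume f: "f \<in> bmoa" and g: "g \<in> bmoa"
  show "bmoa_dist f g = 0 \<longleftrightarrow> f = g"
  proof
    assume "bmoa_dist f g = 0"
    then have "(\<lambda>z. f z - g z) = (\<lambda>_. 0)"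
      unfolding bmoa_dist_def by (intro bmoa_norm_eq_0D bmoa_diff f g)
    then show "f = g" by (metis eq_iff_diff_eq_0 ext)
  next
    assume "f = g"
    moreover have "bmoa_seminorm (\<lambda>_. 0) = 0"
      by (simp add: bmoa_seminorm_def h2_norm_def circle_mean2_def bot_ennreal)
    ultimately show "bmoa_dist f g = 0"
      by (simp add: bmoa_dist_def bmoa_norm_def)
  qed
  assume h: "h \<in> bmoa"
  show "bmoa_dist f h \<le> bmoa_dist f g + bmoa_dist g h"
    using bmoa_norm_triangle(2)[OF bmoa_diff[OF f g] bmoa_diff[OF g h]]
    by (simp add: bmoa_dist_def)
qed

interpretation bmoa: Metric_space bmoa bmoa_dist
  by (rule Metric_space_bmoa)

definition bmoa_norm_topology :: "(complex \<Rightarrow> complex) topology" where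
  "bmoa_norm_topology = bmoa.mtopology"

definition bmoa_dual :: "((complex \<Rightarrow> complex) \<Rightarrow> complex) set" where
  "bmoa_dual = {L. (\<forall>f\<in>bmoa. \<forall>g\<in>bmoa. L (\<lambda>z. f z + g z) = L f + L g) \<and>
                   (\<forall>c. \<forall>f\<in>bmoa. L (\<lambda>z. c * f z) = c * L f) \<and>
                   (\<exists>K. \<forall>f\<in>bmoa. norm (L f) \<le> K * bmoa_norm f)}"

definition bmoa_weak_topology :: "(complex \<Rightarrow> complex) topology" where
  "bmoa_weak_topology =
     topology_generated_by {{f \<in> bmoa. L f \<in> U} | L U. L \<in> bmoa_dual \<and> open U}"

definition bmoa_bounded :: "(complex \<Rightarrow> complex) set \<Rightarrow> bool" where
  "bmoa_bounded B \<longleftrightarrow> B \<subseteq> bmoa \<and> (\<exists>M. \<forall>f\<in>B. bmoa_norm f \<le> M)"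

definition bmoa_compact :: "((complex \<Rightarrow> complex) \<Rightarrow> (complex \<Rightarrow> complex)) \<Rightarrow> bool" where
  "bmoa_compact T \<longleftrightarrow> T \<in> bmoa \<rightarrow> bmoa \<and>
     (\<forall>B. bmoa_bounded B \<longrightarrow> compactin bmoa_norm_topology (bmoa_norm_topology closure_of (T ` B)))"

definition bmoa_weakly_compact :: "((complex \<Rightarrow> complex) \<Rightarrow> (complex \<Rightarrow> complex)) \<Rightarrow> bool" where
  "bmoa_weakly_compact T \<longleftrightarrow> T \<in> bmoa \<rightarrow> bmoa \<and>
     (\<forall>B. bmoa_bounded B \<longrightarrow> compactin bmoa_weak_topology (bmoa_weak_topology closure_of (T ` B)))"

definition comp_op :: "(complex \<Rightarrow> complex) \<Rightarrow> (complex \<Rightarrow> complex) \<Rightarrow> (complex \<Rightarrow> complex)" where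
  "comp_op \<phi> f = (\<lambda>z. if z \<in> \<bbbD> then (f \<circ> \<phi>) z else 0)"

(* Intended for w different from \<psi> 0: then \<psi> - w does not vanish identically and zorder is
   the multiplicity of a preimage. *)
definition nevanlinna :: "(complex \<Rightarrow> complex) \<Rightarrow> complex \<Rightarrow> ennreal" where
  "nevanlinna \<psi> w =
     (\<Sum>\<^sub>\<infinity>z\<in>{z \<in> \<bbbD>. \<psi> z = w}. ennreal (of_int (zorder (\<lambda>u. \<psi> u - w) z) * ln (1 / norm z)))"

definition vanishes_at_image_boundary :: "(complex \<Rightarrow> complex) \<Rightarrow> (complex \<Rightarrow> ennreal) \<Rightarrow> bool" where
  "vanishes_at_image_boundary \<phi> F \<longleftrightarrow>
     (\<forall>\<epsilon>>0. \<exists>\<eta><1. \<forall>a\<in>\<bbbD>. norm (\<phi> a) > \<eta> \<longrightarrow> F a < ennreal \<epsilon>)"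

end

theory Submission
  imports Defs
begin

text \<open>
  Write \<open>\<psi>\<close> for the conjugate \<open>\<sigma> (\<phi> a) \<circ> \<phi> \<circ> \<sigma> a\<close>, which fixes \<open>0\<close>, and let
  \<open>garsia f a\<close> be the \<open>H\<^sup>2\<close>-norm of \<open>f \<circ> \<sigma> a - f a\<close>.

  (iv) implies (i). If \<open>garsia F \<le> 1\<close> on the disc and \<open>F 0 = 0\<close>, the \<open>H\<^sup>2\<close>-norm of \<open>F \<circ> \<psi>\<close> is at most
  \<open>6\<close> times that of \<open>\<psi>\<close>: with \<open>u\<close> the harmonic extension of \<open>|F|\<^sup>2\<close> and \<open>W = |F|\<^sup>2 - u + 2\<close>, the function
  \<open>2 |z|\<^sup>2 W\<^sup>2 + 24 |z|\<^sup>2 - |F|\<^sup>2\<close> is subharmonic. So for a bounded sequence \<open>f\<^sub>n\<close> tending to \<open>0\<close> locally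
  uniformly, \<open>garsia (f\<^sub>n \<circ> \<phi>) a\<close> is small where \<open>|\<phi> a|\<close> is close to \<open>1\<close>. Elsewhere \<open>f\<^sub>n \<circ> \<phi>\<close> is small, and the
  maximum principle for the harmonic extension of \<open>|f\<^sub>n \<circ> \<phi>|\<^sup>2\<close> transports the bound into that region.

  (ii) implies (iv). If (iv) fails along points \<open>a\<^sub>k\<close> with \<open>w\<^sub>k = \<phi> (a\<^sub>k)\<close> tending to the circle fast enough, the
  functions \<open>f\<^sub>k = \<sigma> w\<^sub>k - w\<^sub>k\<close> have bounded partial sums and are almost orthogonal to the functionals
  \<open>f \<mapsto> \<langle>f \<circ> \<sigma> a\<^sub>j - f a\<^sub>j, \<psi>\<^sub>j\<rangle>\<close>; a weak cluster point of the images of the partial sums contradicts the existence of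
  a cluster point of these functionals.

  (iii) and (iv) are equivalent by Jensen's formula for \<open>\<psi> - w\<close>: estimating \<open>ln |1 - \<psi>/w|\<close> gives
  \<open>|w|\<^sup>2 N(\<psi>, w) \<le> \<parallel>\<psi>\<parallel>\<^sup>2 / 2\<close>, and averaging over \<open>|w| = s\<close> (Cartan) bounds the mean of \<open>ln\<^sup>+ (|\<psi>|/s)\<close> by
  the supremum of \<open>N(\<psi>, w)\<close> over \<open>|w| = s\<close>.
\<close>

subsection \<open>Circular means\<close>

text \<open>Subordination alone bounds the H^2-norm of F o \<psi> by that of F and gains nothing
  from a small \<psi>. The gain comes from the Laplacian of |z|^2 W^2, which contains a positive
  multiple of |z|^2 |F'|^2 because W >= 1 and W has Laplacian 4 |F'|^2; the degeneration at z = 0 is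
  repaired by the term 24 |z|^2 and a Bloch bound for F'. For polynomial F the harmonic extension is
  Re K with K a polynomial, so the comparison function is a finite combination of terms Re (p * cnj
  q), and its sub-mean inequality can be read off Taylor coefficients. This is why estimates are
  proved for polynomials first and then transferred by dilation. In (iv) implies (i), the region
  where |\<phi>| is not close to 1 may reach the unit circle, so smallness of f_n o \<phi> there
  does not by itself control its Garsia values. In (ii) implies (iv) the contradiction is a double
  limit: the pairings of the j-th functional with the image of the N-th partial sum have
  incompatible iterated limits. Cluster points take the place of subsequences.\<close>

definition circ_mean :: "real \<Rightarrow> (complex \<Rightarrow> 'a::banach) \<Rightarrow> 'a" where
  "circ_mean r f = (1 / (2 * pi)) *\<^sub>R integral {0..2*pi} (\<lambda>t. f (of_real r * cis t))"

lemma circle_mean2_eq: "circle_mean2 f r = sqrt (circ_mean r (\<lambda>z. (norm (f z))\<^sup>2))"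
  by (simp add: circle_mean2_def circ_mean_def)

lemma continuous_on_circle_sphere:
  assumes "continuous_on (sphere 0 r) f" "r \<ge> 0"
  shows "continuous_on S (\<lambda>t. f (of_real r * cis t))"
  by (rule continuous_on_compose2[OF assms(1)]) (use assms in \<open>auto intro!: continuous_intros simp: norm_mult\<close>)

lemma integrable_on_circle:
  fixes f :: "complex \<Rightarrow> 'a::banach"
  assumes "continuous_on (sphere 0 r) f" "r \<ge> 0"
  shows "(\<lambda>t. f (of_real r * cis t)) integrable_on {0..2*pi}"
  by (intro integrable_continuous_interval continuous_on_circle_sphere assms)

lemma circ_mean_cong:
  assumes "\<And>z. norm z = r \<Longrightarrow> f z = g z" "r \<ge> 0"
  shows "circ_mean r f = circ_mean r g"
proof -
  have "(\<lambda>t. f (of_real r * cis t)) = (\<lambda>t. g (of_real r * cis t))"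
    using assms by (auto simp: norm_mult)
  then show ?thesis unfolding circ_mean_def by (rule arg_cong)
qed

lemma circ_mean_const [simp]: "circ_mean r (\<lambda>_. c) = c"
  by (simp add: circ_mean_def)

lemma circ_mean_add:
  assumes "continuous_on (sphere 0 r) f" "continuous_on (sphere 0 r) g" "r \<ge> 0"
  shows "circ_mean r (\<lambda>z. f z + g z) = circ_mean r f + circ_mean r g"
  unfolding circ_mean_def
  by (subst integral_add) (auto intro!: integrable_on_circle assms simp: scaleR_add_right)

lemma circ_mean_diff:
  assumes "continuous_on (sphere 0 r) f" "continuous_on (sphere 0 r) g" "r \<ge> 0"
  shows "circ_mean r (\<lambda>z. f z - g z) = circ_mean r f - circ_mean r g"
  unfolding circ_mean_def
  by (subst integral_diff) (auto intro!: integrable_on_circle assms simp: scaleR_diff_right)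

lemma circ_mean_bounded_linear:
  assumes "bounded_linear T" "continuous_on (sphere 0 r) f" "r \<ge> 0"
  shows "circ_mean r (\<lambda>z. T (f z)) = T (circ_mean r f)"
  unfolding circ_mean_def
  using integral_linear[OF integrable_on_circle[OF assms(2,3)] assms(1)]
  by (simp add: o_def linear_simps[OF assms(1)])

lemma circ_mean_mult_left:
  fixes f :: "complex \<Rightarrow> 'a::{banach,real_normed_algebra}"
  assumes "continuous_on (sphere 0 r) f" "r \<ge> 0"
  shows "circ_mean r (\<lambda>z. c * f z) = c * circ_mean r f"
  by (rule circ_mean_bounded_linear[OF bounded_linear_mult_right assms])

lemmas circ_mean_Re = circ_mean_bounded_linear[OF bounded_linear_Re]
lemmas circ_mean_cnj = circ_mean_bounded_linear[OF bounded_linear_cnj]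

lemma circ_mean_sum:
  assumes "\<And>i. i \<in> I \<Longrightarrow> continuous_on (sphere 0 r) (f i)" "r \<ge> 0"
  shows "circ_mean r (\<lambda>z. \<Sum>i\<in>I. f i z) = (\<Sum>i\<in>I. circ_mean r (f i))"
  using assms(1)
proof (induction I rule: infinite_finite_induct)
  case (insert x F)
  then show ?case
    by (simp add: circ_mean_add[OF _ _ assms(2)] continuous_on_sum)
qed auto

lemma circ_mean_mono:
  fixes f g :: "complex \<Rightarrow> real"
  assumes "continuous_on (sphere 0 r) f" "continuous_on (sphere 0 r) g" "r \<ge> 0"
    "\<And>z. norm z = r \<Longrightarrow> f z \<le> g z"
  shows "circ_mean r f \<le> circ_mean r g"
  unfolding circ_mean_def real_scaleR_def
  by (intro mult_left_mono integral_le integrable_on_circle assms) (auto simp: norm_mult assms)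

lemma circ_mean_nonneg:
  fixes f :: "complex \<Rightarrow> real"
  assumes "continuous_on (sphere 0 r) f" "r \<ge> 0" "\<And>z. norm z = r \<Longrightarrow> f z \<ge> 0"
  shows "circ_mean r f \<ge> 0"
  using circ_mean_mono[of r "\<lambda>_. 0" f] assms by simp

lemma norm_circ_mean_le:
  fixes f :: "complex \<Rightarrow> 'a::euclidean_space"
  assumes "continuous_on (sphere 0 r) f" "r \<ge> 0"
  shows "norm (circ_mean r f) \<le> circ_mean r (\<lambda>z. norm (f z))"
  unfolding circ_mean_def norm_scaleR
  by (auto intro!: mult_left_mono integral_norm_bound_integral integrable_on_circle continuous_intros assms divide_right_mono)

lemma circ_mean_norm_bound:
  fixes f :: "complex \<Rightarrow> 'a::euclidean_space"
  assumes "continuous_on (sphere 0 r) f" "r \<ge> 0" "\<And>z. norm z = r \<Longrightarrow> norm (f z) \<le> B"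
  shows "norm (circ_mean r f) \<le> B"
proof -
  have "norm (circ_mean r f) \<le> circ_mean r (\<lambda>z. norm (f z))"
    by (rule norm_circ_mean_le[OF assms(1,2)])
  also have "\<dots> \<le> circ_mean r (\<lambda>_. B)"
    by (intro circ_mean_mono continuous_intros assms) auto
  finally show ?thesis by simp
qed

lemma circ_mean_uniform_limit:
  fixes f :: "nat \<Rightarrow> complex \<Rightarrow> 'a::euclidean_space"
  assumes "uniform_limit (sphere 0 r) f g sequentially" "r \<ge> 0"
    "\<And>n. continuous_on (sphere 0 r) (f n)"
  shows "(\<lambda>n. circ_mean r (f n)) \<longlonglongrightarrow> circ_mean r g"
proof -
  have g: "continuous_on (sphere 0 r) g"
    by (rule uniform_limit_theorem[OF _ assms(1)]) (use assms in auto)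
  show ?thesis
  proof (rule tendstoI)
    fix e :: real assume e: "e > 0"
    have "\<forall>\<^sub>F n in sequentially. \<forall>z\<in>sphere 0 r. dist (f n z) (g z) < e/2"
      using assms(1) e unfolding uniform_limit_iff by (meson half_gt_zero)
    then show "\<forall>\<^sub>F n in sequentially. dist (circ_mean r (f n)) (circ_mean r g) < e"
    proof eventually_elim
      case (elim n)
      have "dist (circ_mean r (f n)) (circ_mean r g) = norm (circ_mean r (\<lambda>z. f n z - g z))"
        by (simp add: dist_norm circ_mean_diff[OF assms(3) g assms(2)])
      also have "\<dots> \<le> e/2"
        by (rule circ_mean_norm_bound) (use elim assms g in \<open>auto intro!: continuous_intros simp: dist_norm less_imp_le\<close>)
      finally show ?case using e by simp
    qed
  qed
qed

lemma circ_mean_holomorphic: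
  assumes "f holomorphic_on ball 0 R" "0 \<le> r" "r < R"
  shows "circ_mean r f = f 0"
proof (cases "r = 0")
  case True
  then show ?thesis by (simp add: circ_mean_def)
next
  case False
  have "((\<lambda>u. f u / (u - 0)) has_contour_integral (2 * of_real pi * \<i> * f 0)) (circlepath 0 r)"
    by (rule Cauchy_integral_circlepath_simple)
       (use assms False in \<open>auto intro: holomorphic_on_subset\<close>)
  then have "((\<lambda>t. f (of_real r * cis t) / (of_real r * cis t) * of_real r * \<i> * cis t)
     has_integral (2 * of_real pi * \<i> * f 0)) {0..2*pi}"
    unfolding circlepath_def by (subst (asm) has_contour_integral_part_circlepath_iff) auto
  then have "((\<lambda>t. f (of_real r * cis t) * \<i>) has_integral (2 * of_real pi * \<i> * f 0)) {0..2*pi}"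
    using False by (simp add: field_simps)
  then have "((\<lambda>t. (f (of_real r * cis t) * \<i>) * (-\<i>)) has_integral (2 * of_real pi * \<i> * f 0) * (-\<i>)) {0..2*pi}"
    by (rule has_integral_mult_left)
  then have "((\<lambda>t. f (of_real r * cis t)) has_integral (2 * of_real pi * f 0)) {0..2*pi}"
    by (simp add: algebra_simps)
  then show ?thesis
    by (simp add: circ_mean_def integral_unique scaleR_conv_of_real)
qed

lemma power_series_uniform_limit_cball:
  fixes a :: "nat \<Rightarrow> complex"
  assumes s: "\<And>z. norm z < R \<Longrightarrow> (\<lambda>n. a n * z ^ n) sums f z" and r: "0 \<le> r" "r < R"
  shows "uniform_limit (cball 0 r) (\<lambda>n z. \<Sum>i<n. a i * z ^ i) f sequentially"
proof -
  \<comment> \<open>Convergence at one point t strictly between r and R forces a radius of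
    convergence of at least t, hence larger than r.\<close>
  define t where "t = (r + R) / 2"
  have t: "r < t" "t < R" "0 \<le> t" using r by (auto simp: t_def)
  have "norm (complex_of_real t) < R" using t by simp
  then have "summable (\<lambda>n. a n * (of_real t) ^ n)"
    using s sums_summable by blast
  then have "ereal t \<le> conv_radius a"
    using conv_radius_geI[of a "of_real t"] t by simp
  moreover have "ereal r < ereal t" using t by simp
  ultimately have rr: "ereal r < conv_radius a" by (rule less_le_trans[rotated])
  have "uniform_limit (cball 0 r) (\<lambda>n x. \<Sum>i<n. a i * (x - 0) ^ i) (\<lambda>x. \<Sum>i. a i * (x - 0) ^ i) sequentially"
    by (rule powser_uniform_limit) (use rr in simp)
  moreover have "(\<Sum>i. a i * (x - 0) ^ i) = f x" if "x \<in> cball 0 r" for x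
    using s[of x] that r by (auto simp: sums_iff)
  ultimately show ?thesis
    by (simp add: uniform_limit_iff)
qed

lemma taylor_polynomial_approximation:
  assumes f: "f holomorphic_on ball 0 R" and r: "r < R" and e: "e > 0"
  obtains p where "\<And>z. norm z \<le> r \<Longrightarrow> norm (f z - poly p z) < e"
proof (cases "r < 0")
  case True
  then have "\<not> norm z \<le> r" for z :: complex by (meson norm_ge_zero not_le order.strict_trans1)
  then show ?thesis using that by blast
next
  case False
  define a where "a n = (deriv ^^ n) f 0 / fact n" for n
  have s: "(\<lambda>n. a n * z ^ n) sums f z" if "norm z < R" for z
    using holomorphic_power_series[OF f, of z] that by (simp add: a_def)
  have "\<forall>\<^sub>F n in sequentially. \<forall>x\<in>cball 0 r. dist (\<Sum>i<n. a i * x ^ i) (f x) < e"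
    using power_series_uniform_limit_cball[OF s _ r] False e unfolding uniform_limit_iff by auto
  then obtain n where n: "\<And>x. norm x \<le> r \<Longrightarrow> dist (\<Sum>i<n. a i * x ^ i) (f x) < e"
    by (force simp: eventually_sequentially)
  show ?thesis
    by (rule that[of "\<Sum>i<n. monom (a i) i"])
       (use n in \<open>simp add: poly_sum poly_monom dist_norm norm_minus_commute\<close>)
qed

subsection \<open>Littlewood subordination\<close>

lemma holomorphic_continuous_on_sphere:
  assumes "f holomorphic_on ball 0 R" "r < R"
  shows "continuous_on (sphere 0 r) f"
  by (rule continuous_on_subset[OF holomorphic_on_imp_continuous_on[OF assms(1)]]) (use assms in auto)

lemma holomorphic_on_disc_compose:
  assumes "f holomorphic_on \<bbbD>" "\<omega> holomorphic_on \<bbbD>" "\<omega> ` \<bbbD> \<subseteq> \<bbbD>"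
  shows "(\<lambda>z. f (\<omega> z)) holomorphic_on \<bbbD>"
  using holomorphic_on_compose_gen[OF assms(2,1,3)] by (simp add: o_def)

lemma norm_add_sq: "(norm (x + y :: complex))\<^sup>2 = (norm x)\<^sup>2 + (norm y)\<^sup>2 + 2 * Re (cnj x * y)"
  by (simp add: cmod_power2) (simp add: power2_eq_square algebra_simps)

text \<open>Pythagoras: the cross term is the real part of a holomorphic function vanishing at 0, so
  its mean is zero.\<close>

lemma circ_mean_norm_add_sq:
  assumes "g holomorphic_on ball 0 R" "g 0 = 0" "0 \<le> r" "r < R"
  shows "circ_mean r (\<lambda>z. (norm (c + g z))\<^sup>2) = (norm c)\<^sup>2 + circ_mean r (\<lambda>z. (norm (g z))\<^sup>2)"
proof -
  have cg: "continuous_on (sphere 0 r) g"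
    by (rule holomorphic_continuous_on_sphere) (use assms in auto)
  have "circ_mean r (\<lambda>z. Re (cnj c * g z)) = Re (circ_mean r (\<lambda>z. cnj c * g z))"
    by (intro circ_mean_Re continuous_intros cg assms)
  also have "circ_mean r (\<lambda>z. cnj c * g z) = cnj c * g 0"
    by (rule circ_mean_holomorphic[of _ R]) (use assms in \<open>auto intro!: holomorphic_intros\<close>)
  finally have 0: "circ_mean r (\<lambda>z. Re (cnj c * g z)) = 0" using assms by simp
  have "circ_mean r (\<lambda>z. (norm (c + g z))\<^sup>2)
      = circ_mean r (\<lambda>z. ((norm c)\<^sup>2 + (norm (g z))\<^sup>2) + 2 * Re (cnj c * g z))"
    by (simp add: norm_add_sq)
  also have "\<dots> = circ_mean r (\<lambda>z. (norm c)\<^sup>2 + (norm (g z))\<^sup>2) + circ_mean r (\<lambda>z. 2 * Re (cnj c * g z))"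
    by (intro circ_mean_add continuous_intros cg assms)
  also have "circ_mean r (\<lambda>z. (norm c)\<^sup>2 + (norm (g z))\<^sup>2) = circ_mean r (\<lambda>z. (norm c)\<^sup>2) + circ_mean r (\<lambda>z. (norm (g z))\<^sup>2)"
    by (intro circ_mean_add continuous_intros cg assms)
  also have "circ_mean r (\<lambda>z. 2 * Re (cnj c * g z)) = 2 * circ_mean r (\<lambda>z. Re (cnj c * g z))"
    by (intro circ_mean_mult_left continuous_intros cg assms)
  finally show ?thesis using 0 by simp
qed

lemma circ_mean_norm_diff_sq:
  assumes "g holomorphic_on ball 0 R" "0 \<le> r" "r < R"
  shows "circ_mean r (\<lambda>z. (norm (g z - g 0))\<^sup>2) = circ_mean r (\<lambda>z. (norm (g z))\<^sup>2) - (norm (g 0))\<^sup>2"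
  using circ_mean_norm_add_sq[of "\<lambda>z. g z - g 0" R r "g 0"] holomorphic_on_diff[OF assms(1) holomorphic_on_const] assms(2,3)
  by simp

text \<open>Induction along Horner's scheme a + z p: the constant splits off orthogonally on both
  sides, and on |z| = r Schwarz's lemma bounds the factor |\<omega> z| by r = |z|.\<close>

lemma littlewood_subordination_poly:
  assumes \<omega>: "\<omega> holomorphic_on \<bbbD>" "\<omega> ` \<bbbD> \<subseteq> \<bbbD>" "\<omega> 0 = 0" and r: "0 \<le> r" "r < 1"
  shows "circ_mean r (\<lambda>z. (norm (poly p (\<omega> z)))\<^sup>2) \<le> circ_mean r (\<lambda>z. (norm (poly p z))\<^sup>2)"
proof (induction p)
  case 0
  then show ?case by simp
next
  case (pCons a p)
  have hol: "(\<lambda>z. poly p (\<omega> z)) holomorphic_on \<bbbD>"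
    by (intro holomorphic_intros \<omega>)
  note cont = holomorphic_continuous_on_sphere[OF _ r(2)]
  have sch: "norm (\<omega> z) \<le> norm z" if "norm z < 1" for z
    by (rule Schwarz_Lemma(1)[OF \<omega>(1,3) _ that]) (use \<omega>(2) in force)
  have "circ_mean r (\<lambda>z. (norm (poly (pCons a p) (\<omega> z)))\<^sup>2)
      = (norm a)\<^sup>2 + circ_mean r (\<lambda>z. (norm (\<omega> z * poly p (\<omega> z)))\<^sup>2)"
    unfolding poly_pCons
    by (rule circ_mean_norm_add_sq[OF holomorphic_on_mult[OF \<omega>(1) hol]]) (use \<omega>(3) r in auto)
  also have "circ_mean r (\<lambda>z. (norm (\<omega> z * poly p (\<omega> z)))\<^sup>2) \<le> circ_mean r (\<lambda>z. r\<^sup>2 * (norm (poly p (\<omega> z)))\<^sup>2)"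
  proof (rule circ_mean_mono)
    fix z :: complex assume z: "norm z = r"
    then have "norm (\<omega> z) \<le> r" using sch[of z] r by simp
    then show "(norm (\<omega> z * poly p (\<omega> z)))\<^sup>2 \<le> r\<^sup>2 * (norm (poly p (\<omega> z)))\<^sup>2"
      by (simp add: norm_mult power_mult_distrib mult_right_mono power_mono)
  qed (use r in \<open>auto intro!: continuous_intros cont hol \<omega> holomorphic_on_mult\<close>)
  also have "\<dots> = r\<^sup>2 * circ_mean r (\<lambda>z. (norm (poly p (\<omega> z)))\<^sup>2)"
    by (intro circ_mean_mult_left continuous_intros cont hol r \<omega>)
  also have "\<dots> \<le> r\<^sup>2 * circ_mean r (\<lambda>z. (norm (poly p z))\<^sup>2)"
    by (intro mult_left_mono pCons.IH) auto
  also have "\<dots> = circ_mean r (\<lambda>z. r\<^sup>2 * (norm (poly p z))\<^sup>2)"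
    by (intro circ_mean_mult_left[symmetric] continuous_intros r)
  also have "\<dots> = circ_mean r (\<lambda>z. (norm (z * poly p z))\<^sup>2)"
    using r by (intro circ_mean_cong) (auto simp: norm_mult power_mult_distrib)
  also have "(norm a)\<^sup>2 + \<dots> = circ_mean r (\<lambda>z. (norm (poly (pCons a p) z))\<^sup>2)"
    unfolding poly_pCons
    by (rule circ_mean_norm_add_sq[where R = 1, symmetric]) (use r in \<open>auto intro!: holomorphic_intros\<close>)
  finally show ?case by simp
qed

lemma circle_mean2_le_bound:
  assumes "continuous_on (sphere 0 r) f" "0 \<le> r" "\<And>z. norm z = r \<Longrightarrow> norm (f z) \<le> B"
  shows "circle_mean2 f r \<le> B"
proof -
  have B: "B \<ge> 0" using assms(2) assms(3)[of "of_real r"] by (simp add: order_trans[OF norm_ge_zero])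
  have "circ_mean r (\<lambda>z. (norm (f z))\<^sup>2) \<le> circ_mean r (\<lambda>z. B\<^sup>2)"
    using assms by (intro circ_mean_mono continuous_intros power_mono) auto
  then show ?thesis unfolding circle_mean2_eq using B by (simp add: real_le_lsqrt)
qed

lemma circle_mean2_approx:
  assumes "f holomorphic_on \<bbbD>" "g holomorphic_on \<bbbD>" "0 < r" "r < 1"
    "\<And>z. norm z = r \<Longrightarrow> norm (f z - g z) \<le> e"
  shows "circle_mean2 f r \<le> circle_mean2 g r + e"
proof -
  have "circle_mean2 (\<lambda>z. g z + (f z - g z)) r \<le> circle_mean2 g r + circle_mean2 (\<lambda>z. f z - g z) r"
    using assms by (intro circle_mean2_triangle holomorphic_intros) auto
  moreover have "circle_mean2 (\<lambda>z. f z - g z) r \<le> e"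
    using assms by (intro circle_mean2_le_bound holomorphic_continuous_on_sphere holomorphic_intros) auto
  ultimately show ?thesis by simp
qed

theorem littlewood_subordination:
  assumes f: "f holomorphic_on \<bbbD>"
    and \<omega>: "\<omega> holomorphic_on \<bbbD>" "\<omega> ` \<bbbD> \<subseteq> \<bbbD>" "\<omega> 0 = 0" and r: "0 < r" "r < 1"
  shows "circle_mean2 (\<lambda>z. f (\<omega> z)) r \<le> circle_mean2 f r"
proof (rule field_le_epsilon)
  fix e :: real assume e: "e > 0"
  \<comment> \<open>One polynomial serves both sides, as \<omega> maps the closed disc of radius r
    into itself.\<close>
  obtain p where p: "\<And>z. norm z \<le> r \<Longrightarrow> norm (f z - poly p z) < e/2"
    using taylor_polynomial_approximation[OF f, of r "e/2"] r e by auto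
  have sch: "norm (\<omega> z) \<le> norm z" if "norm z < 1" for z
    by (rule Schwarz_Lemma(1)[OF \<omega>(1,3) _ that]) (use \<omega>(2) in force)
  have "circle_mean2 (\<lambda>z. f (\<omega> z)) r \<le> circle_mean2 (\<lambda>z. poly p (\<omega> z)) r + e/2"
  proof (rule circle_mean2_approx)
    fix z :: complex assume "norm z = r"
    then show "norm (f (\<omega> z) - poly p (\<omega> z)) \<le> e/2"
      using p[of "\<omega> z"] sch[of z] r by auto
  qed (use r f \<omega> in \<open>auto intro!: holomorphic_intros holomorphic_on_disc_compose[OF f]\<close>)
  also have "circle_mean2 (\<lambda>z. poly p (\<omega> z)) r \<le> circle_mean2 (poly p) r"
    unfolding circle_mean2_eq using littlewood_subordination_poly[OF \<omega>] r by simp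
  also have "\<dots> \<le> circle_mean2 f r + e/2"
    by (rule circle_mean2_approx)
       (use r f p in \<open>auto intro!: holomorphic_intros simp: norm_minus_commute less_imp_le\<close>)
  finally show "circle_mean2 (\<lambda>z. f (\<omega> z)) r \<le> circle_mean2 f r + e" by simp
qed

lemma h2_norm_le_iff: "M \<ge> 0 \<Longrightarrow> h2_norm f \<le> ennreal M \<longleftrightarrow> (\<forall>r\<in>{0<..<1}. circle_mean2 f r \<le> M)"
  by (simp add: h2_norm_def SUP_le_iff)

lemma circle_mean2_le_h2_norm:
  assumes "h2_norm f \<le> ennreal M" "M \<ge> 0" "0 < r" "r < 1"
  shows "circle_mean2 f r \<le> M"
  using assms h2_norm_le_iff by auto

lemma h2_norm_subordination:
  assumes "f holomorphic_on \<bbbD>" "\<omega> holomorphic_on \<bbbD>" "\<omega> ` \<bbbD> \<subseteq> \<bbbD>" "\<omega> 0 = 0"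
  shows "h2_norm (\<lambda>z. f (\<omega> z)) \<le> h2_norm f"
  unfolding h2_norm_def
  by (intro SUP_mono) (use littlewood_subordination[OF assms] in \<open>force intro!: ennreal_leI\<close>)

subsection \<open>Sub-mean values of Hermitian sums\<close>

lemma circ_mean_powers:
  assumes "0 \<le> r"
  shows "circ_mean r (\<lambda>z. z ^ m * cnj (z ^ n)) = (if m = n then of_real (r ^ (2*n)) else 0)"
proof -
  have *: "circ_mean r (\<lambda>z. z ^ m * cnj (z ^ n)) = (if m = n then of_real (r ^ (2*n)) else 0)" if "n \<le> m" for m n
  proof -
    have "z ^ m * cnj (z ^ n) = of_real (r ^ (2*n)) * z ^ (m - n)" if z: "norm z = r" for z
    proof -
      have "z ^ m = z ^ (m - n) * z ^ n" using \<open>n \<le> m\<close> by (simp flip: power_add)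
      then have "z ^ m * cnj (z ^ n) = z ^ (m - n) * (z * cnj z) ^ n"
        by (simp add: power_mult_distrib)
      also have "z * cnj z = of_real (r\<^sup>2)" using z complex_norm_square[of z] by simp
      finally show ?thesis by (simp only: power_mult of_real_power) (simp add: mult.commute)
    qed
    then have "circ_mean r (\<lambda>z. z ^ m * cnj (z ^ n)) = circ_mean r (\<lambda>z. of_real (r ^ (2*n)) * z ^ (m - n))"
      by (rule circ_mean_cong) (use assms in auto)
    also have "\<dots> = of_real (r ^ (2*n)) * 0 ^ (m - n)"
      by (rule circ_mean_holomorphic[of _ "r+1"]) (use assms in \<open>auto intro!: holomorphic_intros\<close>)
    finally show ?thesis using that by (auto simp: power_0_left)
  qed
  show ?thesis
  proof (cases "n \<le> m")
    case False
    have "circ_mean r (\<lambda>z. z ^ m * cnj (z ^ n)) = circ_mean r (\<lambda>z. cnj (z ^ n * cnj (z ^ m)))"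
      by (simp add: mult.commute)
    also have "\<dots> = cnj (circ_mean r (\<lambda>z. z ^ n * cnj (z ^ m)))"
      by (intro circ_mean_cnj continuous_intros assms)
    finally show ?thesis using *[of m n] False by auto
  qed (use * in auto)
qed

text \<open>The polarized form is wanted because the later comparison functions contain products p *
  cnj q with p different from q.\<close>

lemma parseval_circ_mean:
  assumes a: "\<And>z. norm z < 1 \<Longrightarrow> (\<lambda>n. a n * z ^ n) sums f z"
    and b: "\<And>z. norm z < 1 \<Longrightarrow> (\<lambda>n. b n * z ^ n) sums g z"
    and f: "f holomorphic_on \<bbbD>" and g: "g holomorphic_on \<bbbD>" and r: "0 \<le> r" "r < 1"
  shows "(\<lambda>n. a n * cnj (b n) * of_real (r ^ (2*n))) sums circ_mean r (\<lambda>z. f z * cnj (g z))"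
proof -
  note cf = holomorphic_continuous_on_sphere[OF f r(2)]
  note cg = holomorphic_continuous_on_sphere[OF g r(2)]
  have bdd: "bounded (h ` sphere 0 r)" if "continuous_on (sphere 0 r) h" for h :: "complex \<Rightarrow> complex"
    using compact_continuous_image[OF that] compact_imp_bounded by auto
  \<comment> \<open>First the series of g against a single power, then the series of f against g:
    each interchange with the mean is one uniform limit.\<close>
  have 1: "circ_mean r (\<lambda>z. z ^ n * cnj (g z)) = cnj (b n) * of_real (r ^ (2*n))" for n
  proof -
    have "uniform_limit (sphere 0 r) (\<lambda>N z. (\<Sum>i<N. b i * z ^ i) * cnj (z ^ n)) (\<lambda>z. g z * cnj (z ^ n)) sequentially"
      by (intro uniform_lim_mult uniform_limit_on_subset[OF power_series_uniform_limit_cball[OF b r] sphere_cball] uniform_limit_const bdd cg continuous_intros)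
    then have "(\<lambda>N. circ_mean r (\<lambda>z. (\<Sum>i<N. b i * z ^ i) * cnj (z ^ n))) \<longlonglongrightarrow> circ_mean r (\<lambda>z. g z * cnj (z ^ n))"
      by (rule circ_mean_uniform_limit) (use r in \<open>auto intro!: continuous_intros\<close>)
    moreover have "circ_mean r (\<lambda>z. (\<Sum>i<N. b i * z ^ i) * cnj (z ^ n)) = b n * of_real (r ^ (2*n))" if "N > n" for N
    proof -
      have "circ_mean r (\<lambda>z. (\<Sum>i<N. b i * z ^ i) * cnj (z ^ n)) = circ_mean r (\<lambda>z. \<Sum>i<N. b i * (z ^ i * cnj (z ^ n)))"
        by (simp add: sum_distrib_right mult.assoc)
      also have "\<dots> = (\<Sum>i<N. b i * circ_mean r (\<lambda>z. z ^ i * cnj (z ^ n)))"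
        by (subst circ_mean_sum) (auto intro!: continuous_intros r sum.cong circ_mean_mult_left)
      also have "\<dots> = (\<Sum>i<N. if i = n then b n * of_real (r ^ (2*n)) else 0)"
        by (intro sum.cong refl, subst circ_mean_powers[OF r(1)]) auto
      finally show ?thesis using that by simp
    qed
    then have "(\<lambda>N. circ_mean r (\<lambda>z. (\<Sum>i<N. b i * z ^ i) * cnj (z ^ n))) \<longlonglongrightarrow> b n * of_real (r ^ (2*n))"
      by (intro tendsto_eventually eventually_mono[OF eventually_gt_at_top[of n]])
    ultimately have "circ_mean r (\<lambda>z. g z * cnj (z ^ n)) = b n * of_real (r ^ (2*n))"
      by (rule LIMSEQ_unique)
    moreover have "circ_mean r (\<lambda>z. z ^ n * cnj (g z)) = cnj (circ_mean r (\<lambda>z. g z * cnj (z ^ n)))"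
      by (subst circ_mean_cnj[symmetric]) (auto intro!: continuous_intros cg r simp: mult.commute)
    ultimately show ?thesis by simp
  qed
  have "uniform_limit (sphere 0 r) (\<lambda>N z. (\<Sum>i<N. a i * z ^ i) * cnj (g z)) (\<lambda>z. f z * cnj (g z)) sequentially"
    by (intro uniform_lim_mult uniform_limit_on_subset[OF power_series_uniform_limit_cball[OF a r] sphere_cball] uniform_limit_const bdd cf cg continuous_intros)
  then have "(\<lambda>N. circ_mean r (\<lambda>z. (\<Sum>i<N. a i * z ^ i) * cnj (g z))) \<longlonglongrightarrow> circ_mean r (\<lambda>z. f z * cnj (g z))"
    by (rule circ_mean_uniform_limit) (use r cg in \<open>auto intro!: continuous_intros\<close>)
  moreover have "circ_mean r (\<lambda>z. (\<Sum>i<N. a i * z ^ i) * cnj (g z)) = (\<Sum>i<N. a i * cnj (b i) * of_real (r ^ (2*i)))" for N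
  proof -
    have "circ_mean r (\<lambda>z. (\<Sum>i<N. a i * z ^ i) * cnj (g z)) = circ_mean r (\<lambda>z. \<Sum>i<N. a i * (z ^ i * cnj (g z)))"
      by (simp add: sum_distrib_right mult.assoc)
    also have "\<dots> = (\<Sum>i<N. a i * circ_mean r (\<lambda>z. z ^ i * cnj (g z)))"
      by (subst circ_mean_sum) (auto intro!: continuous_intros r cg sum.cong circ_mean_mult_left)
    finally show ?thesis by (simp add: 1 mult.assoc)
  qed
  ultimately show ?thesis by (simp add: sums_def)
qed

text \<open>\<open>Y\<close> stands for a sum of terms Re (p * cnj q) and \<open>Q\<close> for the
  sum of the Re (p' * cnj q'), a quarter of the Laplacian of \<open>Y\<close>. Angular averaging
  kills the off-diagonal terms, so \<open>c n\<close> is the diagonal Taylor coefficient, and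
  differentiating both factors produces (n+1)^2 times \<open>c (Suc n)\<close>.\<close>

definition hermitian_coeffs :: "(nat \<Rightarrow> real) \<Rightarrow> (complex \<Rightarrow> real) \<Rightarrow> (complex \<Rightarrow> real) \<Rightarrow> bool" where
  "hermitian_coeffs c Y Q \<longleftrightarrow> continuous_on \<bbbD> Y \<and> continuous_on \<bbbD> Q \<and> (\<forall>r. 0 \<le> r \<longrightarrow> r < 1 \<longrightarrow>
     (\<lambda>n. c n * r ^ (2*n)) sums circ_mean r Y \<and>
     (\<lambda>n. (real (Suc n))\<^sup>2 * c (Suc n) * r ^ (2*n)) sums circ_mean r Q)"

definition hermitian_pair :: "(complex \<Rightarrow> real) \<Rightarrow> (complex \<Rightarrow> real) \<Rightarrow> bool" where
  "hermitian_pair Y Q \<longleftrightarrow> (\<exists>c. hermitian_coeffs c Y Q)"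

lemma hermitian_coeffsD:
  assumes "hermitian_coeffs c Y Q"
  shows "continuous_on \<bbbD> Y" "continuous_on \<bbbD> Q"
    "0 \<le> r \<Longrightarrow> r < 1 \<Longrightarrow> (\<lambda>n. c n * r ^ (2*n)) sums circ_mean r Y"
    "0 \<le> r \<Longrightarrow> r < 1 \<Longrightarrow> (\<lambda>n. (real (Suc n))\<^sup>2 * c (Suc n) * r ^ (2*n)) sums circ_mean r Q"
  using assms unfolding hermitian_coeffs_def by blast+

lemma continuous_on_disc_sphere: "continuous_on \<bbbD> f \<Longrightarrow> r < 1 \<Longrightarrow> continuous_on (sphere 0 r) f"
  by (erule continuous_on_subset) auto

lemma hermitian_pair_add:
  assumes "hermitian_pair Y1 Q1" "hermitian_pair Y2 Q2"
  shows "hermitian_pair (\<lambda>z. Y1 z + Y2 z) (\<lambda>z. Q1 z + Q2 z)"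
proof -
  obtain c1 where "hermitian_coeffs c1 Y1 Q1" using assms(1) by (auto simp: hermitian_pair_def)
  note 1 = hermitian_coeffsD[OF this]
  obtain c2 where "hermitian_coeffs c2 Y2 Q2" using assms(2) by (auto simp: hermitian_pair_def)
  note 2 = hermitian_coeffsD[OF this]
  note co = 1(1) 2(1) 1(2) 2(2)
  show ?thesis
    unfolding hermitian_pair_def hermitian_coeffs_def
  proof (intro exI[of _ "\<lambda>n. c1 n + c2 n"] conjI allI impI)
    fix r :: real assume r: "0 \<le> r" "r < 1"
    show "(\<lambda>n. (c1 n + c2 n) * r ^ (2*n)) sums circ_mean r (\<lambda>z. Y1 z + Y2 z)"
      using sums_add[OF 1(3)[OF r] 2(3)[OF r]]
      by (simp add: circ_mean_add continuous_on_disc_sphere co r distrib_right)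
    show "(\<lambda>n. (real (Suc n))\<^sup>2 * (c1 (Suc n) + c2 (Suc n)) * r ^ (2*n)) sums circ_mean r (\<lambda>z. Q1 z + Q2 z)"
      using sums_add[OF 1(4)[OF r] 2(4)[OF r]]
      by (simp only: circ_mean_add continuous_on_disc_sphere co r distrib_right distrib_left)
  qed (intro continuous_intros co)+
qed

lemma hermitian_pair_cmult:
  assumes "hermitian_pair Y Q"
  shows "hermitian_pair (\<lambda>z. k * Y z) (\<lambda>z. k * Q z)"
proof -
  obtain c where "hermitian_coeffs c Y Q" using assms by (auto simp: hermitian_pair_def)
  note co = hermitian_coeffsD[OF this]
  note c = co(3,4)
  show ?thesis
    unfolding hermitian_pair_def hermitian_coeffs_def
  proof (intro exI[of _ "\<lambda>n. k * c n"] conjI allI impI)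
    fix r :: real assume r: "0 \<le> r" "r < 1"
    show "(\<lambda>n. (k * c n) * r ^ (2*n)) sums circ_mean r (\<lambda>z. k * Y z)"
      using sums_mult[OF c(1)[OF r], of k]
      by (simp add: circ_mean_mult_left continuous_on_disc_sphere co r mult.assoc)
    show "(\<lambda>n. (real (Suc n))\<^sup>2 * (k * c (Suc n)) * r ^ (2*n)) sums circ_mean r (\<lambda>z. k * Q z)"
      using sums_mult[OF c(2)[OF r], of k]
      by (simp only: circ_mean_mult_left continuous_on_disc_sphere co r mult_ac)
  qed (intro continuous_intros co(1,2))+
qed

lemma hermitian_pair_product:
  assumes p: "p holomorphic_on \<bbbD>" and q: "q holomorphic_on \<bbbD>"
  shows "hermitian_pair (\<lambda>z. Re (p z * cnj (q z))) (\<lambda>z. Re (deriv p z * cnj (deriv q z)))"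
proof -
  define a where "a n = (deriv ^^ n) p 0 / fact n" for n
  define b where "b n = (deriv ^^ n) q 0 / fact n" for n
  have a: "(\<lambda>n. a n * z ^ n) sums p z" if "norm z < 1" for z
    using holomorphic_power_series[OF p, of z] that by (simp add: a_def)
  have b: "(\<lambda>n. b n * z ^ n) sums q z" if "norm z < 1" for z
    using holomorphic_power_series[OF q, of z] that by (simp add: b_def)
  have hd: "deriv p holomorphic_on \<bbbD>" "deriv q holomorphic_on \<bbbD>"
    using p q by (auto intro: holomorphic_deriv)
  have der: "(\<lambda>n. (of_nat (Suc n) * ((deriv ^^ Suc n) f 0 / fact (Suc n))) * z ^ n) sums deriv f z"
    if "f holomorphic_on \<bbbD>" "norm z < 1" for f z
  proof -
    have "(of_nat (Suc n) * ((deriv ^^ Suc n) f 0 / fact (Suc n))) = (deriv ^^ n) (deriv f) 0 / fact n" for n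
      by (subst funpow_Suc_right) (simp add: o_def del: of_nat_Suc)
    then show ?thesis
      using holomorphic_power_series[of "deriv f" 0 1 z] that holomorphic_deriv[OF that(1)] by simp
  qed
  note a' = der[OF p, folded a_def] and b' = der[OF q, folded b_def]
  note cp = holomorphic_on_imp_continuous_on[OF p] and cq = holomorphic_on_imp_continuous_on[OF q]
  note cd = holomorphic_on_imp_continuous_on[OF hd(1)] holomorphic_on_imp_continuous_on[OF hd(2)]
  show ?thesis
    unfolding hermitian_pair_def hermitian_coeffs_def
  proof (intro exI[of _ "\<lambda>n. Re (a n * cnj (b n))"] conjI allI impI)
    fix r :: real assume r: "0 \<le> r" "r < 1"
    have "(\<lambda>n. Re (a n * cnj (b n) * of_real (r ^ (2*n)))) sums Re (circ_mean r (\<lambda>z. p z * cnj (q z)))"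
      by (rule sums_Re[OF parseval_circ_mean[OF a b p q r]])
    then show "(\<lambda>n. Re (a n * cnj (b n)) * r ^ (2*n)) sums circ_mean r (\<lambda>z. Re (p z * cnj (q z)))"
      by (subst circ_mean_Re) (auto intro!: continuous_intros continuous_on_disc_sphere cp cq r simp del: of_real_power)
    have "(\<lambda>n. Re ((of_nat (Suc n) * a (Suc n)) * cnj (of_nat (Suc n) * b (Suc n)) * of_real (r ^ (2*n))))
        sums Re (circ_mean r (\<lambda>z. deriv p z * cnj (deriv q z)))"
      by (rule sums_Re[OF parseval_circ_mean[OF a' b' hd r]])
    also have "(\<lambda>n. Re ((of_nat (Suc n) * a (Suc n)) * cnj (of_nat (Suc n) * b (Suc n)) * of_real (r ^ (2*n))))
       = (\<lambda>n. (real (Suc n))\<^sup>2 * Re (a (Suc n) * cnj (b (Suc n))) * r ^ (2*n))"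
    proof
      fix n
      have "Re ((of_real x * u) * cnj (of_real x * v) * of_real y) = x\<^sup>2 * Re (u * cnj v) * y" for x y :: real and u v
        by (simp add: power2_eq_square algebra_simps)
      from this[of "real (Suc n)" "a (Suc n)" "b (Suc n)" "r ^ (2*n)"]
      show "Re ((of_nat (Suc n) * a (Suc n)) * cnj (of_nat (Suc n) * b (Suc n)) * of_real (r ^ (2*n))) =
        (real (Suc n))\<^sup>2 * Re (a (Suc n) * cnj (b (Suc n))) * r ^ (2*n)"
        by (simp only: of_real_of_nat_eq)
    qed
    finally show "(\<lambda>n. (real (Suc n))\<^sup>2 * Re (a (Suc n) * cnj (b (Suc n))) * r ^ (2*n)) sums
        circ_mean r (\<lambda>z. Re (deriv p z * cnj (deriv q z)))"
      by (subst circ_mean_Re) (auto intro!: continuous_intros continuous_on_disc_sphere cd r)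
  qed (auto intro!: continuous_intros cp cq cd)
qed

text \<open>With \<open>x = r\<^sup>2\<close> and \<open>f x = \<Sum> c\<^sub>n x\<^sup>n\<close> the circular mean of \<open>Y\<close>, the circular mean of \<open>Q\<close> is the
  derivative of \<open>x f' x\<close>, so positivity of \<open>Q\<close> makes \<open>f\<close> increasing.\<close>

lemma hermitian_pair_submean:
  assumes h: "hermitian_pair Y Q" and Q: "\<And>z. norm z < 1 \<Longrightarrow> Q z \<ge> 0" and r: "0 \<le> r" "r < 1"
  shows "Y 0 \<le> circ_mean r Y"
proof -
  obtain c where "hermitian_coeffs c Y Q" using h by (auto simp: hermitian_pair_def)
  note co = hermitian_coeffsD[OF this]
  note cQ = co(2) and c = co(3,4)
  define f where "f x = (\<Sum>n. c n * x ^ n)" for x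
  define f' where "f' x = (\<Sum>n. diffs c n * x ^ n)" for x
  have sm: "summable (\<lambda>n. c n * x ^ n)" if "norm x < 1" for x
  proof -
    define R where "R = (norm x + 1) / 2"
    have "summable (\<lambda>n. c n * R ^ n)"
      using c(1)[of "sqrt R"] that by (auto simp: sums_iff R_def power_mult)
    then show ?thesis by (rule powser_inside) (use that in \<open>auto simp: R_def\<close>)
  qed
  have sm': "summable (\<lambda>n. diffs c n * x ^ n)" if "norm x < 1" for x
    by (rule termdiff_converges[OF that sm])
  have df: "(f has_field_derivative f' x) (at x)" if "norm x < 1" for x
    unfolding f_def f'_def by (rule termdiffs_strong'[OF sm that])
  have f0: "f 0 = Y 0"
    using c(1)[of 0] powser_zero[of c] unfolding f_def
    by (auto simp: sums_iff power_0_left circ_mean_def)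
  \<comment> \<open>Coefficients of x f'(x); \<open>diffs e n\<close> is then (n+1)^2 times
    \<open>c (Suc n)\<close>, the coefficient of the mean of \<open>Q\<close> in the variable
    x.\<close>
  define e where "e n = (case n of 0 \<Rightarrow> 0 | Suc m \<Rightarrow> diffs c m)" for n
  have e_sums: "(\<lambda>n. e n * x ^ n) sums (x * f' x)" if "norm x < 1" for x
  proof -
    have "(\<lambda>n. x * (diffs c n * x ^ n)) sums (x * f' x)"
      unfolding f'_def by (intro sums_mult summable_sums sm' that)
    then have "(\<lambda>n. e (Suc n) * x ^ Suc n) sums (x * f' x)"
      by (simp add: e_def mult_ac)
    from sums_Suc[of "\<lambda>n. e n * x ^ n", OF this] show ?thesis by (simp add: e_def)
  qed
  have dg: "((\<lambda>x. x * f' x) has_field_derivative (\<Sum>n. diffs e n * x ^ n)) (at x)" if "norm x < 1" for x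
  proof -
    have "((\<lambda>x. \<Sum>n. e n * x ^ n) has_field_derivative (\<Sum>n. diffs e n * x ^ n)) (at x)"
      by (rule termdiffs_strong'[OF _ that]) (use e_sums in \<open>auto simp: sums_iff\<close>)
    moreover have "eventually (\<lambda>y. y \<in> ball 0 1) (nhds x)"
      using that by (intro eventually_nhds_in_open) auto
    then have "eventually (\<lambda>y. (\<Sum>n. e n * y ^ n) = y * f' y) (nhds x)"
      by eventually_elim (use e_sums in \<open>auto simp: sums_iff\<close>)
    ultimately show ?thesis by (subst (asm) DERIV_cong_ev) auto
  qed
  have dg_nonneg: "(\<Sum>n. diffs e n * x ^ n) \<ge> 0" if "0 \<le> x" "x < 1" for x
  proof -
    have "diffs e n * x ^ n = (real (Suc n))\<^sup>2 * c (Suc n) * sqrt x ^ (2*n)" for n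
      using that by (simp add: diffs_def e_def power_mult power2_eq_square del: of_nat_Suc)
    then have "(\<lambda>n. diffs e n * x ^ n) sums circ_mean (sqrt x) Q"
      using c(2)[of "sqrt x"] that by simp
    moreover have "circ_mean (sqrt x) Q \<ge> 0"
      using that Q by (intro circ_mean_nonneg continuous_on_disc_sphere[OF cQ]) auto
    ultimately show ?thesis by (simp add: sums_iff)
  qed
  have f'_nonneg: "f' x \<ge> 0" if "0 < x" "x < 1" for x
  proof -
    have "0 * f' 0 \<le> x * f' x"
    proof (rule DERIV_nonneg_imp_nondecreasing[of 0 x "\<lambda>x. x * f' x"])
      fix y assume "0 \<le> y" "y \<le> x"
      then show "\<exists>z. ((\<lambda>x. x * f' x) has_real_derivative z) (at y) \<and> 0 \<le> z"
        using dg[of y] dg_nonneg[of y] that by auto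
    qed (use that in auto)
    then show ?thesis using that by (simp add: zero_le_mult_iff)
  qed
  \<comment> \<open>At 0 the factor x cannot be divided out, but both series have the constant term
    \<open>c 1\<close>.\<close>
  have f'0: "f' 0 \<ge> 0"
    using dg_nonneg[of 0] powser_zero[of "diffs e"] powser_zero[of "diffs c"]
    by (simp add: f'_def diffs_def e_def)
  have r2: "r\<^sup>2 < 1" using r by (simp add: abs_square_less_1)
  have "f 0 \<le> f (r\<^sup>2)"
  proof (rule DERIV_nonneg_imp_nondecreasing[of 0 "r\<^sup>2" f])
    fix y assume "0 \<le> y" "y \<le> r\<^sup>2"
    then show "\<exists>z. (f has_real_derivative z) (at y) \<and> 0 \<le> z"
      using df[of y] f'_nonneg[of y] f'0 r2 by (cases "y = 0") auto
  qed simp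
  also have "f (r\<^sup>2) = circ_mean r Y"
    using c(1)[OF r] by (simp add: f_def sums_iff power_mult)
  finally show ?thesis by (simp add: f0)
qed

subsection \<open>Disc automorphisms and the Garsia seminorm\<close>

lemma disc_aut_simps [simp]: "\<sigma> a 0 = a" "\<sigma> a a = 0"
  by (auto simp: disc_aut_def)

lemma disc_aut_image: "a \<in> \<bbbD> \<Longrightarrow> \<sigma> a ` \<bbbD> \<subseteq> \<bbbD>"
  using disc_aut_in_disc(2) by blast

lemma disc_aut_involution:
  assumes "a \<in> \<bbbD>" "z \<in> \<bbbD>"
  shows "\<sigma> a (\<sigma> a z) = z"
proof -
  have nz: "1 - cnj a * z \<noteq> 0" "1 - cnj a * a \<noteq> 0"
    using disc_aut_in_disc(1)[OF assms] disc_aut_in_disc(1)[OF assms(1) assms(1)] by auto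
  have "a - \<sigma> a z = z * (1 - cnj a * a) / (1 - cnj a * z)"
    using nz by (simp add: disc_aut_def field_simps)
  moreover have "1 - cnj a * \<sigma> a z = (1 - cnj a * a) / (1 - cnj a * z)"
    using nz by (simp add: disc_aut_def field_simps)
  ultimately show ?thesis using nz unfolding disc_aut_def[of a "\<sigma> a z"] by simp
qed

lemma disc_aut_unimodular:
  assumes "norm a < 1" "norm z = 1"
  shows "norm (\<sigma> a z) = 1" "1 - cnj a * z \<noteq> 0"
proof -
  have "norm (cnj a * z) < 1" using assms by (simp add: norm_mult)
  then show nz: "1 - cnj a * z \<noteq> 0" by auto
  have "(norm (1 - cnj a * z))\<^sup>2 - (norm (a - z))\<^sup>2 = (1 - (norm a)\<^sup>2) * (1 - (norm z)\<^sup>2)"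
    unfolding cmod_power2 by (simp add: algebra_simps power2_eq_square)
  then have "norm (a - z) = norm (1 - cnj a * z)" using assms by simp
  then show "norm (\<sigma> a z) = 1" using nz by (simp add: disc_aut_def norm_divide)
qed

lemma one_minus_norm_disc_aut_sq:
  assumes "a \<in> \<bbbD>" "z \<in> \<bbbD>"
  shows "1 - (norm (\<sigma> a z))\<^sup>2 = (1 - (norm a)\<^sup>2) * (1 - (norm z)\<^sup>2) / (norm (1 - cnj a * z))\<^sup>2"
proof -
  have nz: "norm (1 - cnj a * z) \<noteq> 0" using disc_aut_in_disc(1)[OF assms] by simp
  have "(norm (1 - cnj a * z))\<^sup>2 - (norm (a - z))\<^sup>2 = (1 - (norm a)\<^sup>2) * (1 - (norm z)\<^sup>2)"
    unfolding cmod_power2 by (simp add: algebra_simps power2_eq_square)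
  then show ?thesis using nz by (simp add: disc_aut_def norm_divide power_divide field_simps)
qed

text \<open>The pole 1 / cnj a lies outside the closed disc, so means over the unit circle itself
  fall under the mean value property.\<close>

lemma disc_aut_holomorphic_ball:
  assumes "norm a < 1"
  obtains R where "R > 1" "\<sigma> a holomorphic_on ball 0 R"
proof -
  define R where "R = (if a = 0 then 2 else 1 / norm a)"
  have R: "R > 1" using assms by (auto simp: R_def field_simps)
  have "1 - cnj a * z \<noteq> 0" if "z \<in> ball 0 R" for z
  proof -
    have "norm (cnj a * z) < 1" using that assms by (auto simp: R_def norm_mult field_simps split: if_splits)
    then show ?thesis by auto
  qed
  then have "\<sigma> a holomorphic_on ball 0 R"
    unfolding disc_aut_def[abs_def] by (intro holomorphic_intros) auto
  with R show ?thesis using that by blast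
qed

definition garsia :: "(complex \<Rightarrow> complex) \<Rightarrow> complex \<Rightarrow> ennreal" where
  "garsia f a = h2_norm (\<lambda>z. f (\<sigma> a z) - f a)"

lemma bmoa_seminorm_eq: "bmoa_seminorm f = (SUP a\<in>\<bbbD>. garsia f a)"
  by (simp add: bmoa_seminorm_def garsia_def)

lemma holomorphic_disc_aut_compose:
  assumes "f holomorphic_on \<bbbD>" "a \<in> \<bbbD>"
  shows "(\<lambda>z. f (\<sigma> a z)) holomorphic_on \<bbbD>"
  by (rule holomorphic_on_disc_compose[OF assms(1) disc_aut_holomorphic disc_aut_image]) (use assms in auto)

lemma disc_aut_conjugate:
  assumes \<phi>: "\<phi> holomorphic_on \<bbbD>" "\<phi> ` \<bbbD> \<subseteq> \<bbbD>" and a: "a \<in> \<bbbD>"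
  defines "\<psi> \<equiv> \<sigma> (\<phi> a) \<circ> \<phi> \<circ> \<sigma> a"
  shows "\<psi> holomorphic_on \<bbbD>" "\<psi> ` \<bbbD> \<subseteq> \<bbbD>" "\<psi> 0 = 0"
proof -
  have w: "\<phi> a \<in> \<bbbD>" using \<phi>(2) a by blast
  have im: "(\<lambda>z. \<phi> (\<sigma> a z)) ` \<bbbD> \<subseteq> \<bbbD>" using \<phi>(2) disc_aut_image[OF a] by blast
  show "\<psi> holomorphic_on \<bbbD>"
    using holomorphic_on_disc_compose[OF disc_aut_holomorphic[OF w] holomorphic_disc_aut_compose[OF \<phi>(1) a] im]
    by (simp add: \<psi>_def o_def)
  show "\<psi> ` \<bbbD> \<subseteq> \<bbbD>" using im disc_aut_image[OF w] by (force simp: \<psi>_def)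
  show "\<psi> 0 = 0" by (simp add: \<psi>_def)
qed

text \<open>By the involution property, \<open>\<phi> \<circ> \<sigma> a\<close> is
  \<open>\<sigma> (\<phi> a)\<close> after a map fixing 0, and subordination applies to that map.
  Taking suprema over a, this is also the boundedness of composition operators for the
  seminorm.\<close>

lemma garsia_compose:
  assumes f: "f holomorphic_on \<bbbD>" and \<phi>: "\<phi> holomorphic_on \<bbbD>" "\<phi> ` \<bbbD> \<subseteq> \<bbbD>" and a: "a \<in> \<bbbD>"
  shows "garsia (\<lambda>z. f (\<phi> z)) a \<le> garsia f (\<phi> a)"
proof -
  have b: "\<phi> a \<in> \<bbbD>" using \<phi>(2) a by blast
  define \<psi> where "\<psi> z = \<sigma> (\<phi> a) (\<phi> (\<sigma> a z))" for z
  have im: "(\<lambda>z. \<phi> (\<sigma> a z)) ` \<bbbD> \<subseteq> \<bbbD>" using \<phi>(2) disc_aut_image[OF a] by blast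
  have \<psi>: "\<psi> holomorphic_on \<bbbD>" "\<psi> ` \<bbbD> \<subseteq> \<bbbD>" "\<psi> 0 = 0"
    using disc_aut_conjugate[OF \<phi> a] by (simp_all add: \<psi>_def[abs_def] o_def)
  have "h2_norm (\<lambda>z. (\<lambda>u. f (\<sigma> (\<phi> a) u) - f (\<phi> a)) (\<psi> z)) \<le> h2_norm (\<lambda>u. f (\<sigma> (\<phi> a) u) - f (\<phi> a))"
    by (rule h2_norm_subordination[OF _ \<psi>])
       (intro holomorphic_intros holomorphic_disc_aut_compose f b)
  moreover have "h2_norm (\<lambda>z. (\<lambda>u. f (\<sigma> (\<phi> a) u) - f (\<phi> a)) (\<psi> z)) = h2_norm (\<lambda>z. f (\<phi> (\<sigma> a z)) - f (\<phi> a))"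
    unfolding h2_norm_def circle_mean2_eq
  proof (intro SUP_cong refl arg_cong[where f = ennreal] arg_cong[where f = sqrt] circ_mean_cong)
    fix r :: real and z :: complex assume "r \<in> {0<..<1}" "norm z = r"
    then have "z \<in> \<bbbD>" by auto
    then have "\<phi> (\<sigma> a z) \<in> \<bbbD>" using im by blast
    then show "(norm (f (\<sigma> (\<phi> a) (\<psi> z)) - f (\<phi> a)))\<^sup>2 = (norm (f (\<phi> (\<sigma> a z)) - f (\<phi> a)))\<^sup>2"
      using b by (simp add: \<psi>_def disc_aut_involution)
  qed auto
  ultimately show ?thesis by (simp add: garsia_def)
qed

lemma garsia_le_seminorm: "a \<in> \<bbbD> \<Longrightarrow> garsia f a \<le> bmoa_seminorm f"
  unfolding bmoa_seminorm_eq by (rule SUP_upper)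

lemma h2_norm_approx:
  assumes f: "f holomorphic_on \<bbbD>" and g: "g holomorphic_on \<bbbD>" and e: "e \<ge> 0"
    "\<And>z. z \<in> \<bbbD> \<Longrightarrow> norm (f z - g z) \<le> e"
  shows "h2_norm f \<le> h2_norm g + ennreal e"
  unfolding h2_norm_def[of f]
proof (rule SUP_least)
  fix r :: real assume r: "r \<in> {0<..<1}"
  have "ennreal (circle_mean2 f r) \<le> ennreal (circle_mean2 g r + e)"
    using r by (intro ennreal_leI circle_mean2_approx f g e) auto
  also have "\<dots> = ennreal (circle_mean2 g r) + ennreal e"
    using e by (simp add: circle_mean2_nonneg)
  also have "\<dots> \<le> h2_norm g + ennreal e"
    unfolding h2_norm_def using r by (intro add_right_mono SUP_upper)
  finally show "ennreal (circle_mean2 f r) \<le> h2_norm g + ennreal e" .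
qed

lemma garsia_approx:
  assumes f: "f holomorphic_on \<bbbD>" and g: "g holomorphic_on \<bbbD>" and a: "a \<in> \<bbbD>" and e: "e \<ge> 0"
    "\<And>z. z \<in> \<bbbD> \<Longrightarrow> norm (f z - g z) \<le> e"
  shows "garsia f a \<le> garsia g a + ennreal (2 * e)"
  unfolding garsia_def
proof (rule h2_norm_approx)
  fix z assume "z \<in> \<bbbD>"
  then have "norm (f (\<sigma> a z) - g (\<sigma> a z)) \<le> e" "norm (f a - g a) \<le> e"
    using e disc_aut_in_disc(2)[OF a] a by auto
  then show "norm (f (\<sigma> a z) - f a - (g (\<sigma> a z) - g a)) \<le> 2 * e"
    using norm_triangle_ineq4[of "f (\<sigma> a z) - g (\<sigma> a z)" "f a - g a"] by (simp add: algebra_simps)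
qed (use e in \<open>auto intro!: holomorphic_intros holomorphic_disc_aut_compose f g a\<close>)

section \<open>Approximation by polynomials through dilation\<close>

lemma dilation_approx:
  assumes F: "F holomorphic_on \<bbbD>" and R: "R < 1" and e: "e > 0"
  obtains t where "0 < t" "t < 1" "\<And>z. norm z \<le> R \<Longrightarrow> norm (F (of_real t * z) - F z) < e"
proof -
  define S where "S = max R 0"
  have S: "S < 1" "S \<ge> 0" "R \<le> S" using R by (auto simp: S_def)
  have "uniformly_continuous_on (cball 0 S) F"
    by (intro compact_uniformly_continuous continuous_on_subset[OF holomorphic_on_imp_continuous_on[OF F]])
       (use S in auto)
  then obtain d where d: "d > 0" "\<And>x y. x \<in> cball 0 S \<Longrightarrow> y \<in> cball 0 S \<Longrightarrow> dist y x < d \<Longrightarrow> dist (F y) (F x) < e"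
    using e unfolding uniformly_continuous_on_def by meson
  define t where "t = max (1/2) (1 - d/2)"
  have t: "0 < t" "t < 1" "1 - t < d" using d by (auto simp: t_def)
  show ?thesis
  proof (rule that[OF t(1,2)])
    fix z :: complex assume z: "norm z \<le> R"
    have "norm (of_real t * z - z) = (1 - t) * norm z"
    proof -
      have "of_real t * z - z = - (of_real (1 - t) * z)" by (simp add: algebra_simps)
      then show ?thesis using t by (simp add: norm_mult del: of_real_diff)
    qed
    also have "\<dots> \<le> 1 - t" using z R t by (intro mult_left_le) auto
    finally have "dist (of_real t * z) z < d" using t by (simp add: dist_norm)
    moreover have "norm (of_real t * z) \<le> S"
      using z t S mult_right_mono[of t 1 "norm z"] by (simp add: norm_mult)
    ultimately show "norm (F (of_real t * z) - F z) < e"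
      using d(2)[of z "of_real t * z"] z S by (auto simp: dist_norm)
  qed
qed

text \<open>F itself need not be a uniform limit of polynomials on the disc, but its dilate is
  holomorphic past the closed disc. Dilation is a self-map of the disc, so the Garsia value of the
  dilate at a is controlled by that of F at t a; this pointwise form is what the maximum principle
  uses.\<close>

lemma dilation_polynomial:
  assumes F: "F holomorphic_on \<bbbD>" and t: "0 < t" "t < 1" and e: "e > 0"
  obtains p where "\<And>z. norm z \<le> 1 \<Longrightarrow> norm (F (of_real t * z) - poly p z) < e"
    "\<And>a. a \<in> \<bbbD> \<Longrightarrow> garsia (poly p) a \<le> garsia F (of_real t * a) + ennreal (2 * e)"
proof -
  define Ft where "Ft z = F (of_real t * z)" for z
  have tim: "(\<lambda>z. of_real t * z) ` ball 0 (1/t) \<subseteq> \<bbbD>"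
    using t by (auto simp: norm_mult field_simps)
  have Ft_hol: "Ft holomorphic_on ball 0 (1/t)"
    unfolding Ft_def using holomorphic_on_compose_gen[OF _ F tim] by (simp add: o_def holomorphic_intros)
  have Ft_hol': "Ft holomorphic_on \<bbbD>"
    by (rule holomorphic_on_subset[OF Ft_hol subset_ball]) (use t in simp)
  have td: "of_real t * z \<in> \<bbbD>" if "z \<in> \<bbbD>" for z
    using that t mult_strict_mono[of t 1 "norm z" 1] by (auto simp: norm_mult)
  obtain p where p: "\<And>z. norm z \<le> 1 \<Longrightarrow> norm (Ft z - poly p z) < e"
    using taylor_polynomial_approximation[OF Ft_hol, of 1 e] e t by (auto simp: field_simps)
  show ?thesis
  proof (rule that[of p])
    fix a :: complex assume a: "a \<in> \<bbbD>"
    have "garsia (poly p) a \<le> garsia Ft a + ennreal (2 * e)"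
      by (rule garsia_approx) (use a e p Ft_hol' in \<open>auto intro!: holomorphic_intros simp: norm_minus_commute less_imp_le\<close>)
    also have "garsia Ft a \<le> garsia F (of_real t * a)"
      unfolding Ft_def by (rule garsia_compose[OF F]) (use td a in \<open>auto intro!: holomorphic_intros\<close>)
    finally show "garsia (poly p) a \<le> garsia F (of_real t * a) + ennreal (2 * e)" by (simp add: add_right_mono)
  qed (use p in \<open>simp add: Ft_def\<close>)
qed

lemma circ_mean_scale: "circ_mean r (\<lambda>z. f (of_real s * z)) = circ_mean (s * r) f"
  by (simp add: circ_mean_def mult_ac)

lemma circle_mean2_scale: "circle_mean2 (\<lambda>z. f (of_real s * z)) r = circle_mean2 f (s * r)"
  unfolding circle_mean2_eq using circ_mean_scale[of r "\<lambda>z. (norm (f z))\<^sup>2" s] by simp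

lemma circle_mean2_one_le_h2_norm:
  assumes g: "g holomorphic_on ball 0 R" "R > 1" and M: "h2_norm g \<le> ennreal M" "M \<ge> 0"
  shows "circle_mean2 g 1 \<le> M"
proof (rule field_le_epsilon)
  fix e :: real assume e: "e > 0"
  \<comment> \<open>Rescaling by s moves the unit circle to radius 1/s < 1, where the Minkowski
    estimate for radii below 1 applies.\<close>
  define s where "s = (1 + R) / 2"
  have s: "1 < s" "s < R" using g by (auto simp: s_def)
  have "uniformly_continuous_on (cball 0 1) g"
    by (intro compact_uniformly_continuous continuous_on_subset[OF holomorphic_on_imp_continuous_on[OF g(1)]])
       (use g in auto)
  then obtain d where d: "d > 0" "\<And>x y. x \<in> cball 0 1 \<Longrightarrow> y \<in> cball 0 1 \<Longrightarrow> dist y x < d \<Longrightarrow> dist (g y) (g x) < e"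
    using e unfolding uniformly_continuous_on_def by metis
  define t where "t = max (1/2) (1 - d/2)"
  have t: "0 < t" "t < 1" "1 - t < d" using d by (auto simp: t_def)
  have hol: "(\<lambda>z. g (of_real k * z)) holomorphic_on \<bbbD>" if "0 < k" "k \<le> s" for k
  proof -
    have "(\<lambda>z. of_real k * z) ` \<bbbD> \<subseteq> ball 0 R"
      using that s mult_strict_mono[of k R] by (auto simp: norm_mult) (metis less_le_trans mult.right_neutral mult_less_cancel_left_pos order.strict_trans)
    then show ?thesis
      using holomorphic_on_compose_gen[OF _ g(1), of "\<lambda>z. of_real k * z" \<bbbD>] by (simp add: o_def holomorphic_intros)
  qed
  have "circle_mean2 g 1 = circle_mean2 (\<lambda>z. g (of_real s * z)) (1/s)"
    using s by (simp add: circle_mean2_scale)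
  also have "\<dots> \<le> circle_mean2 (\<lambda>z. g (of_real (s * t) * z)) (1/s) + e"
  proof (rule circle_mean2_approx)
    fix z :: complex assume z: "norm z = 1 / s"
    have n1: "norm (of_real s * z) = 1" using z s by (simp add: norm_mult)
    have "of_real s * z - of_real (s * t) * z = of_real (1 - t) * (of_real s * z)"
      by (simp add: algebra_simps)
    then have "norm (of_real s * z - of_real (s * t) * z) = 1 - t"
      using n1 t by (simp only: norm_mult norm_of_real) simp
    moreover have "norm (of_real (s * t) * z) \<le> 1"
      using z s t by (simp add: norm_mult)
    ultimately show "norm (g (of_real s * z) - g (of_real (s * t) * z)) \<le> e"
      using d(2)[of "of_real (s * t) * z" "of_real s * z"] n1 t by (auto simp: dist_norm)
  next
    show "(\<lambda>z. g (of_real s * z)) holomorphic_on \<bbbD>" using hol[of s] s by simp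
    have "s * t \<le> s" "0 < s * t" using s t by (auto intro: mult_left_le)
    then show "(\<lambda>z. g (of_real (s * t) * z)) holomorphic_on \<bbbD>" by (intro hol)
  qed (use s in auto)
  also have "circle_mean2 (\<lambda>z. g (of_real (s * t) * z)) (1/s) = circle_mean2 g t"
    using s by (simp only: circle_mean2_scale) simp
  also have "\<dots> \<le> M"
    by (rule circle_mean2_le_h2_norm) (use M t in auto)
  finally show "circle_mean2 g 1 \<le> M + e" by simp
qed

text \<open>Cauchy-Schwarz in variance form: expand the mean of (|f| - c)^2, with c the mean of
  |f|.\<close>

lemma circ_mean_norm_le_circle_mean2:
  fixes f :: "complex \<Rightarrow> complex"
  assumes "continuous_on (sphere 0 r) f" "r \<ge> 0"
  shows "circ_mean r (\<lambda>z. norm (f z)) \<le> circle_mean2 f r"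
proof -
  define c where "c = circ_mean r (\<lambda>z. norm (f z))"
  have "0 \<le> circ_mean r (\<lambda>z. (norm (f z) - c)\<^sup>2)"
    by (rule circ_mean_nonneg) (use assms in \<open>auto intro!: continuous_intros\<close>)
  also have "\<dots> = circ_mean r (\<lambda>z. ((norm (f z))\<^sup>2 + c\<^sup>2) - (2 * c) * norm (f z))"
    by (simp add: power2_eq_square algebra_simps)
  also have "\<dots> = circ_mean r (\<lambda>z. (norm (f z))\<^sup>2 + c\<^sup>2) - circ_mean r (\<lambda>z. (2 * c) * norm (f z))"
    by (intro circ_mean_diff continuous_intros assms)
  also have "circ_mean r (\<lambda>z. (norm (f z))\<^sup>2 + c\<^sup>2) = circ_mean r (\<lambda>z. (norm (f z))\<^sup>2) + circ_mean r (\<lambda>z. c\<^sup>2)"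
    by (intro circ_mean_add continuous_intros assms)
  also have "circ_mean r (\<lambda>z. (2 * c) * norm (f z)) = (2 * c) * c"
    unfolding c_def by (intro circ_mean_mult_left continuous_intros assms)
  finally have "c\<^sup>2 \<le> circ_mean r (\<lambda>z. (norm (f z))\<^sup>2)"
    by (simp add: power2_eq_square)
  then show ?thesis
    unfolding circle_mean2_eq c_def[symmetric] by (rule real_le_rsqrt)
qed

lemma norm_deriv_0_le_h2_norm:
  assumes f: "f holomorphic_on \<bbbD>" and M: "h2_norm f \<le> ennreal M" "M \<ge> 0"
  shows "norm (deriv f 0) \<le> M"
proof -
  define a where "a n = (deriv ^^ n) f 0 / fact n" for n
  \<comment> \<open>Coefficients of the identity function: pairing with cnj z extracts the first
    Taylor coefficient.\<close>
  define b where "b n = (if n = 1 then 1 else 0 :: complex)" for n :: nat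
  have a: "(\<lambda>n. a n * z ^ n) sums f z" if "norm z < 1" for z
    using holomorphic_power_series[OF f, of z] that by (simp add: a_def)
  have b: "(\<lambda>n. b n * z ^ n) sums z" if "norm z < 1" for z
  proof -
    have "(\<lambda>n. b n * z ^ n) = (\<lambda>n. if n = 1 then z ^ n else 0)" by (auto simp: b_def)
    then show ?thesis using sums_single[of 1 "\<lambda>n. z ^ n"] by simp
  qed
  have *: "r * norm (deriv f 0) \<le> M" if r: "0 < r" "r < 1" for r
  proof -
    have "(\<lambda>n. a n * cnj (b n) * of_real (r ^ (2*n))) sums circ_mean r (\<lambda>z. f z * cnj z)"
      by (rule parseval_circ_mean[OF a b f]) (use r in \<open>auto intro!: holomorphic_intros\<close>)
    moreover have "(\<lambda>n. a n * cnj (b n) * of_real (r ^ (2*n))) sums (a 1 * of_real (r\<^sup>2))"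
    proof -
      have "(\<lambda>n. a n * cnj (b n) * of_real (r ^ (2*n))) = (\<lambda>n. if n = 1 then a n * of_real (r ^ (2*n)) else 0)"
        by (auto simp: b_def)
      then show ?thesis using sums_single[of 1 "\<lambda>n. a n * of_real (r ^ (2*n))"] by simp
    qed
    ultimately have "circ_mean r (\<lambda>z. f z * cnj z) = a 1 * of_real (r\<^sup>2)"
      by (rule sums_unique2)
    then have "r\<^sup>2 * norm (deriv f 0) = norm (circ_mean r (\<lambda>z. f z * cnj z))"
      using r by (simp add: a_def norm_mult norm_power)
    also have "\<dots> \<le> circ_mean r (\<lambda>z. norm (f z * cnj z))"
      by (rule norm_circ_mean_le) (use r in \<open>auto intro!: continuous_intros holomorphic_continuous_on_sphere[OF f]\<close>)
    also have "\<dots> = circ_mean r (\<lambda>z. r * norm (f z))"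
      using r by (intro circ_mean_cong) (auto simp: norm_mult)
    also have "\<dots> = r * circ_mean r (\<lambda>z. norm (f z))"
      by (intro circ_mean_mult_left continuous_intros holomorphic_continuous_on_sphere[OF f]) (use r in auto)
    also have "\<dots> \<le> r * M"
      using circ_mean_norm_le_circle_mean2[OF holomorphic_continuous_on_sphere[OF f r(2)]]
        circle_mean2_le_h2_norm[OF M r] r
      by (intro mult_left_mono) auto
    finally show ?thesis using r by (simp add: power2_eq_square)
  qed
  show ?thesis
  proof (rule field_le_mult_one_interval)
    fix z :: real assume "0 < z" "z < 1"
    then show "z * norm (deriv f 0) \<le> M" using * by simp
  qed
qed

text \<open>The embedding of BMOA in the Bloch space: the derivative of
  \<open>f \<circ> \<sigma> a\<close> at 0 is f'(a) (|a|^2 - 1), and first Taylor coefficients are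
  bounded by the H^2-norm.\<close>

lemma norm_deriv_le_garsia:
  assumes f: "f holomorphic_on \<bbbD>" and a: "a \<in> \<bbbD>" and M: "garsia f a \<le> ennreal M" "M \<ge> 0"
  shows "norm (deriv f a) * (1 - (norm a)\<^sup>2) \<le> M"
proof -
  have hs: "\<sigma> a holomorphic_on \<bbbD>" by (rule disc_aut_holomorphic[OF a])
  have "(\<sigma> a has_field_derivative (((a - 0) * cnj a - (1 - cnj a * 0)) / (1 - cnj a * 0)\<^sup>2)) (at 0)"
    unfolding disc_aut_def[abs_def] by (auto intro!: derivative_eq_intros simp: power2_eq_square)
  then have ds: "(\<sigma> a has_field_derivative (a * cnj a - 1)) (at 0)" by simp
  have df: "(f has_field_derivative deriv f a) (at (\<sigma> a 0))"
    using holomorphic_derivI[OF f _ a] by simp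
  have "((\<lambda>z. f (\<sigma> a z) - f a) has_field_derivative (deriv f a * (a * cnj a - 1))) (at 0)"
    using DERIV_diff[OF DERIV_chain2[OF df ds] DERIV_const[of "f a"]] by simp
  then have "deriv (\<lambda>z. f (\<sigma> a z) - f a) 0 = deriv f a * (a * cnj a - 1)"
    by (rule DERIV_imp_deriv)
  moreover have "norm (deriv (\<lambda>z. f (\<sigma> a z) - f a) 0) \<le> M"
    by (rule norm_deriv_0_le_h2_norm[OF _ M[unfolded garsia_def]])
       (intro holomorphic_intros holomorphic_disc_aut_compose f a)
  moreover have "norm (a * cnj a - 1) = 1 - (norm a)\<^sup>2"
  proof -
    have "a * cnj a - 1 = of_real ((norm a)\<^sup>2 - 1)" by (simp add: complex_norm_square[symmetric])
    moreover have "(norm a)\<^sup>2 \<le> 1" using a by (simp add: abs_square_le_1)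
    ultimately show ?thesis by (simp only: norm_of_real)
  qed
  ultimately show ?thesis by (simp add: norm_mult)
qed

subsection \<open>The harmonic extension of the squared modulus of a polynomial\<close>

text \<open>On the unit circle \<open>z\<^sup>j cnj (z\<^sup>k)\<close> is \<open>z\<^sup>j\<^sup>-\<^sup>k\<close> or the conjugate of \<open>z\<^sup>k\<^sup>-\<^sup>j\<close>.\<close>

lemma poly_norm_sq_on_circle:
  obtains K where "\<And>z. norm z = 1 \<Longrightarrow> (norm (poly p z))\<^sup>2 = Re (poly K z)"
proof
  define n where "n = degree p"
  define c where "c = coeff p"
  fix z :: complex assume z: "norm z = 1"
  have zz: "z * cnj z = 1" using z complex_norm_square[of z] by simp
  have pw: "z ^ j * cnj (z ^ k) = (if k \<le> j then z ^ (j - k) else cnj (z ^ (k - j)))" for j k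
  proof (cases "k \<le> j")
    case True
    then have "z ^ j = z ^ (j - k) * z ^ k" by (simp flip: power_add)
    then have "z ^ j * cnj (z ^ k) = z ^ (j - k) * (z * cnj z) ^ k" by (simp add: power_mult_distrib)
    then show ?thesis using zz True by simp
  next
    case False
    then have "z ^ k = z ^ (k - j) * z ^ j" by (simp flip: power_add)
    then have "z ^ j * cnj (z ^ k) = cnj (z ^ (k - j)) * (z * cnj z) ^ j" by (simp add: power_mult_distrib)
    then show ?thesis using zz False by simp
  qed
  have p: "poly p z = (\<Sum>j\<le>n. c j * z ^ j)" by (simp add: poly_altdef n_def c_def)
  have "(norm (poly p z))\<^sup>2 = Re (poly p z * cnj (poly p z))"
    by (simp add: complex_norm_square[symmetric] del: of_real_power)
  also have "poly p z * cnj (poly p z) = (\<Sum>j\<le>n. \<Sum>k\<le>n. c j * cnj (c k) * (z ^ j * cnj (z ^ k)))"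
    unfolding p by (simp add: sum_product mult_ac)
  also have "Re \<dots> = (\<Sum>j\<le>n. \<Sum>k\<le>n. Re (c j * cnj (c k) * (z ^ j * cnj (z ^ k))))" by simp
  also have "\<dots> = (\<Sum>j\<le>n. \<Sum>k\<le>n. Re (poly (if k \<le> j then monom (c j * cnj (c k)) (j - k) else monom (cnj (c j) * c k) (k - j)) z))"
  proof (intro sum.cong refl)
    fix j k
    have "Re (a * cnj u) = Re (cnj a * u)" for a u by simp
    from this[of "c j * cnj (c k)" "z ^ (k - j)"]
    show "Re (c j * cnj (c k) * (z ^ j * cnj (z ^ k))) = Re (poly (if k \<le> j then monom (c j * cnj (c k)) (j - k) else monom (cnj (c j) * c k) (k - j)) z)"
      unfolding pw by (simp add: poly_monom del: times_complex.sel complex_cnj_power)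
  qed
  also have "\<dots> = Re (poly (\<Sum>j\<le>n. \<Sum>k\<le>n. if k \<le> j then monom (c j * cnj (c k)) (j - k) else monom (cnj (c j) * c k) (k - j)) z)"
    by (simp add: poly_sum)
  finally show "(norm (poly p z))\<^sup>2 = Re (poly (\<Sum>j\<le>degree p. \<Sum>k\<le>degree p. if k \<le> j then monom (coeff p j * cnj (coeff p k)) (j - k) else monom (cnj (coeff p j) * coeff p k) (k - j)) z)"
    by (simp only: n_def c_def)
qed

text \<open>Re K is harmonic and agrees with |p|^2 on the unit circle, which
  \<open>\<sigma> a\<close> preserves. Hence Re K at a is the mean of |p o \<sigma>_a|^2, and
  Pythagoras accounts for the subtraction of |p a|^2.\<close>

lemma poly_harmonic_majorant:
  assumes K: "\<And>z. norm z = 1 \<Longrightarrow> (norm (poly p z))\<^sup>2 = Re (poly K z)" and a: "a \<in> \<bbbD>"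
  shows "Re (poly K a) - (norm (poly p a))\<^sup>2 = (circle_mean2 (\<lambda>z. poly p (\<sigma> a z) - poly p a) 1)\<^sup>2"
proof -
  obtain R where R: "R > 1" "\<sigma> a holomorphic_on ball 0 R"
    using disc_aut_holomorphic_ball a by auto
  have hp: "(\<lambda>z. poly q (\<sigma> a z)) holomorphic_on ball 0 R" for q
    by (intro holomorphic_intros R)
  have cont: "continuous_on (sphere 0 1) (\<lambda>z. poly q (\<sigma> a z))" for q
    by (rule holomorphic_continuous_on_sphere[OF hp R(1)])
  have "circ_mean 1 (\<lambda>z. (norm (poly p (\<sigma> a z) - poly p a))\<^sup>2)
      = circ_mean 1 (\<lambda>z. (norm (poly p (\<sigma> a z)))\<^sup>2) - (norm (poly p a))\<^sup>2"
    using circ_mean_norm_diff_sq[OF hp, of 1 p] R(1) by simp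
  also have "circ_mean 1 (\<lambda>z. (norm (poly p (\<sigma> a z)))\<^sup>2) = circ_mean 1 (\<lambda>z. Re (poly K (\<sigma> a z)))"
    by (intro circ_mean_cong K disc_aut_unimodular) (use a in auto)
  also have "\<dots> = Re (circ_mean 1 (\<lambda>z. poly K (\<sigma> a z)))"
    by (intro circ_mean_Re cont) auto
  also have "circ_mean 1 (\<lambda>z. poly K (\<sigma> a z)) = poly K a"
    using circ_mean_holomorphic[OF hp, of 1 K] R(1) by simp
  finally have "circ_mean 1 (\<lambda>z. (norm (poly p (\<sigma> a z) - poly p a))\<^sup>2) = Re (poly K a) - (norm (poly p a))\<^sup>2" .
  moreover have "circ_mean 1 (\<lambda>z. (norm (poly p (\<sigma> a z) - poly p a))\<^sup>2) \<ge> 0"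
    by (rule circ_mean_nonneg) (auto intro!: continuous_intros cont)
  ultimately show ?thesis by (simp add: circle_mean2_eq)
qed

lemma poly_harmonic_majorant_bounds:
  assumes K: "\<And>z. norm z = 1 \<Longrightarrow> (norm (poly p z))\<^sup>2 = Re (poly K z)" and a: "a \<in> \<bbbD>"
  shows "(norm (poly p a))\<^sup>2 \<le> Re (poly K a)"
    and "garsia (poly p) a \<le> ennreal M \<Longrightarrow> M \<ge> 0 \<Longrightarrow> Re (poly K a) \<le> (norm (poly p a))\<^sup>2 + M\<^sup>2"
proof -
  note eq = poly_harmonic_majorant[OF K a]
  show "(norm (poly p a))\<^sup>2 \<le> Re (poly K a)" using eq by (smt (verit) zero_le_power2)
  obtain R where R: "R > 1" "\<sigma> a holomorphic_on ball 0 R"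
    using disc_aut_holomorphic_ball a by auto
  assume M: "garsia (poly p) a \<le> ennreal M" "M \<ge> 0"
  have "circle_mean2 (\<lambda>z. poly p (\<sigma> a z) - poly p a) 1 \<le> M"
    by (rule circle_mean2_one_le_h2_norm[OF _ R(1)])
       (use M in \<open>auto intro!: holomorphic_intros R(2) simp: garsia_def\<close>)
  then have "(circle_mean2 (\<lambda>z. poly p (\<sigma> a z) - poly p a) 1)\<^sup>2 \<le> M\<^sup>2"
    using circle_mean2_nonneg by (intro power_mono) auto
  with eq show "Re (poly K a) \<le> (norm (poly p a))\<^sup>2 + M\<^sup>2" by linarith
qed

lemma hermitian_pair_cong:
  assumes "hermitian_pair Y Q" "\<And>z. z \<in> \<bbbD> \<Longrightarrow> Y z = Y' z" "\<And>z. z \<in> \<bbbD> \<Longrightarrow> Q z = Q' z"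
  shows "hermitian_pair Y' Q'"
proof -
  obtain c where c: "hermitian_coeffs c Y Q" using assms(1) by (auto simp: hermitian_pair_def)
  have "circ_mean r Y = circ_mean r Y'" "circ_mean r Q = circ_mean r Q'" if "0 \<le> r" "r < 1" for r
    using that assms(2,3) by (auto intro!: circ_mean_cong)
  moreover have "continuous_on \<bbbD> Y \<longleftrightarrow> continuous_on \<bbbD> Y'" "continuous_on \<bbbD> Q \<longleftrightarrow> continuous_on \<bbbD> Q'"
    by (rule continuous_on_cong; simp add: assms(2,3))+
  ultimately show ?thesis
    using c unfolding hermitian_pair_def hermitian_coeffs_def by (intro exI[of _ c]) simp
qed

text \<open>Conformal behaviour of the Laplacian: composition with \<psi> only multiplies by
  |\<psi>'|^2 >= 0, so signs can be decided in the variable u = \<psi> z.\<close>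

lemma hermitian_pair_poly:
  assumes \<psi>: "\<psi> holomorphic_on \<bbbD>"
  shows "hermitian_pair (\<lambda>z. Re (poly p (\<psi> z) * cnj (poly q (\<psi> z))))
    (\<lambda>z. (norm (deriv \<psi> z))\<^sup>2 * Re (poly (pderiv p) (\<psi> z) * cnj (poly (pderiv q) (\<psi> z))))"
proof (rule hermitian_pair_cong)
  show "hermitian_pair (\<lambda>z. Re (poly p (\<psi> z) * cnj (poly q (\<psi> z))))
     (\<lambda>z. Re (deriv (\<lambda>z. poly p (\<psi> z)) z * cnj (deriv (\<lambda>z. poly q (\<psi> z)) z)))"
    by (intro hermitian_pair_product holomorphic_intros \<psi>)
  fix z :: complex assume z: "z \<in> \<bbbD>"
  have "deriv (\<lambda>z. poly p (\<psi> z)) z = poly (pderiv p) (\<psi> z) * deriv \<psi> z" for p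
    by (rule DERIV_imp_deriv, rule DERIV_chain2[OF poly_DERIV holomorphic_derivI[OF \<psi> _ z]]) simp
  moreover have "Re (a * d * cnj (b * d)) = (norm d)\<^sup>2 * Re (a * cnj b)" for a b d
  proof -
    have "a * d * cnj (b * d) = (d * cnj d) * (a * cnj b)" by simp
    also have "d * cnj d = of_real ((norm d)\<^sup>2)" by (rule complex_norm_square[symmetric])
    finally show ?thesis by (simp only: Re_complex_of_real times_complex.sel Im_complex_of_real)
  qed
  ultimately show "Re (deriv (\<lambda>z. poly p (\<psi> z)) z * cnj (deriv (\<lambda>z. poly q (\<psi> z)) z))
     = (norm (deriv \<psi> z))\<^sup>2 * Re (poly (pderiv p) (\<psi> z) * cnj (poly (pderiv q) (\<psi> z)))"
    by simp
qed simp

text \<open>The formula 2 (Re K)^2 = Re (K^2) + |K|^2 makes 2 |z|^2 W^2 a combination of terms Re (p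
  * cnj q). Writing real parts as (x + cnj x) / 2 leaves a polynomial identity in the variables and
  their conjugates.\<close>

lemma weighted_form_identity:
  fixes z F K :: complex
  assumes W: "W = (norm F)\<^sup>2 - Re K"
  shows "2 * (norm (z * F\<^sup>2))\<^sup>2 - 4 * Re (z * F * K * cnj (z * F)) + Re (z * K\<^sup>2 * cnj z) + (norm (z * K))\<^sup>2
    = 2 * (norm z)\<^sup>2 * W\<^sup>2"
proof -
  have eq: "complex_of_real W = F * cnj F - (K + cnj K) / 2"
    unfolding W by (simp add: complex_norm_square[symmetric] complex_add_cnj)
  have re: "complex_of_real (Re x) = (x + cnj x) / 2" for x by (simp add: complex_add_cnj)
  have "complex_of_real (2 * (norm (z * F\<^sup>2))\<^sup>2 - 4 * Re (z * F * K * cnj (z * F)) + Re (z * K\<^sup>2 * cnj z) + (norm (z * K))\<^sup>2)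
     = complex_of_real (2 * (norm z)\<^sup>2 * W\<^sup>2)"
    unfolding of_real_add of_real_diff of_real_mult re complex_norm_square of_real_power[of W] eq
    by (simp add: field_simps power2_eq_square)
  then show ?thesis by (simp only: of_real_eq_iff)
qed

text \<open>Reading F' and K' as derivatives, this is a quarter of the Laplacian of 2 |z|^2 W^2 with
  the square completed: W has z-derivative F' cnj F - K'/2 and mixed second derivative |F'|^2. For W
  >= 0 the only negative term is - 2 W^2.\<close>

lemma weighted_form_derivative_identity:
  fixes z F K F' K' :: complex
  assumes W: "W = (norm F)\<^sup>2 - Re K"
  shows "2 * (norm (F\<^sup>2 + 2 * z * F * F'))\<^sup>2 - 4 * Re ((F * K + z * F' * K + z * F * K') * cnj (F + z * F'))
      + Re (K\<^sup>2 + 2 * z * K * K') + (norm (K + z * K'))\<^sup>2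
    = 4 * (norm (z * (F' * cnj F - K' / 2) + of_real W))\<^sup>2 - 2 * W\<^sup>2 + 4 * (norm z)\<^sup>2 * W * (norm F')\<^sup>2"
proof -
  have eq: "complex_of_real W = F * cnj F - (K + cnj K) / 2"
    unfolding W by (simp add: complex_norm_square[symmetric] complex_add_cnj)
  have re: "complex_of_real (Re x) = (x + cnj x) / 2" for x by (simp add: complex_add_cnj)
  have "complex_of_real (2 * (norm (F\<^sup>2 + 2 * z * F * F'))\<^sup>2 - 4 * Re ((F * K + z * F' * K + z * F * K') * cnj (F + z * F'))
      + Re (K\<^sup>2 + 2 * z * K * K') + (norm (K + z * K'))\<^sup>2)
     = complex_of_real (4 * (norm (z * (F' * cnj F - K' / 2) + of_real W))\<^sup>2 - 2 * W\<^sup>2 + 4 * (norm z)\<^sup>2 * W * (norm F')\<^sup>2)"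
    unfolding of_real_add of_real_diff of_real_mult re complex_norm_square of_real_power[of W] eq
    by (simp add: field_simps power2_eq_square)
  then show ?thesis by (simp only: of_real_eq_iff)
qed

text \<open>If \<open>u\<close> is the harmonic extension of \<open>|F|\<^sup>2\<close> and \<open>W = |F|\<^sup>2 - u + 2 \<in> [1, 2]\<close>, then
  \<open>2 |z|\<^sup>2 W\<^sup>2 + 24 |z|\<^sup>2 - |F|\<^sup>2\<close> is subharmonic; composing with \<open>\<psi>\<close> and taking means gives the bound.\<close>

lemma bmo_composition_poly:
  assumes g: "\<And>a. a \<in> \<bbbD> \<Longrightarrow> garsia (poly F) a \<le> ennreal 1"
    and \<psi>: "\<psi> holomorphic_on \<bbbD>" "\<psi> ` \<bbbD> \<subseteq> \<bbbD>" "\<psi> 0 = 0" and r: "0 \<le> r" "r < 1"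
  shows "circ_mean r (\<lambda>z. (norm (poly F (\<psi> z)))\<^sup>2) \<le> (norm (poly F 0))\<^sup>2 + 32 * circ_mean r (\<lambda>z. (norm (\<psi> z))\<^sup>2)"
proof -
  obtain K0 where K0: "\<And>z. norm z = 1 \<Longrightarrow> (norm (poly F z))\<^sup>2 = Re (poly K0 z)"
    using poly_norm_sq_on_circle by blast
  \<comment> \<open>Subtracting 2 shifts W into [1, 2], as Re K0 - |F|^2 lies in [0, 1] by the
    Garsia bound.\<close>
  define K where "K = K0 - [:2:]"
  define W where "W u = (norm (poly F u))\<^sup>2 - Re (poly K u)" for u
  have W: "1 \<le> W u" "W u \<le> 2" if "u \<in> \<bbbD>" for u
    using poly_harmonic_majorant_bounds(1)[OF K0 that] poly_harmonic_majorant_bounds(2)[OF K0 that g[OF that]]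
    by (auto simp: W_def K_def)
  define X where "X = ([:0, 1:] :: complex poly)"
  define h where "h p q z = Re (poly p (\<psi> z) * cnj (poly q (\<psi> z)))" for p q z
  define d where "d p q z = (norm (deriv \<psi> z))\<^sup>2 * Re (poly (pderiv p) (\<psi> z) * cnj (poly (pderiv q) (\<psi> z)))" for p q z
  have hp: "hermitian_pair (h p q) (d p q)" for p q
    unfolding h_def d_def by (rule hermitian_pair_poly[OF \<psi>(1)])
  \<comment> \<open>The first four terms are the expansion of 2 |\<psi>|^2 W(\<psi>)^2 into
    Hermitian products; \<open>Q\<close> takes the derivative of each factor.\<close>
  define Y where "Y z = 2 * h (X * F^2) (X * F^2) z + (-4) * h (X * F * K) (X * F) z + h (X * K^2) X z + h (X * K) (X * K) z
     + 24 * h X X z + (-1) * h F F z" for z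
  define Q where "Q z = 2 * d (X * F^2) (X * F^2) z + (-4) * d (X * F * K) (X * F) z + d (X * K^2) X z + d (X * K) (X * K) z
     + 24 * d X X z + (-1) * d F F z" for z
  have YQ: "hermitian_pair Y Q"
    unfolding Y_def[abs_def] Q_def[abs_def] by (intro hermitian_pair_add hermitian_pair_cmult hp)
  have nsq: "Re (x * cnj x) = (norm x)\<^sup>2" for x
    using complex_norm_square[of x] by (metis Re_complex_of_real)
  have Yeq: "Y z = 2 * (norm (\<psi> z))\<^sup>2 * (W (\<psi> z))\<^sup>2 + 24 * (norm (\<psi> z))\<^sup>2 - (norm (poly F (\<psi> z)))\<^sup>2" for z
    using weighted_form_identity[OF W_def[of "\<psi> z"], of "\<psi> z"]
    unfolding Y_def h_def X_def nsq by (simp add: nsq power2_eq_square mult_ac)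
  have "Q z \<ge> 0" if z: "norm z < 1" for z
  proof -
    define u where "u = \<psi> z"
    have u: "u \<in> \<bbbD>" using z \<psi>(2) unfolding u_def by (simp add: image_subset_iff)
    define F' where "F' = poly (pderiv F) u"
    define K' where "K' = poly (pderiv K) u"
    define S where "S = 2 * (norm ((poly F u)\<^sup>2 + 2 * u * poly F u * F'))\<^sup>2 - 4 * Re ((poly F u * poly K u + u * F' * poly K u + u * poly F u * K') * cnj (poly F u + u * F'))
      + Re ((poly K u)\<^sup>2 + 2 * u * poly K u * K') + (norm (poly K u + u * K'))\<^sup>2"
    have pd: "poly (pderiv (X * F^2)) u = (poly F u)\<^sup>2 + 2 * u * poly F u * F'"
       "poly (pderiv (X * F * K)) u = poly F u * poly K u + u * F' * poly K u + u * poly F u * K'"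
       "poly (pderiv (X * F)) u = poly F u + u * F'"
       "poly (pderiv (X * K^2)) u = (poly K u)\<^sup>2 + 2 * u * poly K u * K'"
       "poly (pderiv (X * K)) u = poly K u + u * K'" "poly (pderiv X) u = 1"
      by (simp_all add: X_def pderiv_mult power2_eq_square pderiv_pCons F'_def K'_def algebra_simps)
    have "Q z = (norm (deriv \<psi> z))\<^sup>2 * (S + 24 - (norm F')\<^sup>2)"
      unfolding Q_def d_def u_def[symmetric] pd nsq S_def F'_def[symmetric]
      by (simp add: nsq algebra_simps del: times_complex.sel plus_complex.sel complex_cnj_mult complex_cnj_add)
    moreover have "S + 24 - (norm F')\<^sup>2 \<ge> 0"
    proof -
      have "S = 4 * (norm (u * (F' * cnj (poly F u) - K' / 2) + of_real (W u)))\<^sup>2 - 2 * (W u)\<^sup>2 + 4 * (W u * ((norm u)\<^sup>2 * (norm F')\<^sup>2))"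
        unfolding S_def weighted_form_derivative_identity[OF W_def] by simp
      moreover have "(W u)\<^sup>2 \<le> 4" using power_mono[of "W u" 2 2] W[OF u] by simp
      moreover have "(norm u)\<^sup>2 * (norm F')\<^sup>2 \<le> W u * ((norm u)\<^sup>2 * (norm F')\<^sup>2)"
        using mult_right_mono[of 1 "W u" "(norm u)\<^sup>2 * (norm F')\<^sup>2"] W[OF u] by simp
      \<comment> \<open>24 = 8 + 16: the 8 pays for 2 W^2, the 16 for |F'|^2 near the origin. For
        |u| > 1/2 the gain 4 |u|^2 |F'|^2 dominates |F'|^2; for |u| <= 1/2 the Bloch bound gives
        |F'| <= 4.\<close>
      moreover have "(norm F')\<^sup>2 \<le> 4 * ((norm u)\<^sup>2 * (norm F')\<^sup>2) + 16"
      proof (cases "norm u \<le> 1/2")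
        case True
        have "norm F' * (1 - (norm u)\<^sup>2) \<le> 1"
          using norm_deriv_le_garsia[OF _ u g[OF u]] DERIV_imp_deriv[OF poly_DERIV[of F u]]
          by (simp add: F'_def holomorphic_intros)
        moreover have "(norm u)\<^sup>2 \<le> (1/2)\<^sup>2" using True by (intro power_mono) auto
        then have "norm F' * (3/4) \<le> norm F' * (1 - (norm u)\<^sup>2)"
          by (intro mult_left_mono) (auto simp: power2_eq_square)
        ultimately have "norm F' \<le> 4" by linarith
        then have "(norm F')\<^sup>2 \<le> 4\<^sup>2" by (intro power_mono) auto
        then show ?thesis by (simp add: add_increasing)
      next
        case False
        then have "(1/2)\<^sup>2 \<le> (norm u)\<^sup>2" by (intro power_mono) auto
        then have "1 * (norm F')\<^sup>2 \<le> (4 * (norm u)\<^sup>2) * (norm F')\<^sup>2"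
          by (intro mult_right_mono) (auto simp: power2_eq_square)
        then show ?thesis by simp
      qed
      ultimately show ?thesis
        using zero_le_power2[of "norm (u * (F' * cnj (poly F u) - K' / 2) + of_real (W u))"] by linarith
    qed
    ultimately show ?thesis by simp
  qed
  then have "Y 0 \<le> circ_mean r Y"
    by (rule hermitian_pair_submean[OF YQ _ r])
  note contS = holomorphic_continuous_on_sphere[OF _ r(2)]
  have c\<psi>: "continuous_on (sphere 0 r) \<psi>" by (rule contS[OF \<psi>(1)])
  have cF: "continuous_on (sphere 0 r) (\<lambda>z. poly F (\<psi> z))" "continuous_on (sphere 0 r) (\<lambda>z. poly K (\<psi> z))"
    by (intro contS holomorphic_intros \<psi>(1))+
  have cY: "continuous_on (sphere 0 r) Y"
    unfolding Yeq W_def by (intro continuous_intros c\<psi> cF)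
  have "- (norm (poly F 0))\<^sup>2 = Y 0" by (simp add: Yeq \<psi>(3))
  also have "\<dots> \<le> circ_mean r Y" by fact
  \<comment> \<open>32 = 2 * 2^2 + 24, from W <= 2.\<close>
  also have "\<dots> \<le> circ_mean r (\<lambda>z. 32 * (norm (\<psi> z))\<^sup>2 - (norm (poly F (\<psi> z)))\<^sup>2)"
  proof (rule circ_mean_mono[OF cY])
    fix z :: complex assume z: "norm z = r"
    have "\<psi> z \<in> \<bbbD>" using z r \<psi>(2) by (simp add: image_subset_iff)
    from W[OF this] have "(W (\<psi> z))\<^sup>2 \<le> 2\<^sup>2" by (intro power_mono) auto
    then have "2 * (norm (\<psi> z))\<^sup>2 * (W (\<psi> z))\<^sup>2 \<le> 2 * (norm (\<psi> z))\<^sup>2 * 2\<^sup>2" by (intro mult_left_mono) auto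
    then show "Y z \<le> 32 * (norm (\<psi> z))\<^sup>2 - (norm (poly F (\<psi> z)))\<^sup>2" by (simp add: Yeq)
  qed (use r in \<open>auto intro!: continuous_intros c\<psi> cF\<close>)
  also have "\<dots> = circ_mean r (\<lambda>z. 32 * (norm (\<psi> z))\<^sup>2) - circ_mean r (\<lambda>z. (norm (poly F (\<psi> z)))\<^sup>2)"
    by (intro circ_mean_diff continuous_intros c\<psi> cF r)
  also have "circ_mean r (\<lambda>z. 32 * (norm (\<psi> z))\<^sup>2) = 32 * circ_mean r (\<lambda>z. (norm (\<psi> z))\<^sup>2)"
    by (intro circ_mean_mult_left continuous_intros c\<psi> r)
  finally show ?thesis by simp
qed

subsection \<open>Composition estimates\<close>

lemma circle_mean2_cmult: "circle_mean2 (\<lambda>z. c * f z) r = norm c * circle_mean2 f r"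
  unfolding circle_mean2_eq
  using real_sqrt_mult[of "(norm c)\<^sup>2" "circ_mean r (\<lambda>z. (norm (f z))\<^sup>2)"]
  by (simp add: circ_mean_def norm_mult power_mult_distrib)

lemma h2_norm_cmult_le:
  assumes "h2_norm f \<le> ennreal M" "M \<ge> 0"
  shows "h2_norm (\<lambda>z. c * f z) \<le> ennreal (norm c * M)"
  using assms by (auto simp: h2_norm_le_iff circle_mean2_cmult mult_left_mono)

lemma garsia_cmult_le:
  assumes "garsia f a \<le> ennreal M" "M \<ge> 0"
  shows "garsia (\<lambda>z. c * f z) a \<le> ennreal (norm c * M)"
  using h2_norm_cmult_le[of "\<lambda>z. f (\<sigma> a z) - f a" M c] assms by (simp add: garsia_def right_diff_distrib)

lemma circle_mean2_cong:
  assumes "\<And>z. norm z = r \<Longrightarrow> f z = g z" "r \<ge> 0"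
  shows "circle_mean2 f r = circle_mean2 g r"
  unfolding circle_mean2_eq using assms by (auto intro!: arg_cong[where f = sqrt] circ_mean_cong)

lemma disc_scale:
  assumes "0 < t" "t < 1" "norm z \<le> 1"
  shows "of_real t * z \<in> \<bbbD>"
proof -
  have "t * norm z \<le> t * 1" using assms by (intro mult_left_mono) auto
  then have "t * norm z < 1" using assms by linarith
  then show ?thesis using assms by (simp add: norm_mult)
qed

lemma bmo_composition_circle:
  assumes F: "F holomorphic_on \<bbbD>" "F 0 = 0" and g: "\<And>a. a \<in> \<bbbD> \<Longrightarrow> garsia F a \<le> ennreal 1"
    and \<psi>: "\<psi> holomorphic_on \<bbbD>" "\<psi> ` \<bbbD> \<subseteq> \<bbbD>" "\<psi> 0 = 0" and r: "0 < r" "r < 1"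
  shows "circle_mean2 (\<lambda>z. F (\<psi> z)) r \<le> 6 * circle_mean2 \<psi> r"
proof (rule field_le_epsilon)
  fix e' :: real assume e': "e' > 0"
  \<comment> \<open>17 = 3 + 2 + 12 collects the errors 3 e + 2 e^2 + 12 e m at the end, with e and
    m at most 1.\<close>
  define e where "e = min 1 (e' / 17)"
  have e: "0 < e" "e \<le> 1" "17 * e \<le> e'" using e' by (auto simp: e_def)
  have \<psi>r: "norm (\<psi> z) \<le> r" if "norm z = r" for z
    using Schwarz_Lemma(1)[OF \<psi>(1,3), of z] \<psi>(2) r that by (force simp: image_subset_iff)
  obtain t where t: "0 < t" "t < 1" "\<And>z. norm z \<le> r \<Longrightarrow> norm (F (of_real t * z) - F z) < e"
    using dilation_approx[OF F(1) r(2) e(1)] by auto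
  obtain p where p: "\<And>z. norm z \<le> 1 \<Longrightarrow> norm (F (of_real t * z) - poly p z) < e"
    "\<And>a. a \<in> \<bbbD> \<Longrightarrow> garsia (poly p) a \<le> garsia F (of_real t * a) + ennreal (2 * e)"
    using dilation_polynomial[OF F(1) t(1,2) e(1)] by auto
  \<comment> \<open>Approximation raises the Garsia bound to 1 + 2 e; dividing by k restores the
    normalization of the polynomial case.\<close>
  define k where "k = 1 + 2 * e"
  have k: "k \<ge> 1" "k \<le> 3" using e by (auto simp: k_def)
  define q where "q = smult (of_real (1/k)) p"
  have q: "poly q = (\<lambda>z. of_real (1/k) * poly p z)" by (auto simp: q_def)
  have qp: "poly p z = of_real k * poly q z" for z using k by (simp add: q_def)
  have gq: "garsia (poly q) a \<le> ennreal 1" if "a \<in> \<bbbD>" for a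
  proof -
    have "garsia (poly p) a \<le> ennreal 1 + ennreal (2 * e)"
      using p(2)[OF that] g[OF disc_scale[OF t(1,2)], of a] that
      by (meson add_right_mono dual_order.trans less_imp_le mem_ball_0)
    also have "\<dots> = ennreal k" using e by (simp add: k_def)
    finally have "garsia (poly p) a \<le> ennreal k" .
    from garsia_cmult_le[OF this, of "of_real (1/k)"] show ?thesis
      using k by (simp add: q norm_divide)
  qed
  have q0: "norm (poly q 0) \<le> e"
  proof -
    have "norm (poly p 0) < e" using p(1)[of 0] F(2) by simp
    then have "k * norm (poly q 0) < e" using k by (simp add: qp norm_mult)
    moreover have "1 * norm (poly q 0) \<le> k * norm (poly q 0)" using k by (intro mult_right_mono) auto
    ultimately show ?thesis by simp
  qed
  define m where "m = circle_mean2 \<psi> r"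
  have m: "m \<ge> 0" "m\<^sup>2 = circ_mean r (\<lambda>z. (norm (\<psi> z))\<^sup>2)" "m \<le> 1"
  proof -
    show "m \<ge> 0" by (simp add: m_def circle_mean2_nonneg)
    have "circ_mean r (\<lambda>z. (norm (\<psi> z))\<^sup>2) \<ge> 0"
      by (rule circ_mean_nonneg) (use r in \<open>auto intro!: continuous_intros holomorphic_continuous_on_sphere[OF \<psi>(1)]\<close>)
    then show "m\<^sup>2 = circ_mean r (\<lambda>z. (norm (\<psi> z))\<^sup>2)" by (simp add: m_def circle_mean2_eq)
    show "m \<le> 1" unfolding m_def
      by (rule circle_mean2_le_bound) (use r \<psi>r in \<open>force intro!: holomorphic_continuous_on_sphere[OF \<psi>(1)]\<close>)+
  qed
  have cq: "circle_mean2 (\<lambda>z. poly q (\<psi> z)) r \<le> e + 6 * m"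
  proof -
    have "circ_mean r (\<lambda>z. (norm (poly q (\<psi> z)))\<^sup>2) \<le> (norm (poly q 0))\<^sup>2 + 32 * m\<^sup>2"
      using bmo_composition_poly[OF gq \<psi>, of r] r m(2) by simp
    also have "\<dots> \<le> e\<^sup>2 + 32 * m\<^sup>2" using q0 by (intro add_right_mono power_mono) auto
    \<comment> \<open>32 is enlarged to 36 and a cross term added to obtain a perfect square, whence
      the constant 6.\<close>
    also have "\<dots> \<le> e\<^sup>2 + 36 * m\<^sup>2 + 12 * e * m" using e m(1) by simp
    also have "\<dots> = (e + 6 * m)\<^sup>2"
      by (simp add: power2_eq_square algebra_simps)
    finally show ?thesis unfolding circle_mean2_eq using e m by (intro real_le_lsqrt) auto
  qed
  have "circle_mean2 (\<lambda>z. F (\<psi> z)) r \<le> circle_mean2 (\<lambda>z. poly p (\<psi> z)) r + 2 * e"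
  proof (rule circle_mean2_approx)
    fix z :: complex assume "norm z = r"
    then have "norm (\<psi> z) \<le> r" by (rule \<psi>r)
    then have "norm (F (of_real t * \<psi> z) - F (\<psi> z)) < e" "norm (F (of_real t * \<psi> z) - poly p (\<psi> z)) < e"
      using t(3) p(1) r by auto
    then show "norm (F (\<psi> z) - poly p (\<psi> z)) \<le> 2 * e"
      using norm_triangle_ineq4[of "F (of_real t * \<psi> z) - poly p (\<psi> z)" "F (of_real t * \<psi> z) - F (\<psi> z)"] by simp
  qed (use r in \<open>auto intro!: holomorphic_intros holomorphic_on_disc_compose[OF F(1)] \<psi>\<close>)
  also have "circle_mean2 (\<lambda>z. poly p (\<psi> z)) r = k * circle_mean2 (\<lambda>z. poly q (\<psi> z)) r"
    using k by (simp add: qp circle_mean2_cmult)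
  also have "\<dots> \<le> k * (e + 6 * m)" using cq k by (intro mult_left_mono) auto
  also have "\<dots> + 2 * e = 6 * m + (3 * e + 2 * e * e + 12 * e * m)"
    by (simp add: k_def algebra_simps)
  also have "\<dots> \<le> 6 * m + (3 * e + 2 * e * 1 + 12 * e * 1)"
    using e m by (intro add_left_mono add_mono mult_left_mono) auto
  finally have "circle_mean2 (\<lambda>z. F (\<psi> z)) r \<le> 6 * m + 17 * e" by simp
  then show "circle_mean2 (\<lambda>z. F (\<psi> z)) r \<le> 6 * circle_mean2 \<psi> r + e'"
    using e by (simp add: m_def)
qed

lemma garsia_disc_aut:
  assumes "f holomorphic_on \<bbbD>" "w \<in> \<bbbD>" "b \<in> \<bbbD>"
  shows "garsia (\<lambda>z. f (\<sigma> w z) - c) b \<le> garsia f (\<sigma> w b)"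
  using garsia_compose[OF assms(1) disc_aut_holomorphic[OF assms(2)] disc_aut_image[OF assms(2)] assms(3)]
  by (simp add: garsia_def)

text \<open>With w = \<phi> a and F = f o \<sigma>_w - f w, the function f o \<phi> o \<sigma>_a - f
  w is F o \<psi>. The Garsia bound passes from f to F because \<open>\<sigma> w\<close> maps the
  disc to itself.\<close>

theorem bmo_composition_bound:
  assumes f: "f holomorphic_on \<bbbD>" and g: "\<And>b. b \<in> \<bbbD> \<Longrightarrow> garsia f b \<le> ennreal 1"
    and \<phi>: "\<phi> holomorphic_on \<bbbD>" "\<phi> ` \<bbbD> \<subseteq> \<bbbD>" and a: "a \<in> \<bbbD>"
    and k: "h2_norm (\<sigma> (\<phi> a) \<circ> \<phi> \<circ> \<sigma> a) \<le> ennreal k" "k \<ge> 0"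
  shows "garsia (\<lambda>z. f (\<phi> z)) a \<le> ennreal (6 * k)"
proof -
  define w where "w = \<phi> a"
  have w: "w \<in> \<bbbD>" using \<phi>(2) a by (auto simp: w_def image_subset_iff)
  define \<psi> where "\<psi> = \<sigma> w \<circ> \<phi> \<circ> \<sigma> a"
  have im: "\<phi> (\<sigma> a z) \<in> \<bbbD>" if "z \<in> \<bbbD>" for z using \<phi>(2) disc_aut_in_disc(2)[OF a that] by blast
  have \<psi>: "\<psi> holomorphic_on \<bbbD>" "\<psi> ` \<bbbD> \<subseteq> \<bbbD>" "\<psi> 0 = 0"
    unfolding \<psi>_def w_def by (rule disc_aut_conjugate[OF \<phi> a])+
  define F where "F z = f (\<sigma> w z) - f w" for z
  have F: "F holomorphic_on \<bbbD>" "F 0 = 0"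
    unfolding F_def by (intro holomorphic_intros holomorphic_disc_aut_compose f w) simp
  have gF: "garsia F b \<le> ennreal 1" if "b \<in> \<bbbD>" for b
    using garsia_disc_aut[OF f w that, of "f w"] g[OF disc_aut_in_disc(2)[OF w that]]
    unfolding F_def[abs_def] by simp
  have "circle_mean2 (\<lambda>z. f (\<phi> (\<sigma> a z)) - f (\<phi> a)) r \<le> 6 * k" if r: "0 < r" "r < 1" for r
  proof -
    have "circle_mean2 (\<lambda>z. f (\<phi> (\<sigma> a z)) - f (\<phi> a)) r = circle_mean2 (\<lambda>z. F (\<psi> z)) r"
    proof (rule circle_mean2_cong)
      fix z :: complex assume "norm z = r"
      then have "\<phi> (\<sigma> a z) \<in> \<bbbD>" using im r by auto
      then show "f (\<phi> (\<sigma> a z)) - f (\<phi> a) = F (\<psi> z)"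
        using disc_aut_involution[OF w] by (simp add: F_def \<psi>_def w_def)
    qed (use r in auto)
    also have "\<dots> \<le> 6 * circle_mean2 \<psi> r" by (rule bmo_composition_circle[OF F gF \<psi> r])
    also have "\<dots> \<le> 6 * k"
      using circle_mean2_le_h2_norm[OF k r] by (simp add: \<psi>_def w_def)
    finally show ?thesis .
  qed
  then show ?thesis unfolding garsia_def using k by (subst h2_norm_le_iff) auto
qed

section \<open>Maximum principle for the harmonic extension\<close>

text \<open>At radii below 1 the boundary identity becomes the inequality |q|^2 <= Re K, while Re K
  o \<sigma>_a still has mean Re K at a.\<close>

lemma poly_majorant_circle_mean:
  assumes K: "\<And>z. norm z = 1 \<Longrightarrow> (norm (poly q z))\<^sup>2 = Re (poly K z)" and a: "a \<in> \<bbbD>"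
    and B: "Re (poly K a) \<le> B\<^sup>2" "B \<ge> 0" and s: "0 < s" "s < 1"
  shows "circle_mean2 (\<lambda>z. poly q (\<sigma> a z) - poly q a) s \<le> B"
proof -
  have hp: "(\<lambda>z. poly p (\<sigma> a z)) holomorphic_on \<bbbD>" for p
    by (intro holomorphic_intros disc_aut_holomorphic a)
  have cont: "continuous_on (sphere 0 s) (\<lambda>z. poly p (\<sigma> a z))" for p
    by (rule holomorphic_continuous_on_sphere[OF hp s(2)])
  have "circ_mean s (\<lambda>z. (norm (poly q (\<sigma> a z) - poly q a))\<^sup>2)
      = circ_mean s (\<lambda>z. (norm (poly q (\<sigma> a z)))\<^sup>2) - (norm (poly q a))\<^sup>2"
    using circ_mean_norm_diff_sq[OF hp, of s q] s by simp
  also have "circ_mean s (\<lambda>z. (norm (poly q (\<sigma> a z)))\<^sup>2) \<le> circ_mean s (\<lambda>z. Re (poly K (\<sigma> a z)))"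
    by (rule circ_mean_mono)
       (use s disc_aut_in_disc(2)[OF a] in \<open>auto intro!: continuous_intros cont poly_harmonic_majorant_bounds(1)[OF K]\<close>)
  also have "\<dots> = Re (circ_mean s (\<lambda>z. poly K (\<sigma> a z)))"
    by (intro circ_mean_Re cont) (use s in auto)
  also have "circ_mean s (\<lambda>z. poly K (\<sigma> a z)) = poly K a"
    using circ_mean_holomorphic[OF hp, of s K] s by simp
  finally have "circ_mean s (\<lambda>z. (norm (poly q (\<sigma> a z) - poly q a))\<^sup>2) \<le> B\<^sup>2"
    using B by (smt (verit) zero_le_power2)
  then show ?thesis unfolding circle_mean2_eq using B by (simp add: real_le_lsqrt)
qed

text \<open>The harmonic extension of \<open>|H|\<^sup>2\<close> is at most \<open>\<delta>\<^sup>2 + \<epsilon>\<^sup>2\<close> on the boundary of \<open>\<Omega>\<close>, hence on \<open>\<Omega>\<close>.\<close>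

theorem garsia_maximum_principle:
  assumes H: "H holomorphic_on \<bbbD>" and \<Omega>: "open \<Omega>"
    and \<delta>: "\<And>z. z \<in> \<bbbD> \<Longrightarrow> z \<in> closure \<Omega> \<Longrightarrow> norm (H z) \<le> \<delta>" "\<delta> \<ge> 0"
    and \<epsilon>: "\<And>z. z \<in> \<bbbD> \<Longrightarrow> z \<notin> \<Omega> \<Longrightarrow> garsia H z \<le> ennreal \<epsilon>" "\<epsilon> \<ge> 0"
    and a: "a \<in> \<bbbD>"
  shows "garsia H a \<le> ennreal (\<delta> + \<epsilon>)"
proof -
  have "circle_mean2 (\<lambda>z. H (\<sigma> a z) - H a) s \<le> \<delta> + \<epsilon>" if s: "0 < s" "s < 1" for s
  proof (rule field_le_epsilon)
    fix e :: real assume e: "e > 0"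
    \<comment> \<open>7 = 3 + 4: the bound \<open>B\<close> exceeds \<delta> + \<epsilon> by 3
      \<tau>, and replacing H by q costs 2 \<tau> at each of \<open>\<sigma> a z\<close> and
      \<open>a\<close>.\<close>
    define \<tau> where "\<tau> = e / 7"
    have \<tau>: "\<tau> > 0" using e by (simp add: \<tau>_def)
    have "compact (insert a (\<sigma> a ` sphere 0 s))"
      by (intro compact_insert compact_continuous_image holomorphic_continuous_on_sphere[OF disc_aut_holomorphic[OF a] s(2)] compact_sphere)
    moreover have "insert a (\<sigma> a ` sphere 0 s) \<subseteq> \<bbbD>" using a s disc_aut_in_disc(2)[OF a] by auto
    \<comment> \<open>For fixed s only the values of H at a and on the image circle matter; they lie
      in a smaller closed disc, where dilation is a small perturbation.\<close>
    ultimately obtain R where R: "R < 1" "\<And>z. z \<in> insert a (\<sigma> a ` sphere 0 s) \<Longrightarrow> norm z \<le> R"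
    proof -
      assume c: "compact (insert a (\<sigma> a ` sphere 0 s))" and sub: "insert a (\<sigma> a ` sphere 0 s) \<subseteq> \<bbbD>"
      obtain z0 where "z0 \<in> insert a (\<sigma> a ` sphere 0 s)" "\<And>z. z \<in> insert a (\<sigma> a ` sphere 0 s) \<Longrightarrow> norm z \<le> norm z0"
        using continuous_attains_sup[OF c _ continuous_on_norm_id] by auto
      then show ?thesis using sub that[of "norm z0"] by auto
    qed
    obtain t where t: "0 < t" "t < 1" "\<And>z. norm z \<le> R \<Longrightarrow> norm (H (of_real t * z) - H z) < \<tau>"
      using dilation_approx[OF H R(1) \<tau>] by auto
    obtain q where q: "\<And>z. norm z \<le> 1 \<Longrightarrow> norm (H (of_real t * z) - poly q z) < \<tau>"
      "\<And>a. a \<in> \<bbbD> \<Longrightarrow> garsia (poly q) a \<le> garsia H (of_real t * a) + ennreal (2 * \<tau>)"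
      using dilation_polynomial[OF H t(1,2) \<tau>] by auto
    obtain K where K: "\<And>z. norm z = 1 \<Longrightarrow> (norm (poly q z))\<^sup>2 = Re (poly K z)"
      using poly_norm_sq_on_circle by blast
    define B where "B = \<delta> + \<epsilon> + 3 * \<tau>"
    have B: "B \<ge> 0" using \<delta>(2) \<epsilon>(2) \<tau> by (simp add: B_def)
    have gq: "garsia (poly q) z \<le> ennreal (\<epsilon> + 2 * \<tau>)" if "z \<in> \<bbbD>" "of_real t * z \<notin> \<Omega>" for z
    proof -
      have "garsia (poly q) z \<le> garsia H (of_real t * z) + ennreal (2 * \<tau>)" by (rule q(2)[OF that(1)])
      also have "\<dots> \<le> ennreal \<epsilon> + ennreal (2 * \<tau>)"
        by (intro add_right_mono \<epsilon>(1) disc_scale t that) (use that in auto)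
      finally show ?thesis using \<epsilon>(2) \<tau> by simp
    qed
    define \<Omega>t where "\<Omega>t = \<bbbD> \<inter> (\<lambda>z. of_real t * z) -` \<Omega>"
    have op: "open \<Omega>t" unfolding \<Omega>t_def
      by (intro open_Int open_vimage \<Omega> continuous_intros) auto
    have bound: "Re (poly K z) \<le> B\<^sup>2" if z: "z \<in> \<Omega>t" for z
    proof (rule maximum_real_frontier[of "poly K" \<Omega>t])
      show "bounded \<Omega>t" by (rule bounded_subset[OF bounded_ball[of 0 1]]) (auto simp: \<Omega>t_def)
      fix z assume "z \<in> frontier \<Omega>t"
      then have zc: "z \<in> closure \<Omega>t" and zn: "z \<notin> \<Omega>t"
        using op by (auto simp: frontier_def interior_open)
      have "closure \<Omega>t \<subseteq> cball 0 1"
        by (rule closure_minimal) (auto simp: \<Omega>t_def)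
      with zc have z1: "norm z \<le> 1" by auto
      have "(\<lambda>z. of_real t * z) ` closure \<Omega>t \<subseteq> closure \<Omega>"
        by (rule image_closure_subset) (auto intro!: continuous_intros simp: \<Omega>t_def closure_subset[THEN subsetD])
      then have "of_real t * z \<in> closure \<Omega>" using zc by auto
      then have "norm (H (of_real t * z)) \<le> \<delta>" by (intro \<delta>(1) disc_scale t z1)
      then have qz: "norm (poly q z) \<le> \<delta> + \<tau>"
        using q(1)[OF z1] norm_triangle_ineq2[of "poly q z" "H (of_real t * z)"] by (simp add: norm_minus_commute)
      then have qz2: "(norm (poly q z))\<^sup>2 \<le> (\<delta> + \<tau>)\<^sup>2" by (intro power_mono) auto
      have BB: "(\<delta> + \<tau>)\<^sup>2 + (\<epsilon> + 2 * \<tau>)\<^sup>2 \<le> B\<^sup>2"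
      proof -
        have "B\<^sup>2 = (\<delta> + \<tau>)\<^sup>2 + (\<epsilon> + 2 * \<tau>)\<^sup>2 + 2 * (\<delta> + \<tau>) * (\<epsilon> + 2 * \<tau>)"
          by (simp add: B_def power2_eq_square algebra_simps)
        then show ?thesis using \<delta>(2) \<epsilon>(2) \<tau> by simp
      qed
      show "Re (poly K z) \<le> B\<^sup>2"
      \<comment> \<open>On the unit circle Re K equals |q|^2. A frontier point inside the disc has
        its dilate in the closure of \<Omega> but outside \<Omega>, so the \<delta>-bound and the
        \<epsilon>-bound both apply.\<close>
      proof (cases "norm z = 1")
        case True
        then show ?thesis using K[OF True] qz2 BB by (smt (verit) zero_le_power2)
      next
        case False
        then have zD: "z \<in> \<bbbD>" using z1 by auto
        then have "of_real t * z \<notin> \<Omega>" using zn by (auto simp: \<Omega>t_def)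
        from poly_harmonic_majorant_bounds(2)[OF K zD gq[OF zD this]]
        have "Re (poly K z) \<le> (norm (poly q z))\<^sup>2 + (\<epsilon> + 2 * \<tau>)\<^sup>2" using \<epsilon>(2) \<tau> by simp
        then show ?thesis using qz2 BB by linarith
      qed
    qed (use z in \<open>auto intro!: holomorphic_intros continuous_intros\<close>)
    have cq: "circle_mean2 (\<lambda>z. poly q (\<sigma> a z) - poly q a) s \<le> B"
    proof (cases "of_real t * a \<in> \<Omega>")
      case True
      then have "a \<in> \<Omega>t" using a by (simp add: \<Omega>t_def)
      from poly_majorant_circle_mean[OF K a bound[OF this] B s] show ?thesis .
    next
      case False
      have "circle_mean2 (\<lambda>z. poly q (\<sigma> a z) - poly q a) s \<le> \<epsilon> + 2 * \<tau>"
        by (rule circle_mean2_le_h2_norm) (use gq[OF a False] \<epsilon>(2) \<tau> s in \<open>auto simp: garsia_def\<close>)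
      then show ?thesis using \<delta>(2) \<tau> by (simp add: B_def)
    qed
    have "circle_mean2 (\<lambda>z. H (\<sigma> a z) - H a) s \<le> circle_mean2 (\<lambda>z. poly q (\<sigma> a z) - poly q a) s + 4 * \<tau>"
    proof (rule circle_mean2_approx)
      fix z :: complex assume z: "norm z = s"
      have Hq: "norm (H u - poly q u) \<le> 2 * \<tau>" if "u \<in> insert a (\<sigma> a ` sphere 0 s)" for u
      proof -
        have "norm u \<le> R" by (rule R(2)[OF that])
        then have "norm (H (of_real t * u) - H u) < \<tau>" "norm (H (of_real t * u) - poly q u) < \<tau>"
          using t(3) q(1) R(1) by auto
        then show ?thesis
          using norm_triangle_ineq4[of "H (of_real t * u) - poly q u" "H (of_real t * u) - H u"] by simp
      qed
      have "norm (H (\<sigma> a z) - poly q (\<sigma> a z)) \<le> 2 * \<tau>" "norm (H a - poly q a) \<le> 2 * \<tau>"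
        using z by (auto intro!: Hq)
      then show "norm (H (\<sigma> a z) - H a - (poly q (\<sigma> a z) - poly q a)) \<le> 4 * \<tau>"
        using norm_triangle_ineq4[of "H (\<sigma> a z) - poly q (\<sigma> a z)" "H a - poly q a"] by (simp add: algebra_simps)
    qed (use s a in \<open>auto intro!: holomorphic_intros holomorphic_disc_aut_compose H disc_aut_holomorphic\<close>)
    with cq show "circle_mean2 (\<lambda>z. H (\<sigma> a z) - H a) s \<le> \<delta> + \<epsilon> + e"
      by (simp add: B_def \<tau>_def)
  qed
  then show ?thesis unfolding garsia_def using \<delta>(2) \<epsilon>(2) by (subst h2_norm_le_iff) auto
qed

subsection \<open>Compactness\<close>

lemma garsia_cong:
  assumes "\<And>z. z \<in> \<bbbD> \<Longrightarrow> f z = g z" "a \<in> \<bbbD>"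
  shows "garsia f a = garsia g a"
  unfolding garsia_def h2_norm_def
proof (intro SUP_cong refl arg_cong[where f = ennreal] circle_mean2_cong)
  fix r :: real and z :: complex assume "r \<in> {0<..<1}" "norm z = r"
  then have "\<sigma> a z \<in> \<bbbD>" by (intro disc_aut_in_disc assms) auto
  then show "f (\<sigma> a z) - f a = g (\<sigma> a z) - g a" using assms by simp
qed auto

lemma bmoa_garsia_le:
  assumes "f \<in> bmoa" "a \<in> \<bbbD>"
  shows "garsia f a \<le> ennreal (bmoa_norm f)"
proof -
  have "garsia f a \<le> bmoa_seminorm f" by (rule garsia_le_seminorm[OF assms(2)])
  also have "bmoa_seminorm f = ennreal (enn2real (bmoa_seminorm f))"
    using assms by (simp add: bmoa_def)
  also have "\<dots> \<le> ennreal (bmoa_norm f)" by (intro ennreal_leI) (simp add: bmoa_norm_def)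
  finally show ?thesis .
qed

lemma bmoa_norm_nonneg [simp]: "bmoa_norm f \<ge> 0"
  by (simp add: bmoa_norm_def)

lemma bmoa_holomorphic: "f \<in> bmoa \<Longrightarrow> f holomorphic_on \<bbbD>"
  by (simp add: bmoa_def)

lemma bmoaI:
  assumes "f holomorphic_on \<bbbD>" "\<And>z. z \<notin> \<bbbD> \<Longrightarrow> f z = 0" "\<And>a. a \<in> \<bbbD> \<Longrightarrow> garsia f a \<le> ennreal M" "M \<ge> 0"
  shows "f \<in> bmoa" "bmoa_norm f \<le> norm (f 0) + M"
proof -
  have s: "bmoa_seminorm f \<le> ennreal M"
    unfolding bmoa_seminorm_eq using assms(3) by (intro SUP_least)
  then show "f \<in> bmoa" using assms(1,2) by (auto simp: bmoa_def intro: le_less_trans)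
  have "enn2real (bmoa_seminorm f) \<le> enn2real (ennreal M)" using s by (intro enn2real_mono) auto
  then show "bmoa_norm f \<le> norm (f 0) + M" using assms(4) by (simp add: bmoa_norm_def)
qed

text \<open>Mean value inequality with the Bloch bound: on |u| <= R the weight 1 - |u|^2 is at least
  1 - R^2.\<close>

lemma norm_le_garsia_bound:
  assumes f: "f holomorphic_on \<bbbD>" and M: "\<And>a. a \<in> \<bbbD> \<Longrightarrow> garsia f a \<le> ennreal M" "M \<ge> 0"
    and R: "R < 1" "norm z \<le> R"
  shows "norm (f z) \<le> norm (f 0) + M / (1 - R\<^sup>2)"
proof -
  have R0: "R \<ge> 0" using R norm_ge_zero order_trans by blast
  have R2: "R\<^sup>2 < 1" using R R0 by (simp add: abs_square_less_1)
  have "norm (f z - f 0) \<le> M / (1 - R\<^sup>2) * norm (z - 0)"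
  proof (rule field_differentiable_bound[of "cball 0 R" f "deriv f"])
    fix u :: complex assume u: "u \<in> cball 0 R"
    then have uD: "u \<in> \<bbbD>" using R by auto
    show "(f has_field_derivative deriv f u) (at u within cball 0 R)"
      by (rule has_field_derivative_at_within[OF holomorphic_derivI[OF f open_ball uD]])
    have "(norm u)\<^sup>2 \<le> R\<^sup>2" using u by (intro power_mono) auto
    then have "norm (deriv f u) * (1 - R\<^sup>2) \<le> norm (deriv f u) * (1 - (norm u)\<^sup>2)"
      by (intro mult_left_mono) auto
    also have "\<dots> \<le> M" by (rule norm_deriv_le_garsia[OF f uD M(1)[OF uD] M(2)])
    finally show "norm (deriv f u) \<le> M / (1 - R\<^sup>2)" using R2 by (simp add: field_simps)
  qed (use R R0 in auto)
  also have "\<dots> \<le> M / (1 - R\<^sup>2) * 1" using M R R2 by (intro mult_left_mono) auto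
  finally show ?thesis using norm_triangle_ineq2[of "f z" "f 0"] by simp
qed

lemma bmoa_pointwise_bound:
  assumes "f \<in> bmoa" "R < 1" "norm z \<le> R"
  shows "norm (f z) \<le> (1 + 1 / (1 - R\<^sup>2)) * bmoa_norm f"
proof -
  have "norm (f z) \<le> norm (f 0) + bmoa_norm f / (1 - R\<^sup>2)"
    by (rule norm_le_garsia_bound) (use assms in \<open>auto intro: bmoa_holomorphic bmoa_garsia_le\<close>)
  also have "norm (f 0) \<le> bmoa_norm f" by (simp add: bmoa_norm_def)
  finally show ?thesis by (simp add: algebra_simps)
qed

lemma comp_op_holomorphic:
  assumes "f holomorphic_on \<bbbD>" "\<phi> holomorphic_on \<bbbD>" "\<phi> ` \<bbbD> \<subseteq> \<bbbD>"
  shows "comp_op \<phi> f holomorphic_on \<bbbD>"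
  using holomorphic_on_disc_compose[OF assms] by (rule holomorphic_transform) (auto simp: comp_op_def)

lemma comp_op_garsia: "a \<in> \<bbbD> \<Longrightarrow> garsia (comp_op \<phi> f) a = garsia (\<lambda>z. f (\<phi> z)) a"
  by (rule garsia_cong) (auto simp: comp_op_def)

lemma comp_op_bmoa:
  assumes "f \<in> bmoa" "\<phi> holomorphic_on \<bbbD>" "\<phi> ` \<bbbD> \<subseteq> \<bbbD>"
  shows "comp_op \<phi> f \<in> bmoa"
proof (rule bmoaI(1))
  show "comp_op \<phi> f holomorphic_on \<bbbD>" by (intro comp_op_holomorphic bmoa_holomorphic assms)
  fix a assume a: "a \<in> \<bbbD>"
  have "garsia (\<lambda>z. f (\<phi> z)) a \<le> garsia f (\<phi> a)"
    by (rule garsia_compose[OF bmoa_holomorphic[OF assms(1)] assms(2,3) a])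
  also have "\<dots> \<le> ennreal (bmoa_norm f)"
    by (rule bmoa_garsia_le) (use assms a in \<open>auto simp: image_subset_iff\<close>)
  finally show "garsia (comp_op \<phi> f) a \<le> ennreal (bmoa_norm f)" by (simp add: comp_op_garsia[OF a])
qed (auto simp: comp_op_def)

lemma garsia_add_le:
  assumes "f holomorphic_on \<bbbD>" "g holomorphic_on \<bbbD>" "a \<in> \<bbbD>"
  shows "garsia (\<lambda>z. f z + g z) a \<le> garsia f a + garsia g a"
proof -
  have "(\<lambda>z. f (\<sigma> a z) + g (\<sigma> a z) - (f a + g a)) = (\<lambda>z. (f (\<sigma> a z) - f a) + (g (\<sigma> a z) - g a))" by auto
  then show ?thesis unfolding garsia_def
    using h2_norm_triangle[of "\<lambda>z. f (\<sigma> a z) - f a" "\<lambda>z. g (\<sigma> a z) - g a"] assms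
    by (simp add: holomorphic_intros holomorphic_disc_aut_compose)
qed

text \<open>\<rho> is chosen before h and a: one radius has to serve a whole bounded family of
  functions and every point of the disc.\<close>

lemma composition_small:
  assumes \<phi>: "\<phi> holomorphic_on \<bbbD>" "\<phi> ` \<bbbD> \<subseteq> \<bbbD>"
    and van: "vanishes_at_image_boundary \<phi> (\<lambda>a. h2_norm (\<sigma> (\<phi> a) \<circ> \<phi> \<circ> \<sigma> a))"
    and M: "M > 0" and e: "e > 0"
  shows "\<exists>\<rho>. 0 < \<rho> \<and> \<rho> < 1 \<and> (\<forall>h a. h holomorphic_on \<bbbD> \<longrightarrow> (\<forall>b\<in>\<bbbD>. garsia h b \<le> ennreal M) \<longrightarrow>
    (\<forall>z. norm z \<le> \<rho> \<longrightarrow> norm (h z) \<le> e) \<longrightarrow> a \<in> \<bbbD> \<longrightarrow> garsia (\<lambda>z. h (\<phi> z)) a \<le> ennreal (2 * e))"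
proof -
  \<comment> \<open>The composition bound has constant 6 and is normalized to Garsia bound 1, so k
    is chosen with 6 k M = e.\<close>
  define k where "k = e / (6 * M)"
  have k: "k > 0" using M e by (simp add: k_def)
  obtain \<eta> where \<eta>: "\<eta> < 1" "\<And>a. a \<in> \<bbbD> \<Longrightarrow> norm (\<phi> a) > \<eta> \<Longrightarrow> h2_norm (\<sigma> (\<phi> a) \<circ> \<phi> \<circ> \<sigma> a) < ennreal k"
    using van k unfolding vanishes_at_image_boundary_def by blast
  define \<rho> where "\<rho> = max (1/2) ((\<eta> + 1) / 2)"
  have \<rho>: "0 < \<rho>" "\<rho> < 1" "\<eta> < \<rho>" using \<eta>(1) by (auto simp: \<rho>_def less_max_iff_disj)
  have c\<phi>: "continuous_on \<bbbD> \<phi>" by (rule holomorphic_on_imp_continuous_on[OF \<phi>(1)])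
  show ?thesis
  proof (intro exI[of _ \<rho>] conjI allI impI \<rho>(1,2))
    fix h a assume h1: "h holomorphic_on \<bbbD>" "\<forall>b\<in>\<bbbD>. garsia h b \<le> ennreal M"
      "\<forall>z. norm z \<le> \<rho> \<longrightarrow> norm (h z) \<le> e" and a: "a \<in> \<bbbD>"
    note h = h1(1) bspec[OF h1(2)] h1(3)[rule_format]
    define \<Omega> where "\<Omega> = \<bbbD> \<inter> \<phi> -` ball 0 \<rho>"
    have "garsia (\<lambda>z. h (\<phi> z)) a \<le> ennreal (e + e)"
    proof (rule garsia_maximum_principle[where \<Omega> = \<Omega>])
      show "(\<lambda>z. h (\<phi> z)) holomorphic_on \<bbbD>" by (rule holomorphic_on_disc_compose[OF h(1) \<phi>])
      show "open \<Omega>" unfolding \<Omega>_def by (rule continuous_open_preimage[OF c\<phi>]) auto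
    next
      fix z assume z: "z \<in> \<bbbD>" "z \<in> closure \<Omega>"
      then obtain x where x: "\<And>n. x n \<in> \<Omega>" "x \<longlonglongrightarrow> z" by (auto simp: closure_sequential)
      have "(\<lambda>n. \<phi> (x n)) \<longlonglongrightarrow> \<phi> z"
        using c\<phi> x z by (auto simp: \<Omega>_def continuous_on_sequentially o_def)
      then have "norm (\<phi> z) \<le> \<rho>"
        by (intro LIMSEQ_le_const2[OF tendsto_norm]) (use x in \<open>auto simp: \<Omega>_def less_imp_le\<close>)
      then show "norm (h (\<phi> z)) \<le> e" by (rule h(3))
    next
      fix z assume z: "z \<in> \<bbbD>" "z \<notin> \<Omega>"
      then have "h2_norm (\<sigma> (\<phi> z) \<circ> \<phi> \<circ> \<sigma> z) \<le> ennreal k"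
        using \<eta>(2)[of z] \<rho> by (auto simp: \<Omega>_def less_imp_le)
      moreover have "garsia (\<lambda>z. of_real (1/M) * h z) b \<le> ennreal 1" if "b \<in> \<bbbD>" for b
        using garsia_cmult_le[OF h(2)[OF that], of "of_real (1/M)"] M by (simp add: norm_divide)
      ultimately have "garsia (\<lambda>z. of_real (1/M) * h (\<phi> z)) z \<le> ennreal (6 * k)"
        using bmo_composition_bound[of "\<lambda>z. of_real (1/M) * h z" \<phi> z k] \<phi> z(1) h(1) k
        by (auto simp: holomorphic_intros)
      from garsia_cmult_le[OF this, of "of_real M"] show "garsia (\<lambda>z. h (\<phi> z)) z \<le> ennreal e"
        using M e by (simp add: k_def)
    qed (use e a in auto)
    then show "garsia (\<lambda>z. h (\<phi> z)) a \<le> ennreal (2 * e)" by simp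
  qed
qed

text \<open>Garsia values are lower semicontinuous under locally uniform convergence, since each
  mean sees only a compact set. The factor 2 counts M once for \<open>g 0\<close> and once for the
  seminorm.\<close>

lemma bmoa_montel:
  assumes f: "\<And>n::nat. f n \<in> bmoa" "\<And>n. bmoa_norm (f n) \<le> M"
  obtains g s where "g \<in> bmoa" "bmoa_norm g \<le> 2 * M" "strict_mono (s :: nat \<Rightarrow> nat)"
    "\<forall>\<rho><1. uniform_limit (cball 0 \<rho>) (\<lambda>n. f (s n)) g sequentially"
proof -
  have M: "M \<ge> 0" using f(2)[of 0] bmoa_norm_nonneg order_trans by blast
  have bd: "\<exists>B. \<forall>h\<in>range f. \<forall>z\<in>K. norm (h z) \<le> B" if K: "compact K" "K \<subseteq> \<bbbD>" for K
  proof (cases "K = {}")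
    case False
    obtain z0 where z0: "z0 \<in> K" "\<And>z. z \<in> K \<Longrightarrow> norm z \<le> norm z0"
      using continuous_attains_sup[OF K(1) False continuous_on_norm_id] by auto
    have z1: "norm z0 < 1" using z0 K by auto
    have "norm (h z) \<le> (1 + 1 / (1 - (norm z0)\<^sup>2)) * M" if "h \<in> range f" "z \<in> K" for h z
    proof -
      obtain n where h: "h = f n" using \<open>h \<in> range f\<close> by auto
      have "norm (h z) \<le> (1 + 1 / (1 - (norm z0)\<^sup>2)) * bmoa_norm (f n)"
        unfolding h by (rule bmoa_pointwise_bound[OF f(1) z1 z0(2)[OF that(2)]])
      also have "\<dots> \<le> (1 + 1 / (1 - (norm z0)\<^sup>2)) * M"
        using z1 f(2) by (intro mult_left_mono) (auto simp: abs_square_le_1 add_nonneg_nonneg)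
      finally show ?thesis .
    qed
    then show ?thesis by blast
  qed auto
  obtain g0 s where g0: "g0 holomorphic_on \<bbbD>" "strict_mono (s :: nat \<Rightarrow> nat)"
     "\<And>x. x \<in> \<bbbD> \<Longrightarrow> (\<lambda>n. f (s n) x) \<longlonglongrightarrow> g0 x"
     "\<And>K. compact K \<Longrightarrow> K \<subseteq> \<bbbD> \<Longrightarrow> uniform_limit K (f \<circ> s) g0 sequentially"
    by (rule Montel[of \<bbbD> "range f" f, OF open_ball _ bd order_refl]) (use f(1) bmoa_holomorphic in auto)
  \<comment> \<open>Montel's limit is arbitrary off the disc, where elements of \<open>bmoa\<close>
    have to vanish.\<close>
  define g where "g z = (if z \<in> \<bbbD> then g0 z else 0)" for z
  have ghol: "g holomorphic_on \<bbbD>"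
    by (rule holomorphic_transform[OF g0(1)]) (auto simp: g_def)
  have ul: "uniform_limit K (\<lambda>n. f (s n)) g sequentially" if "compact K" "K \<subseteq> \<bbbD>" for K
  proof -
    have "g x = g0 x" if "x \<in> K" for x using that \<open>K \<subseteq> \<bbbD>\<close> by (auto simp: g_def)
    then show ?thesis using g0(4)[OF that] by (simp add: uniform_limit_iff)
  qed
  have gars: "garsia g a \<le> ennreal M" if a: "a \<in> \<bbbD>" for a
    unfolding garsia_def
  proof (subst h2_norm_le_iff[OF M], intro ballI)
    fix r :: real assume r: "r \<in> {0<..<1}"
    show "circle_mean2 (\<lambda>z. g (\<sigma> a z) - g a) r \<le> M"
    proof (rule field_le_epsilon)
      fix e :: real assume e: "e > 0"
      have K: "compact (insert a (\<sigma> a ` sphere 0 r))" "insert a (\<sigma> a ` sphere 0 r) \<subseteq> \<bbbD>"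
        using a r disc_aut_in_disc(2)[OF a]
        by (auto intro!: compact_insert compact_continuous_image holomorphic_continuous_on_sphere[OF disc_aut_holomorphic])
      obtain n where n: "\<And>u. u \<in> insert a (\<sigma> a ` sphere 0 r) \<Longrightarrow> dist (f (s n) u) (g u) < e/2"
        using ul[OF K] e unfolding uniform_limit_iff eventually_sequentially by (meson half_gt_zero order_refl)
      have "circle_mean2 (\<lambda>z. g (\<sigma> a z) - g a) r \<le> circle_mean2 (\<lambda>z. f (s n) (\<sigma> a z) - f (s n) a) r + e"
      proof (rule circle_mean2_approx)
        fix z :: complex assume z: "norm z = r"
        have "dist (f (s n) (\<sigma> a z)) (g (\<sigma> a z)) < e/2" "dist (f (s n) a) (g a) < e/2"
          using z n[of "\<sigma> a z"] n[of a] by auto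
        then show "norm (g (\<sigma> a z) - g a - (f (s n) (\<sigma> a z) - f (s n) a)) \<le> e"
          using norm_triangle_ineq4[of "g (\<sigma> a z) - f (s n) (\<sigma> a z)" "g a - f (s n) a"]
          by (simp add: algebra_simps dist_norm norm_minus_commute)
      qed (use a r ghol bmoa_holomorphic[OF f(1)] in \<open>auto intro!: holomorphic_intros holomorphic_disc_aut_compose\<close>)
      also have "circle_mean2 (\<lambda>z. f (s n) (\<sigma> a z) - f (s n) a) r \<le> M"
      proof (rule circle_mean2_le_h2_norm)
        have "garsia (f (s n)) a \<le> ennreal (bmoa_norm (f (s n)))" by (rule bmoa_garsia_le[OF f(1) a])
        also have "\<dots> \<le> ennreal M" by (intro ennreal_leI f)
        finally show "h2_norm (\<lambda>z. f (s n) (\<sigma> a z) - f (s n) a) \<le> ennreal M" by (simp add: garsia_def)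
      qed (use r M in auto)
      finally show "circle_mean2 (\<lambda>z. g (\<sigma> a z) - g a) r \<le> M + e" by simp
    qed
  qed
  have g: "g \<in> bmoa" "bmoa_norm g \<le> norm (g 0) + M"
    by (rule bmoaI[OF ghol _ gars M]; simp add: g_def)+
  have "norm (g 0) \<le> M"
  proof (rule LIMSEQ_le_const2)
    show "(\<lambda>n. norm (f (s n) 0)) \<longlonglongrightarrow> norm (g 0)" using g0(3)[of 0] by (auto simp: g_def intro: tendsto_norm)
    have "norm (f (s n) 0) \<le> M" for n
      using f(2)[of "s n"] enn2real_nonneg[of "bmoa_seminorm (f (s n))"] unfolding bmoa_norm_def by linarith
    then show "\<exists>N. \<forall>n\<ge>N. norm (f (s n) 0) \<le> M" by blast
  qed
  with g have "bmoa_norm g \<le> 2 * M" by simp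
  moreover have "\<forall>\<rho><1. uniform_limit (cball 0 \<rho>) (\<lambda>n. f (s n)) g sequentially"
    by (intro allI impI ul) auto
  ultimately show ?thesis by (intro that[OF g(1) _ g0(2)])
qed

lemma composition_subsequence_limit:
  assumes \<phi>: "\<phi> holomorphic_on \<bbbD>" "\<phi> ` \<bbbD> \<subseteq> \<bbbD>"
    and van: "vanishes_at_image_boundary \<phi> (\<lambda>a. h2_norm (\<sigma> (\<phi> a) \<circ> \<phi> \<circ> \<sigma> a))"
    and f: "\<And>n::nat. f n \<in> bmoa" "\<And>n. bmoa_norm (f n) \<le> M"
  obtains g s where "g \<in> bmoa" "strict_mono (s :: nat \<Rightarrow> nat)"
    "(\<lambda>n. bmoa_dist (comp_op \<phi> (f (s n))) (comp_op \<phi> g)) \<longlonglongrightarrow> 0"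
proof -
  obtain g s where g: "g \<in> bmoa" "bmoa_norm g \<le> 2 * M" "strict_mono (s :: nat \<Rightarrow> nat)"
    and ul: "\<forall>\<rho><1. uniform_limit (cball 0 \<rho>) (\<lambda>n. f (s n)) g sequentially"
    by (rule bmoa_montel[OF f])
  have M: "M \<ge> 0" using f(2)[of 0] bmoa_norm_nonneg order_trans by blast
  \<comment> \<open>M + 2 M bounds the differences f - g; the added 1 keeps the bound
    positive.\<close>
  define N where "N = 3 * M + 1"
  have N: "N > 0" using M by (simp add: N_def)
  define h where "h n z = f (s n) z - g z" for n z
  have hb: "h n \<in> bmoa" for n unfolding h_def by (rule bmoa_diff[OF f(1) g(1)])
  have hN: "bmoa_norm (h n) \<le> N" for n
  proof -
    have "bmoa_norm (\<lambda>z. f (s n) z + - g z) \<le> bmoa_norm (f (s n)) + bmoa_norm (\<lambda>z. - g z)"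
      by (intro bmoa_norm_triangle f bmoa_uminus g)
    then show ?thesis using f(2)[of "s n"] g(2) by (simp add: h_def[abs_def] bmoa_uminus(2) N_def)
  qed
  have hg: "garsia (h n) b \<le> ennreal N" if "b \<in> \<bbbD>" for n b
    using bmoa_garsia_le[OF hb that] ennreal_leI[OF hN] order_trans by blast
  have "(\<lambda>n. bmoa_dist (comp_op \<phi> (f (s n))) (comp_op \<phi> g)) \<longlonglongrightarrow> 0"
  proof (rule LIMSEQ_I)
    fix e :: real assume e: "e > 0"
    \<comment> \<open>One k for the value at 0 and 2 k for the seminorm stay below e.\<close>
    define k where "k = e / 4"
    have k: "k > 0" using e by (simp add: k_def)
    obtain \<rho> where \<rho>: "0 < \<rho>" "\<rho> < 1"
      "\<forall>h a. h holomorphic_on \<bbbD> \<longrightarrow> (\<forall>b\<in>\<bbbD>. garsia h b \<le> ennreal N) \<longrightarrow>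
        (\<forall>z. norm z \<le> \<rho> \<longrightarrow> norm (h z) \<le> k) \<longrightarrow> a \<in> \<bbbD> \<longrightarrow> garsia (\<lambda>z. h (\<phi> z)) a \<le> ennreal (2 * k)"
      using composition_small[OF \<phi> van N k] by (elim exE conjE)
    \<comment> \<open>The disc also has to contain \<phi> 0, for the value at 0 that enters the norm
      of the composition.\<close>
    define R where "R = max \<rho> (norm (\<phi> 0))"
    have R: "R < 1" using \<rho> \<phi>(2) by (auto simp: R_def image_subset_iff)
    obtain n0 where n0': "\<forall>n\<ge>n0. \<forall>z\<in>cball 0 R. norm (h n z) < k"
      
  proof -
    have "\<forall>\<^sub>F n in sequentially. \<forall>z\<in>cball 0 R. dist (f (s n) z) (g z) < k"
      using ul R k unfolding uniform_limit_iff by blast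
    then show ?thesis using that by (auto simp: eventually_sequentially h_def dist_norm)
  qed
    then have n0: "norm (h n z) < k" if "n \<ge> n0" "norm z \<le> R" for n z using that by simp
    have "norm (bmoa_dist (comp_op \<phi> (f (s n))) (comp_op \<phi> g) - 0) < e" if n: "n \<ge> n0" for n
    proof -
      have eq: "(\<lambda>z. comp_op \<phi> (f (s n)) z - comp_op \<phi> g z) = comp_op \<phi> (h n)"
        by (auto simp: comp_op_def h_def)
      have "bmoa_norm (comp_op \<phi> (h n)) \<le> norm (comp_op \<phi> (h n) 0) + 2 * k"
      proof (rule bmoaI(2))
        show "comp_op \<phi> (h n) holomorphic_on \<bbbD>" by (intro comp_op_holomorphic bmoa_holomorphic hb \<phi>)
        fix a assume a: "a \<in> \<bbbD>"
        show "garsia (comp_op \<phi> (h n)) a \<le> ennreal (2 * k)"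
          unfolding comp_op_garsia[OF a]
        proof (rule \<rho>(3)[rule_format, OF bmoa_holomorphic[OF hb] hg _ a])
          fix z :: complex assume "norm z \<le> \<rho>"
          then have "norm z \<le> R" by (simp add: R_def le_max_iff_disj)
          then show "norm (h n z) \<le> k" using n0[OF n] less_imp_le by blast
        qed
      qed (use k in \<open>auto simp: comp_op_def\<close>)
      also have "norm (comp_op \<phi> (h n) 0) < k"
        using n0[OF n, of "\<phi> 0"] by (simp add: comp_op_def R_def)
      finally show ?thesis using k by (simp add: bmoa_dist_def eq k_def)
    qed
    then show "\<exists>no. \<forall>n\<ge>no. norm (bmoa_dist (comp_op \<phi> (f (s n))) (comp_op \<phi> g) - 0) < e" by blast
  qed
  with g(1,3) show ?thesis by (rule that)
qed

theorem vanishing_imp_compact: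
  assumes \<phi>: "\<phi> holomorphic_on \<bbbD>" "\<phi> ` \<bbbD> \<subseteq> \<bbbD>"
    and van: "vanishes_at_image_boundary \<phi> (\<lambda>a. h2_norm (\<sigma> (\<phi> a) \<circ> \<phi> \<circ> \<sigma> a))"
  shows "bmoa_compact (comp_op \<phi>)"
  unfolding bmoa_compact_def
proof (intro conjI allI impI)
  show T: "comp_op \<phi> \<in> bmoa \<rightarrow> bmoa" using comp_op_bmoa[OF _ \<phi>] by blast
  fix B assume B: "bmoa_bounded B"
  then obtain M where BM: "B \<subseteq> bmoa" "\<And>f. f \<in> B \<Longrightarrow> bmoa_norm f \<le> M" by (auto simp: bmoa_bounded_def)
  define C where "C = bmoa.mtopology closure_of (comp_op \<phi> ` B)"
  have Cm: "C \<subseteq> bmoa" unfolding C_def using closure_of_subset_topspace[of bmoa.mtopology] by simp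
  have "compactin bmoa.mtopology C"
    unfolding bmoa.compactin_sequentially
  proof (intro conjI allI impI Cm)
    fix x :: "nat \<Rightarrow> complex \<Rightarrow> complex" assume x: "range x \<subseteq> C"
    \<comment> \<open>Points of the closure are replaced by images of elements of \<open>B\<close>
      at distance below 1/(n+1), which leaves limits of subsequences unchanged.\<close>
    have "\<exists>b\<in>B. bmoa_dist (x n) (comp_op \<phi> b) < inverse (real (Suc n))" for n
    proof -
      have "x n \<in> C" using x by auto
      moreover have "inverse (real (Suc n)) > 0" by simp
      ultimately have "\<exists>y\<in>comp_op \<phi> ` B. y \<in> bmoa.mball (x n) (inverse (real (Suc n)))"
        unfolding C_def bmoa.metric_closure_of by blast
      then show ?thesis by auto
    qed
    then obtain b where b: "\<And>n. b n \<in> B" "\<And>n. bmoa_dist (x n) (comp_op \<phi> (b n)) < inverse (real (Suc n))" by metis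
    obtain g s where g: "g \<in> bmoa" "strict_mono (s :: nat \<Rightarrow> nat)"
      "(\<lambda>n. bmoa_dist (comp_op \<phi> (b (s n))) (comp_op \<phi> g)) \<longlonglongrightarrow> 0"
      by (rule composition_subsequence_limit[OF \<phi> van, of b M]) (use b BM in auto)
    have Tg: "comp_op \<phi> g \<in> bmoa" using T g(1) by blast
    have lim: "limitin bmoa.mtopology (x \<circ> s) (comp_op \<phi> g) sequentially"
      unfolding bmoa.limitin_metric_dist_null
    proof (intro conjI Tg always_eventually allI)
      show "(x \<circ> s) n \<in> bmoa" for n using x Cm by auto
      show "(\<lambda>n. bmoa_dist ((x \<circ> s) n) (comp_op \<phi> g)) \<longlonglongrightarrow> 0"
      proof (rule tendsto_sandwich[OF _ _ tendsto_const])
        have "(\<lambda>n. inverse (real (Suc (s n)))) \<longlonglongrightarrow> 0"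
          using LIMSEQ_subseq_LIMSEQ[OF LIMSEQ_inverse_real_of_nat g(2)] by (simp add: o_def)
        from tendsto_add[OF this g(3)]
        show "(\<lambda>n. inverse (real (Suc (s n))) + bmoa_dist (comp_op \<phi> (b (s n))) (comp_op \<phi> g)) \<longlonglongrightarrow> 0" by simp
        have "bmoa_dist ((x \<circ> s) n) (comp_op \<phi> g) \<le> inverse (real (Suc (s n))) + bmoa_dist (comp_op \<phi> (b (s n))) (comp_op \<phi> g)" for n
        proof -
          have "x (s n) \<in> bmoa" "comp_op \<phi> (b (s n)) \<in> bmoa" using x Cm b BM(1) T by (auto simp: Pi_iff subset_iff)
          from bmoa.triangle[OF this Tg] b(2)[of "s n"] show ?thesis by simp
        qed
        then show "\<forall>\<^sub>F n in sequentially. bmoa_dist ((x \<circ> s) n) (comp_op \<phi> g) \<le> inverse (real (Suc (s n))) + bmoa_dist (comp_op \<phi> (b (s n))) (comp_op \<phi> g)"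
          by simp
      qed simp
    qed
    have "closedin bmoa.mtopology C" unfolding C_def by simp
    moreover have "range (x \<circ> s) \<subseteq> C" using x by auto
    ultimately have "comp_op \<phi> g \<in> C"
      using lim unfolding bmoa.metric_closedin_iff_sequentially_closed by blast
    with g(2) lim show "\<exists>l r. l \<in> C \<and> strict_mono r \<and> limitin bmoa.mtopology (x \<circ> r) l sequentially" by blast
  qed
  then show "compactin bmoa_norm_topology (bmoa_norm_topology closure_of (comp_op \<phi> ` B))"
    by (simp add: C_def bmoa_norm_topology_def)
qed

subsection \<open>The weak topology\<close>

lemma bmoa_dualD:
  assumes "L \<in> bmoa_dual"
  shows "f \<in> bmoa \<Longrightarrow> g \<in> bmoa \<Longrightarrow> L (\<lambda>z. f z + g z) = L f + L g"
    "f \<in> bmoa \<Longrightarrow> L (\<lambda>z. c * f z) = c * L f"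
    "\<exists>K\<ge>0. \<forall>f\<in>bmoa. norm (L f) \<le> K * bmoa_norm f"
proof -
  obtain K where K: "\<forall>f\<in>bmoa. norm (L f) \<le> K * bmoa_norm f"
    using assms unfolding bmoa_dual_def by blast
  have "norm (L f) \<le> max K 0 * bmoa_norm f" if "f \<in> bmoa" for f
    using bspec[OF K that] mult_right_mono[of K "max K 0" "bmoa_norm f"] by simp
  then show "\<exists>K\<ge>0. \<forall>f\<in>bmoa. norm (L f) \<le> K * bmoa_norm f" by (intro exI[of _ "max K 0"]) auto
qed (use assms in \<open>auto simp: bmoa_dual_def\<close>)

lemma bmoa_dual_diff:
  assumes "L \<in> bmoa_dual" "f \<in> bmoa" "g \<in> bmoa"
  shows "L (\<lambda>z. f z - g z) = L f - L g"
proof -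
  have "L (\<lambda>z. f z + (-1) * g z) = L f + L (\<lambda>z. (-1) * g z)"
    by (rule bmoa_dualD(1)[OF assms(1,2)]) (use bmoa_uminus(1)[OF assms(3)] in simp)
  also have "L (\<lambda>z. (-1) * g z) = (-1) * L g" by (rule bmoa_dualD(2)[OF assms(1,3)])
  finally show ?thesis by simp
qed

lemma openin_weak: "L \<in> bmoa_dual \<Longrightarrow> open U \<Longrightarrow> openin bmoa_weak_topology {f \<in> bmoa. L f \<in> U}"
  unfolding bmoa_weak_topology_def by (rule topology_generated_by_Basis) blast

lemma zero_in_bmoa_dual: "(\<lambda>_. 0) \<in> bmoa_dual"
  unfolding bmoa_dual_def by (auto intro: exI[of _ 0])

lemma topspace_weak [simp]: "topspace bmoa_weak_topology = bmoa"
proof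
  show "topspace bmoa_weak_topology \<subseteq> bmoa" by (auto simp: bmoa_weak_topology_def)
  show "bmoa \<subseteq> topspace bmoa_weak_topology"
    using openin_subset[OF openin_weak[OF zero_in_bmoa_dual open_UNIV]] by auto
qed

lemma continuous_map_norm_weak: "continuous_map bmoa.mtopology bmoa_weak_topology (\<lambda>f. f)"
  unfolding bmoa_weak_topology_def
proof (rule continuous_on_generated_topo)
  fix V assume "V \<in> {{f \<in> bmoa. L f \<in> U} |L U. L \<in> bmoa_dual \<and> open U}"
  then obtain L U where LU: "V = {f \<in> bmoa. L f \<in> U}" "L \<in> bmoa_dual" "open U" by (elim CollectE exE conjE)
  obtain K where K: "K \<ge> 0" "\<And>f. f \<in> bmoa \<Longrightarrow> norm (L f) \<le> K * bmoa_norm f"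
    using bmoa_dualD(3)[OF LU(2)] by blast
  have "openin bmoa.mtopology V"
    unfolding bmoa.openin_mtopology
  proof (intro conjI allI impI)
    show "V \<subseteq> bmoa" using LU by auto
    fix f assume f: "f \<in> V"
    then obtain e where e: "e > 0" "ball (L f) e \<subseteq> U" using LU open_contains_ball by blast
    \<comment> \<open>K + 1 in place of K allows K = 0.\<close>
    have "bmoa.mball f (e / (K + 1)) \<subseteq> V"
    proof
      fix g assume "g \<in> bmoa.mball f (e / (K + 1))"
      then have g: "g \<in> bmoa" "f \<in> bmoa" "bmoa_norm (\<lambda>z. f z - g z) < e / (K + 1)"
        by (auto simp: bmoa_dist_def)
      have "norm (L f - L g) \<le> K * bmoa_norm (\<lambda>z. f z - g z)"
        using K(2)[OF bmoa_diff[OF g(2,1)]] unfolding bmoa_dual_diff[OF LU(2) g(2,1)] .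
      also have "\<dots> \<le> (K + 1) * bmoa_norm (\<lambda>z. f z - g z)" by (intro mult_right_mono) auto
      also have "\<dots> < e" using g(3) K(1) by (simp add: field_simps)
      finally show "g \<in> V" using e LU g by (auto simp: dist_norm)
    qed
    then show "\<exists>r>0. bmoa.mball f r \<subseteq> V" using e K(1) by (intro exI[of _ "e / (K + 1)"]) auto
  qed
  then show "openin bmoa.mtopology ((\<lambda>f. f) -` V \<inter> topspace bmoa.mtopology)"
    using LU by (simp add: Int_absorb2 subset_iff)
next
  show "(\<lambda>f. f) ` topspace bmoa.mtopology \<subseteq> \<Union> {{f \<in> bmoa. L f \<in> U} |L U. L \<in> bmoa_dual \<and> open U}"
    using topspace_weak unfolding bmoa_weak_topology_def topology_generated_by_topspace by (simp only: bmoa.topspace_mtopology image_ident order_refl)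
qed

lemma evaluation_in_bmoa_dual:
  assumes "z \<in> \<bbbD>"
  shows "(\<lambda>f. f z) \<in> bmoa_dual"
proof -
  have "\<forall>f\<in>bmoa. norm (f z) \<le> (1 + 1 / (1 - (norm z)\<^sup>2)) * bmoa_norm f"
    using bmoa_pointwise_bound[of _ "norm z" z] assms by (intro ballI) simp
  then show ?thesis unfolding bmoa_dual_def by (intro CollectI conjI exI) simp_all
qed

text \<open>Point evaluations belong to the dual, and they separate because elements of
  \<open>bmoa\<close> vanish off the disc.\<close>

lemma Hausdorff_weak: "Hausdorff_space bmoa_weak_topology"
  unfolding Hausdorff_space_def
proof (intro allI impI; elim conjE)
  fix f g assume fg: "f \<in> topspace bmoa_weak_topology" "g \<in> topspace bmoa_weak_topology" "f \<noteq> g"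
  then obtain z where "f z \<noteq> g z" by (auto simp: fun_eq_iff)
  moreover have "f z = g z" if "z \<notin> \<bbbD>" using fg(1,2) that by (simp add: bmoa_def)
  ultimately have "\<exists>z\<in>\<bbbD>. f z \<noteq> g z" by blast
  then obtain z where z: "z \<in> \<bbbD>" "f z \<noteq> g z" by blast
  obtain U V where UV: "open U" "open V" "f z \<in> U" "g z \<in> V" "U \<inter> V = {}"
    using separation_t2[of "f z" "g z"] z by auto
  show "\<exists>U V. openin bmoa_weak_topology U \<and> openin bmoa_weak_topology V \<and> f \<in> U \<and> g \<in> V \<and> disjnt U V"
    by (rule exI[of _ "{f \<in> bmoa. f z \<in> U}"], rule exI[of _ "{f \<in> bmoa. f z \<in> V}"])
       (use UV fg openin_weak[OF evaluation_in_bmoa_dual[OF z(1)]] in \<open>auto simp: disjnt_iff\<close>)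
qed

text \<open>A norm compact set stays compact in the coarser weak topology, is therefore weakly
  closed, and so contains the weak closure of the image.\<close>

theorem compact_imp_weakly_compact:
  assumes "bmoa_compact T"
  shows "bmoa_weakly_compact T"
  unfolding bmoa_weakly_compact_def
proof (intro conjI allI impI)
  show T: "T \<in> bmoa \<rightarrow> bmoa" using assms by (simp add: bmoa_compact_def)
  fix B assume B: "bmoa_bounded B"
  define C where "C = bmoa.mtopology closure_of (T ` B)"
  have "compactin bmoa.mtopology C" using assms B by (simp add: bmoa_compact_def C_def bmoa_norm_topology_def)
  from image_compactin[OF this continuous_map_norm_weak] have C: "compactin bmoa_weak_topology C" by simp
  have "T ` B \<subseteq> C" unfolding C_def
    by (rule closure_of_subset) (use T B in \<open>auto simp: bmoa_bounded_def\<close>)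
  then have "bmoa_weak_topology closure_of (T ` B) \<subseteq> C"
    by (rule closure_of_minimal[OF _ compactin_imp_closedin[OF Hausdorff_weak C]])
  then show "compactin bmoa_weak_topology (bmoa_weak_topology closure_of (T ` B))"
    by (rule closed_compactin[OF C]) simp
qed

subsection \<open>Weak compactness\<close>

text \<open>A compact space need not be sequentially compact, so a cluster point is produced in
  place of a subsequential limit. It is described by continuous maps and closed sets, the form in
  which bounds on functionals pass to it.\<close>

lemma compactin_sequence_cluster:
  assumes S: "compactin X S" and x: "\<And>n::nat. x n \<in> S"
  shows "\<exists>l\<in>S. \<forall>G C m. continuous_map X euclidean G \<longrightarrow> closed C \<longrightarrow> (\<forall>n\<ge>m. G (x n) \<in> C) \<longrightarrow> G l \<in> C"
proof -
  have "\<exists>l\<in>S. \<forall>U. openin X U \<longrightarrow> l \<in> U \<longrightarrow> infinite {n. x n \<in> U}"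
  proof (rule ccontr)
    assume neg: "\<not> ?thesis"
    define \<U> where "\<U> = {U. openin X U \<and> finite {n. x n \<in> U}}"
    have "S \<subseteq> \<Union>\<U>" using neg by (auto simp: \<U>_def)
    moreover have "openin X U" if "U \<in> \<U>" for U using that by (simp add: \<U>_def)
    ultimately obtain \<F> where \<F>: "finite \<F>" "\<F> \<subseteq> \<U>" "S \<subseteq> \<Union>\<F>"
      using S unfolding compactin_def by metis
    have "UNIV \<subseteq> (\<Union>U\<in>\<F>. {n. x n \<in> U})" using x \<F>(3) by blast
    moreover have "finite (\<Union>U\<in>\<F>. {n. x n \<in> U})" using \<F>(1,2) by (auto simp: \<U>_def)
    ultimately show False using finite_subset infinite_UNIV_nat by blast
  qed
  then obtain l where l: "l \<in> S" "\<And>U. openin X U \<Longrightarrow> l \<in> U \<Longrightarrow> infinite {n. x n \<in> U}" by blast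
  have lX: "l \<in> topspace X" using l(1) S compactin_subset_topspace by blast
  show ?thesis
  proof (intro bexI[OF _ l(1)] allI impI, rule ccontr)
    fix G C m assume G: "continuous_map X euclidean G" and C: "closed C"
      and m: "\<forall>n\<ge>m. G (x n) \<in> C" and neg: "G l \<notin> C"
    have "openin X {y \<in> topspace X. G y \<in> - C}"
      by (rule openin_continuous_map_preimage[OF G]) (use C in auto)
    then have "infinite {n. x n \<in> {y \<in> topspace X. G y \<in> - C}}"
      by (rule l(2)) (use lX neg in auto)
    moreover have "{n. x n \<in> {y \<in> topspace X. G y \<in> - C}} \<subseteq> {..<m}"
      using m not_le by auto
    ultimately show False using finite_subset by blast
  qed
qed

lemma continuous_map_weak_dual:
  assumes "L \<in> bmoa_dual"
  shows "continuous_map bmoa_weak_topology euclidean L"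
  unfolding continuous_map_def using openin_weak[OF assms] by simp

lemma bmoa_zero: "(\<lambda>_. 0) \<in> bmoa"
  by (rule bmoaI(1)[of _ 0]) (auto simp: garsia_def h2_norm_def circle_mean2_def bot_ennreal)

lemma bmoa_sum: "(\<And>k. k < N \<Longrightarrow> g k \<in> bmoa) \<Longrightarrow> (\<lambda>z. \<Sum>k<N. g k z) \<in> bmoa" for N :: nat
  by (induction N) (auto simp: bmoa_zero intro!: bmoa_norm_triangle(1))

lemma bmoa_dual_sum:
  fixes N :: nat
  assumes L: "L \<in> bmoa_dual" and g: "\<And>k. k < N \<Longrightarrow> g k \<in> bmoa"
  shows "L (\<lambda>z. \<Sum>k<N. g k z) = (\<Sum>k<N. L (g k))"
  using g
proof (induction N)
  case 0
  show ?case using bmoa_dualD(2)[OF L bmoa_zero, of 0] by simp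
next
  case (Suc N)
  have "L (\<lambda>z. (\<Sum>k<N. g k z) + g N z) = L (\<lambda>z. \<Sum>k<N. g k z) + L (g N)"
    by (rule bmoa_dualD(1)[OF L]) (use Suc.prems in \<open>auto intro!: bmoa_sum\<close>)
  then show ?case using Suc by simp
qed

lemma garsia_sum_le:
  fixes N :: nat
  assumes "\<And>k. k < N \<Longrightarrow> g k holomorphic_on \<bbbD>" "a \<in> \<bbbD>"
    "\<And>k. k < N \<Longrightarrow> garsia (g k) a \<le> ennreal (c k)" "\<And>k. k < N \<Longrightarrow> c k \<ge> 0"
  shows "garsia (\<lambda>z. \<Sum>k<N. g k z) a \<le> ennreal (\<Sum>k<N. c k)"
  using assms(1,3,4)
proof (induction N)
  case 0
  show ?case by (simp add: garsia_def h2_norm_def circle_mean2_def bot_ennreal)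
next
  case (Suc N)
  have "garsia (\<lambda>z. (\<Sum>k<N. g k z) + g N z) a \<le> garsia (\<lambda>z. \<Sum>k<N. g k z) a + garsia (g N) a"
    by (rule garsia_add_le) (use Suc.prems assms(2) in \<open>auto intro!: holomorphic_intros\<close>)
  also have "\<dots> \<le> ennreal (\<Sum>k<N. c k) + ennreal (c N)"
    by (intro add_mono Suc) (use Suc.prems in auto)
  also have "\<dots> = ennreal (\<Sum>k<Suc N. c k)"
  proof -
    have "(\<Sum>k<N. c k) \<ge> 0" by (intro sum_nonneg Suc.prems(3)) auto
    then show ?thesis using Suc.prems(3)[of N] by simp
  qed
  finally show ?case by simp
qed

text \<open>Pythagoras again: the mean of |g o \<sigma>_a|^2 is at most 1, and its constant part is
  |g a|^2.\<close>

lemma garsia_self_map: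
  assumes g: "g holomorphic_on \<bbbD>" "g ` \<bbbD> \<subseteq> \<bbbD>" and a: "a \<in> \<bbbD>"
  shows "garsia g a \<le> ennreal (sqrt (1 - (norm (g a))\<^sup>2))"
proof -
  have ga: "norm (g a) < 1" using g a by (auto simp: image_subset_iff)
  have hol: "(\<lambda>z. g (\<sigma> a z)) holomorphic_on \<bbbD>" by (rule holomorphic_disc_aut_compose[OF g(1) a])
  have "circle_mean2 (\<lambda>z. g (\<sigma> a z) - g a) r \<le> sqrt (1 - (norm (g a))\<^sup>2)" if r: "0 < r" "r < 1" for r
  proof -
    have "circ_mean r (\<lambda>z. (norm (g (\<sigma> a z) - g a))\<^sup>2)
        = circ_mean r (\<lambda>z. (norm (g (\<sigma> a z)))\<^sup>2) - (norm (g a))\<^sup>2"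
      using circ_mean_norm_diff_sq[OF hol, of r] r by simp
    also have "circ_mean r (\<lambda>z. (norm (g (\<sigma> a z)))\<^sup>2) \<le> circ_mean r (\<lambda>_. 1)"
    proof (rule circ_mean_mono)
      fix z :: complex assume "norm z = r"
      then have "g (\<sigma> a z) \<in> \<bbbD>" using g(2) disc_aut_in_disc(2)[OF a, of z] r by (auto simp: image_subset_iff)
      then show "(norm (g (\<sigma> a z)))\<^sup>2 \<le> 1" by (simp add: abs_square_le_1)
    qed (use r in \<open>auto intro!: continuous_intros holomorphic_continuous_on_sphere[OF hol]\<close>)
    finally show ?thesis by (simp add: circle_mean2_eq)
  qed
  moreover have "1 - (norm (g a))\<^sup>2 \<ge> 0" using ga by (simp add: abs_square_le_1)
  ultimately show ?thesis unfolding garsia_def by (subst h2_norm_le_iff) auto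
qed

text \<open>With u = 1 - |w| and v = 1 - |a|, the quantity 1 - |\<sigma>_w a|^2 is at most 4 u v /
  m^2, where m = |1 - cnj w * a| is at least u and v; so it is at most 4 times the smaller of u / v
  and v / u. The Garsia value is small when w and a have very different distances to the
  circle.\<close>

lemma garsia_disc_aut_decay:
  assumes w: "w \<in> \<bbbD>" and a: "a \<in> \<bbbD>" and c: "c \<ge> 0"
    and le: "1 - norm a \<le> c\<^sup>2 * (1 - norm w) \<or> 1 - norm w \<le> c\<^sup>2 * (1 - norm a)"
  shows "garsia (\<sigma> w) a \<le> ennreal (2 * c)"
proof -
  define u v where "u = 1 - norm w" and "v = 1 - norm a"
  have uv: "u > 0" "v > 0" "u \<le> 1" "v \<le> 1" using w a by (auto simp: u_def v_def)
  define m where "m = norm (1 - cnj w * a)"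
  have m1: "m \<ge> 1 - norm w * norm a"
    using norm_triangle_ineq2[of 1 "cnj w * a"] by (simp add: m_def norm_mult)
  have "norm w * norm a \<le> norm w" "norm w * norm a \<le> norm a"
    using w a by (auto intro: mult_left_le mult_left_le_one_le)
  then have m: "m \<ge> u" "m \<ge> v" using m1 by (auto simp: u_def v_def)
  have p: "(1 - (norm w)\<^sup>2) * (1 - (norm a)\<^sup>2) \<le> (2 * u) * (2 * v)"
  proof (rule mult_mono)
    have "1 - x\<^sup>2 \<le> 2 * (1 - x)" for x :: real using zero_le_power2[of "1 - x"] by (simp add: power2_eq_square algebra_simps)
    then show "1 - (norm w)\<^sup>2 \<le> 2 * u" "1 - (norm a)\<^sup>2 \<le> 2 * v" by (auto simp: u_def v_def)
  qed (use uv a in \<open>auto simp: abs_square_le_1\<close>)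
  have "(2 * u) * (2 * v) \<le> (2 * c)\<^sup>2 * m\<^sup>2"
    using le
  proof
    assume "1 - norm a \<le> c\<^sup>2 * (1 - norm w)"
    then have "v \<le> c\<^sup>2 * u" by (simp add: u_def v_def)
    then have "u * v \<le> u * (c\<^sup>2 * u)" using uv by (intro mult_left_mono) auto
    also have "\<dots> = c\<^sup>2 * u\<^sup>2" by (simp add: power2_eq_square)
    also have "\<dots> \<le> c\<^sup>2 * m\<^sup>2" using m uv by (intro mult_left_mono power_mono) auto
    finally show ?thesis by (simp add: power_mult_distrib)
  next
    assume "1 - norm w \<le> c\<^sup>2 * (1 - norm a)"
    then have "u \<le> c\<^sup>2 * v" by (simp add: u_def v_def)
    then have "u * v \<le> (c\<^sup>2 * v) * v" using uv by (intro mult_right_mono) auto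
    also have "\<dots> = c\<^sup>2 * v\<^sup>2" by (simp add: power2_eq_square)
    also have "\<dots> \<le> c\<^sup>2 * m\<^sup>2" using m uv by (intro mult_left_mono power_mono) auto
    finally show ?thesis by (simp add: power_mult_distrib)
  qed
  with p have "(1 - (norm w)\<^sup>2) * (1 - (norm a)\<^sup>2) \<le> (2 * c)\<^sup>2 * m\<^sup>2" by linarith
  moreover have "m > 0" using m uv by linarith
  ultimately have "1 - (norm (\<sigma> w a))\<^sup>2 \<le> (2 * c)\<^sup>2"
    unfolding one_minus_norm_disc_aut_sq[OF w a] m_def[symmetric] by (simp add: field_simps)
  then have "sqrt (1 - (norm (\<sigma> w a))\<^sup>2) \<le> 2 * c" using c by (intro real_le_lsqrt) auto
  then show ?thesis
    using garsia_self_map[OF disc_aut_holomorphic[OF w] disc_aut_image[OF w] a] ennreal_leI order_trans by blast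
qed

lemma sum_geometric_le:
  fixes t :: real
  assumes "0 \<le> t" "t \<le> 1/2"
  shows "(\<Sum>k<n. t ^ k) \<le> 2"
proof -
  have "(\<Sum>k<n. t ^ k) * (1 - t) = 1 - t ^ n" using one_diff_power_eq[of t n] by (simp add: mult.commute)
  also have "\<dots> \<le> 1" using assms by simp
  finally have "(\<Sum>k<n. t ^ k) * (1/2) \<le> 1"
    using mult_left_mono[of "1/2" "1 - t" "\<Sum>k<n. t ^ k"] assms by (simp add: sum_nonneg)
  then show ?thesis by simp
qed

text \<open>The exponents run down to 0 at J - 1 and up again from 0 at J, giving two geometric sums
  of at most 2 each.\<close>

lemma sum_two_sided_geometric_le:
  fixes t :: real and J n :: nat
  assumes t: "0 \<le> t" "t \<le> 1/2"
  shows "(\<Sum>k<n. t ^ (if k < J then J - 1 - k else k - J)) \<le> 4"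
proof -
  have split: "(\<Sum>k<J+n. f k) = (\<Sum>k<J. f k) + (\<Sum>k<n. f (J + k))" for f :: "nat \<Rightarrow> real"
    by (induction n) auto
  have "(\<Sum>k<n. t ^ (if k < J then J - 1 - k else k - J)) \<le> (\<Sum>k<J+n. t ^ (if k < J then J - 1 - k else k - J))"
    by (rule sum_mono2) (use t in auto)
  also have "\<dots> = (\<Sum>k<J. t ^ (if k < J then J - 1 - k else k - J)) + (\<Sum>k<n. t ^ (if J + k < J then J - 1 - (J + k) else J + k - J))"
    by (rule split)
  also have "(\<Sum>k<J. t ^ (if k < J then J - 1 - k else k - J)) = (\<Sum>k<J. t ^ (J - Suc k))" by (intro sum.cong) auto
  also have "\<dots> = (\<Sum>k<J. t ^ k)" by (rule sum.nat_diff_reindex)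
  also have "\<dots> \<le> 2" by (rule sum_geometric_le[OF t])
  also have "(\<Sum>k<n. t ^ (if J + k < J then J - 1 - (J + k) else J + k - J)) = (\<Sum>k<n. t ^ k)" by simp
  also have "\<dots> \<le> 2" by (rule sum_geometric_le[OF t])
  finally show ?thesis by simp
qed

lemma sum_offdiagonal_geometric_le:
  fixes t :: real and j n :: nat
  assumes t: "0 \<le> t" "t \<le> 1/2"
  shows "(\<Sum>k\<in>{..<n} - {j}. t ^ (if k < j then j - k else k - j)) \<le> 4 * t"
proof -
  have "(\<Sum>k\<in>{..<n} - {j}. t ^ (if k < j then j - k else k - j)) = (\<Sum>k\<in>{..<n} - {j}. t * t ^ (if k < j then j - 1 - k else k - 1 - j))"
    by (intro sum.cong refl) (auto simp flip: power_Suc simp: Suc_diff_Suc not_less Suc_diff_le)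
  also have "\<dots> = t * (\<Sum>k\<in>{..<n} - {j}. t ^ (if k < j then j - 1 - k else k - 1 - j))"
    by (simp add: sum_distrib_left)
  finally have 1: "(\<Sum>k\<in>{..<n} - {j}. t ^ (if k < j then j - k else k - j)) = \<dots>" .
  have "(\<Sum>k\<in>{..<n} - {j}. t ^ (if k < j then j - 1 - k else k - 1 - j)) \<le> (\<Sum>k<n. t ^ (if k < j then j - 1 - k else k - j))"
  proof -
    \<comment> \<open>After one factor t is taken out, \<open>i\<close> closes the gap at j and the
      off-diagonal sum becomes part of the two-sided one.\<close>
    define i where "i k = (if k < j then k else k - 1)" for k
    have "(\<Sum>k\<in>{..<n} - {j}. t ^ (if k < j then j - 1 - k else k - 1 - j)) = (\<Sum>k\<in>{..<n} - {j}. (\<lambda>k. t ^ (if k < j then j - 1 - k else k - j)) (i k))"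
      by (intro sum.cong refl) (auto simp: i_def)
    also have "\<dots> = (\<Sum>k\<in>i ` ({..<n} - {j}). t ^ (if k < j then j - 1 - k else k - j))"
      by (rule sum.reindex_cong[symmetric, of i]) (auto simp: inj_on_def i_def split: if_splits)
    also have "\<dots> \<le> (\<Sum>k<n. t ^ (if k < j then j - 1 - k else k - j))"
      by (rule sum_mono2) (use t in \<open>auto simp: i_def\<close>)
    finally show ?thesis .
  qed
  also have "\<dots> \<le> 4" by (rule sum_two_sided_geometric_le[OF t])
  finally show ?thesis unfolding 1 using t by (simp add: mult.commute[of _ t] mult_left_mono)
qed


text \<open>Failure of the limit supplies points with |\<phi>| arbitrarily close to 1, so each new
  point can be pushed out until 1 - |\<phi>| has shrunk by the factor t^2. The ratio t = c *
  \<epsilon>^2 is tied to \<epsilon> because off-diagonal terms will compete with a diagonal of size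
  \<epsilon>^2.\<close>

lemma vanishes_at_image_boundary_contrapositive:
  assumes \<phi>: "\<phi> ` \<bbbD> \<subseteq> \<bbbD>" and nv: "\<not> vanishes_at_image_boundary \<phi> F" and c: "c > 0"
  obtains \<epsilon> and a :: "nat \<Rightarrow> complex" where "\<epsilon> > 0" "\<epsilon> \<le> 1"
    "\<forall>k. a k \<in> \<bbbD> \<and> F (a k) \<ge> ennreal \<epsilon>"
    "\<forall>i j. i \<le> j \<longrightarrow> 1 - norm (\<phi> (a j)) \<le> ((c * \<epsilon>\<^sup>2) ^ (j - i))\<^sup>2 * (1 - norm (\<phi> (a i)))"
proof -
  obtain \<epsilon>0 where \<epsilon>0: "\<epsilon>0 > 0" "\<And>\<eta>. \<eta> < 1 \<Longrightarrow> \<exists>a\<in>\<bbbD>. norm (\<phi> a) > \<eta> \<and> \<not> F a < ennreal \<epsilon>0"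
    using nv unfolding vanishes_at_image_boundary_def by blast
  define \<epsilon> where "\<epsilon> = min 1 \<epsilon>0"
  have \<epsilon>: "\<epsilon> > 0" "\<epsilon> \<le> 1" "\<epsilon> \<le> \<epsilon>0" using \<epsilon>0(1) by (auto simp: \<epsilon>_def)
  define t where "t = c * \<epsilon>\<^sup>2"
  have t: "t > 0" using c \<epsilon> by (simp add: t_def)
  have ex: "\<exists>a\<in>\<bbbD>. norm (\<phi> a) > \<eta> \<and> ennreal \<epsilon> \<le> F a" if "\<eta> < 1" for \<eta>
    using \<epsilon>0(2)[OF that] \<epsilon>(3) ennreal_leI order_trans not_less by metis
  have "\<exists>a. \<forall>n. (a n \<in> \<bbbD> \<and> ennreal \<epsilon> \<le> F (a n)) \<and> 1 - norm (\<phi> (a (Suc n))) \<le> t\<^sup>2 * (1 - norm (\<phi> (a n)))"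
  proof (rule dependent_nat_choice)
    show "\<exists>x. x \<in> \<bbbD> \<and> ennreal \<epsilon> \<le> F x" using ex[of 0] by auto
    fix x n assume "x \<in> \<bbbD> \<and> ennreal \<epsilon> \<le> F x"
    then have "norm (\<phi> x) < 1" using \<phi> by (auto simp: image_subset_iff)
    then have "1 - t\<^sup>2 * (1 - norm (\<phi> x)) < 1" using t by simp
    from ex[OF this] show "\<exists>y. (y \<in> \<bbbD> \<and> ennreal \<epsilon> \<le> F y) \<and> 1 - norm (\<phi> y) \<le> t\<^sup>2 * (1 - norm (\<phi> x))"
      by force
  qed
  then obtain a where a: "\<And>n. a n \<in> \<bbbD>" "\<And>n. ennreal \<epsilon> \<le> F (a n)"
    "\<And>n. 1 - norm (\<phi> (a (Suc n))) \<le> t\<^sup>2 * (1 - norm (\<phi> (a n)))" by blast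
  have step: "1 - norm (\<phi> (a (i + d))) \<le> (t ^ d)\<^sup>2 * (1 - norm (\<phi> (a i)))" for i d
  proof (induction d)
    case (Suc d)
    have "1 - norm (\<phi> (a (i + Suc d))) \<le> t\<^sup>2 * (1 - norm (\<phi> (a (i + d))))" using a(3)[of "i + d"] by simp
    also have "\<dots> \<le> t\<^sup>2 * ((t ^ d)\<^sup>2 * (1 - norm (\<phi> (a i))))" by (intro mult_left_mono Suc) auto
    finally show ?case by (simp add: power_mult_distrib mult.assoc)
  qed simp
  show ?thesis
  proof (rule that[OF \<epsilon>(1,2)])
    show "\<forall>k. a k \<in> \<bbbD> \<and> F (a k) \<ge> ennreal \<epsilon>" using a by blast
    have "1 - norm (\<phi> (a j)) \<le> ((c * \<epsilon>\<^sup>2) ^ (j - i))\<^sup>2 * (1 - norm (\<phi> (a i)))"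
      if "i \<le> j" for i j using step[of i "j - i"] that by (simp add: t_def)
    then show "\<forall>i j. i \<le> j \<longrightarrow> 1 - norm (\<phi> (a j)) \<le> ((c * \<epsilon>\<^sup>2) ^ (j - i))\<^sup>2 * (1 - norm (\<phi> (a i)))"
      by blast
  qed
qed

text \<open>Pairing on a circle of radius r < 1 keeps the integrand continuous. The bound by the
  Garsia value at the single point a is finer than the norm bound and yields the
  near-orthogonality.\<close>

lemma circ_mean_functional_in_dual:
  assumes a: "a \<in> \<bbbD>" and r: "0 < r" "r < 1"
    and \<psi>: "continuous_on (sphere 0 r) \<psi>" "\<And>z. norm z = r \<Longrightarrow> norm (\<psi> z) \<le> 1"
  defines "L \<equiv> \<lambda>f. circ_mean r (\<lambda>z. (f (\<sigma> a z) - f a) * cnj (\<psi> z))"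
  shows "L \<in> bmoa_dual"
    and "f \<in> bmoa \<Longrightarrow> garsia f a \<le> ennreal m \<Longrightarrow> m \<ge> 0 \<Longrightarrow> norm (L f) \<le> m"
proof -
  have cont: "continuous_on (sphere 0 r) (\<lambda>z. f (\<sigma> a z))" if "f \<in> bmoa" for f
    by (rule holomorphic_continuous_on_sphere[OF holomorphic_disc_aut_compose[OF bmoa_holomorphic[OF that] a] r(2)])
  have contd: "continuous_on (sphere 0 r) (\<lambda>z. f (\<sigma> a z) - f a)" if "f \<in> bmoa" for f
    by (intro continuous_on_diff cont[OF that] continuous_on_const)
  have contp: "continuous_on (sphere 0 r) (\<lambda>z. (f (\<sigma> a z) - f a) * cnj (\<psi> z))" if "f \<in> bmoa" for f
    by (intro continuous_on_mult contd[OF that] continuous_on_cnj \<psi>)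
  show bd: "norm (L f) \<le> m" if f: "f \<in> bmoa" and m: "garsia f a \<le> ennreal m" "m \<ge> 0" for f m
  proof -
    have "norm (L f) \<le> circ_mean r (\<lambda>z. norm ((f (\<sigma> a z) - f a) * cnj (\<psi> z)))"
      unfolding L_def by (rule norm_circ_mean_le) (use r in \<open>auto intro!: contp contd continuous_on_norm f\<close>)
    also have "\<dots> \<le> circ_mean r (\<lambda>z. norm (f (\<sigma> a z) - f a))"
    proof (rule circ_mean_mono)
      fix z :: complex assume "norm z = r"
      from \<psi>(2)[OF this] show "norm ((f (\<sigma> a z) - f a) * cnj (\<psi> z)) \<le> norm (f (\<sigma> a z) - f a)"
        by (simp add: norm_mult mult_left_le)
    qed (use r in \<open>auto intro!: contp contd continuous_on_norm f\<close>)
    also have "\<dots> \<le> circle_mean2 (\<lambda>z. f (\<sigma> a z) - f a) r"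
      by (rule circ_mean_norm_le_circle_mean2) (use r in \<open>auto intro!: contd f\<close>)
    also have "\<dots> \<le> m"
      by (rule circle_mean2_le_h2_norm) (use m r in \<open>auto simp: garsia_def\<close>)
    finally show ?thesis .
  qed
  show "L \<in> bmoa_dual"
    unfolding bmoa_dual_def
  proof (intro CollectI conjI ballI allI)
    fix f g assume fg: "f \<in> bmoa" "g \<in> bmoa"
    have "L (\<lambda>z. f z + g z) = circ_mean r (\<lambda>z. (f (\<sigma> a z) - f a) * cnj (\<psi> z) + (g (\<sigma> a z) - g a) * cnj (\<psi> z))"
      unfolding L_def by (simp add: algebra_simps)
    also have "\<dots> = L f + L g"
      unfolding L_def by (rule circ_mean_add) (use r in \<open>auto intro!: contp fg\<close>)
    finally show "L (\<lambda>z. f z + g z) = L f + L g" .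
  next
    fix c f assume f: "f \<in> bmoa"
    have "L (\<lambda>z. c * f z) = circ_mean r (\<lambda>z. c * ((f (\<sigma> a z) - f a) * cnj (\<psi> z)))"
      unfolding L_def by (simp add: algebra_simps)
    also have "\<dots> = c * L f"
      unfolding L_def by (rule circ_mean_mult_left) (use r in \<open>auto intro!: contp contd continuous_on_norm f\<close>)
    finally show "L (\<lambda>z. c * f z) = c * L f" .
  next
    have "\<forall>f\<in>bmoa. norm (L f) \<le> 1 * bmoa_norm f"
      using bd bmoa_garsia_le[OF _ a] by simp
    then show "\<exists>K. \<forall>f\<in>bmoa. norm (L f) \<le> K * bmoa_norm f" by (rule exI)
  qed
qed

text \<open>Tychonoff's theorem on the product of the discs \<open>|z| \<le> bmoa_norm f\<close> supplies a cluster point of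
  the functionals, so that no Hahn--Banach extension is needed.\<close>

lemma bmoa_dual_cluster:
  fixes L :: "nat \<Rightarrow> (complex \<Rightarrow> complex) \<Rightarrow> complex"
  assumes L: "\<And>j. L j \<in> bmoa_dual" "\<And>j f. f \<in> bmoa \<Longrightarrow> norm (L j f) \<le> bmoa_norm f"
  shows "\<exists>l\<in>bmoa_dual. \<forall>f C m. f \<in> bmoa \<longrightarrow> closed C \<longrightarrow> (\<forall>j\<ge>m. L j f \<in> C) \<longrightarrow> l f \<in> C"
proof -
  define X where "X = product_topology (\<lambda>_::complex \<Rightarrow> complex. (euclidean :: complex topology)) bmoa"
  define P where "P = PiE bmoa (\<lambda>f. cball (0::complex) (bmoa_norm f))"
  have "compactin X P" unfolding X_def P_def compactin_PiE by simp
  moreover have "restrict (L j) bmoa \<in> P" for j using L(2) by (auto simp: P_def)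
  ultimately obtain l where l: "l \<in> P"
    and lim: "\<forall>G (C :: complex set) m. continuous_map X euclidean G \<longrightarrow> closed C \<longrightarrow> (\<forall>n\<ge>m. G (restrict (L n) bmoa) \<in> C) \<longrightarrow> G l \<in> C"
    using compactin_sequence_cluster[of X P "\<lambda>j. restrict (L j) bmoa"] by blast
  have proj: "continuous_map X euclidean (\<lambda>h. h f)" if "f \<in> bmoa" for f
    unfolding X_def by (rule continuous_map_product_projection[OF that])
  have val: "l f \<in> C" if "f \<in> bmoa" "closed C" "\<And>j. j \<ge> m \<Longrightarrow> L j f \<in> C" for f C m
    using lim[rule_format, OF proj[OF that(1)] that(2), of m] that by simp
  have "l \<in> bmoa_dual"
    unfolding bmoa_dual_def
  proof (intro CollectI conjI ballI allI)
    fix f g assume fg: "f \<in> bmoa" "g \<in> bmoa"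
    have s: "(\<lambda>z. f z + g z) \<in> bmoa" by (rule bmoa_norm_triangle(1)[OF fg])
    \<comment> \<open>Linearity passes to the cluster point as membership of a continuous expression
      in the closed set {0}.\<close>
    have "l (\<lambda>z. f z + g z) - (l f + l g) \<in> {0}"
      by (rule lim[rule_format, where G = "\<lambda>h. h (\<lambda>z. f z + g z) - (h f + h g)" and m = 0])
         (use fg s bmoa_dualD(1)[OF L(1)] in \<open>auto intro!: continuous_map_diff continuous_map_add proj\<close>)
    then show "l (\<lambda>z. f z + g z) = l f + l g" by simp
  next
    fix c f assume f: "f \<in> bmoa"
    have s: "(\<lambda>z. c * f z) \<in> bmoa"
      by (rule bmoaI(1)[of _ "norm c * bmoa_norm f"])
         (use f garsia_cmult_le[OF bmoa_garsia_le[OF f]] in \<open>auto simp: bmoa_def intro!: holomorphic_intros\<close>)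
    have "continuous_map euclidean euclidean (\<lambda>x::complex. c * x)"
      by (simp add: continuous_map_iff_continuous2 continuous_on_mult_left)
    from continuous_map_compose[OF proj[OF f] this]
    have "continuous_map X euclidean (\<lambda>h. c * h f)" by (simp add: o_def)
    then have "l (\<lambda>z. c * f z) - c * l f \<in> {0}"
      by (intro lim[rule_format, where G = "\<lambda>h. h (\<lambda>z. c * f z) - c * h f" and m = 0])
         (use f s bmoa_dualD(2)[OF L(1)] in \<open>auto intro!: continuous_map_diff proj\<close>)
    then show "l (\<lambda>z. c * f z) = c * l f" by simp
  next
    have "\<forall>f\<in>bmoa. norm (l f) \<le> 1 * bmoa_norm f"
      using l by (auto simp: P_def PiE_iff)
    then show "\<exists>K. \<forall>f\<in>bmoa. norm (l f) \<le> K * bmoa_norm f" by (rule exI)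
  qed
  then show ?thesis using val by blast
qed

text \<open>Subtracting w normalizes the value at 0 and leaves Garsia values unchanged; off the disc
  the function is cut to 0, as \<open>bmoa\<close> demands.\<close>

lemma disc_aut_function_in_bmoa:
  assumes w: "w \<in> \<bbbD>"
  defines "f \<equiv> \<lambda>z. if z \<in> \<bbbD> then \<sigma> w z - w else 0"
  shows "f \<in> bmoa" "a \<in> \<bbbD> \<Longrightarrow> garsia f a = garsia (\<sigma> w) a" "f holomorphic_on \<bbbD>"
proof -
  show g: "garsia f a = garsia (\<sigma> w) a" if "a \<in> \<bbbD>" for a
  proof -
    have "garsia f a = garsia (\<lambda>z. \<sigma> w z - w) a" by (rule garsia_cong) (use that in \<open>auto simp: f_def\<close>)
    then show ?thesis by (simp add: garsia_def)
  qed
  show hol: "f holomorphic_on \<bbbD>"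
  proof (rule holomorphic_transform)
    show "(\<lambda>z. \<sigma> w z - w) holomorphic_on \<bbbD>" by (intro holomorphic_intros disc_aut_holomorphic w)
  qed (simp add: f_def)
  show "f \<in> bmoa"
  proof (rule bmoaI(1)[OF hol, of 1])
    fix a assume a: "a \<in> \<bbbD>"
    have "garsia (\<sigma> w) a \<le> ennreal (sqrt (1 - (norm (\<sigma> w a))\<^sup>2))"
      by (rule garsia_self_map[OF disc_aut_holomorphic[OF w] disc_aut_image[OF w] a])
    also have "\<dots> \<le> ennreal 1" by (intro ennreal_leI) (simp add: real_sqrt_le_1_iff)
    finally show "garsia f a \<le> ennreal 1" by (simp only: g[OF a])
  qed (auto simp: f_def)
qed

text \<open>J is the first index with 1 - |w_J| < 1 - |a|. Away from J on either side the ratio of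
  these distances decays by t^2 per step, so the summands decay geometrically; 8 is 2 times
  4.\<close>

lemma sum_disc_aut_garsia_bounded:
  fixes N :: nat
  assumes t: "0 < t" "t \<le> 1/2" and w: "\<And>k. w k \<in> \<bbbD>"
    and decay: "\<And>i j. i \<le> j \<Longrightarrow> 1 - norm (w j) \<le> (t ^ (j - i))\<^sup>2 * (1 - norm (w i))"
    and a: "a \<in> \<bbbD>" and f: "\<And>k. f k holomorphic_on \<bbbD>" "\<And>k. garsia (f k) a = garsia (\<sigma> (w k)) a"
  shows "garsia (\<lambda>z. \<Sum>k<N. f k z) a \<le> ennreal 8"
proof -
  define v where "v = 1 - norm a"
  define u where "u k = 1 - norm (w k)" for k
  have v: "v > 0" using a by (simp add: v_def)
  have ex: "\<exists>k. u k < v"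
  proof -
    obtain n where n: "t ^ n < v" using real_arch_pow_inv[OF v, of t] t by auto
    have "u n \<le> (t ^ n)\<^sup>2 * u 0" using decay[of 0 n] by (simp add: u_def)
    also have "\<dots> \<le> (t ^ n)\<^sup>2 * 1" by (intro mult_left_mono) (auto simp: u_def)
    also have "\<dots> \<le> t ^ n" using t by (simp add: power2_eq_square mult_left_le power_le_one)
    finally show ?thesis using n by (intro exI[of _ n]) simp
  qed
  define J where "J = (LEAST k. u k < v)"
  have J: "u J < v" unfolding J_def by (rule LeastI_ex[OF ex])
  have vu: "v \<le> u k" if "k < J" for k
    using not_less_Least[of k "\<lambda>k. u k < v"] that unfolding J_def by simp
  define c where "c k = t ^ (if k < J then J - 1 - k else k - J)" for k
  have c0: "c k \<ge> 0" for k using t by (simp add: c_def)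
  have g: "garsia (f k) a \<le> ennreal (2 * c k)" for k
    unfolding f(2)
  proof (rule garsia_disc_aut_decay[OF w a c0])
    show "1 - norm a \<le> (c k)\<^sup>2 * (1 - norm (w k)) \<or> 1 - norm (w k) \<le> (c k)\<^sup>2 * (1 - norm a)"
    proof (cases "k < J")
      case True
      have "v \<le> u (J - 1)" using True by (intro vu) auto
      also have "\<dots> \<le> (t ^ (J - 1 - k))\<^sup>2 * u k" unfolding u_def using True by (intro decay) auto
      finally show ?thesis using True by (simp add: c_def u_def v_def)
    next
      case False
      have "u k \<le> (t ^ (k - J))\<^sup>2 * u J" unfolding u_def using False by (intro decay) auto
      also have "\<dots> \<le> (t ^ (k - J))\<^sup>2 * v" using J by (intro mult_left_mono) auto
      finally show ?thesis using False by (simp add: c_def u_def v_def)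
    qed
  qed
  have "garsia (\<lambda>z. \<Sum>k<N. f k z) a \<le> ennreal (\<Sum>k<N. 2 * c k)"
    by (rule garsia_sum_le) (use f(1) a g c0 in auto)
  also have "(\<Sum>k<N. 2 * c k) = 2 * (\<Sum>k<N. c k)" by (simp add: sum_distrib_left)
  also have "ennreal \<dots> \<le> ennreal 8"
    using sum_two_sided_geometric_le[of t J N] t by (intro ennreal_leI) (simp add: c_def)
  finally show ?thesis .
qed

theorem weakly_compact_imp_vanishing:
  assumes \<phi>: "\<phi> holomorphic_on \<bbbD>" "\<phi> ` \<bbbD> \<subseteq> \<bbbD>"
    and wc: "bmoa_weakly_compact (comp_op \<phi>)"
  shows "vanishes_at_image_boundary \<phi> (\<lambda>a. h2_norm (\<sigma> (\<phi> a) \<circ> \<phi> \<circ> \<sigma> a))"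
proof (rule ccontr)
  define T where "T = comp_op \<phi>"
  define \<Psi> where "\<Psi> a = \<sigma> (\<phi> a) \<circ> \<phi> \<circ> \<sigma> a" for a
  assume "\<not> ?thesis"
  then have nv: "\<not> vanishes_at_image_boundary \<phi> (\<lambda>a. h2_norm (\<Psi> a))" by (simp add: \<Psi>_def)
  obtain \<epsilon> and a :: "nat \<Rightarrow> complex" where \<epsilon>: "\<epsilon> > 0" "\<epsilon> \<le> 1"
    and abig: "\<forall>k. a k \<in> \<bbbD> \<and> h2_norm (\<Psi> (a k)) \<ge> ennreal \<epsilon>"
    and decay: "\<forall>i j. i \<le> j \<longrightarrow> 1 - norm (\<phi> (a j)) \<le> ((1/128 * \<epsilon>\<^sup>2) ^ (j - i))\<^sup>2 * (1 - norm (\<phi> (a i)))"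
    by (rule vanishes_at_image_boundary_contrapositive[OF \<phi>(2) nv, of "1/128"]) auto
  have a: "a k \<in> \<bbbD>" and big: "h2_norm (\<Psi> (a k)) \<ge> ennreal \<epsilon>" for k using abig by auto
  \<comment> \<open>8 t = \<epsilon>^2 / 16 bounds the total off-diagonal contribution, a quarter of
    the diagonal lower bound \<epsilon>^2 / 4.\<close>
  define t where "t = 1/128 * \<epsilon>\<^sup>2"
  have t: "0 < t" "t \<le> 1/2" "8 * t = \<epsilon>\<^sup>2 / 16" using \<epsilon> power_le_one[of \<epsilon> 2] by (auto simp: t_def)
  define w where "w k = \<phi> (a k)" for k
  have w: "w k \<in> \<bbbD>" for k using a \<phi>(2) by (auto simp: w_def image_subset_iff)
  have dec: "1 - norm (w j) \<le> (t ^ (j - i))\<^sup>2 * (1 - norm (w i))" if "i \<le> j" for i j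
    using decay[rule_format, OF that] by (simp add: w_def t_def)
  define f where "f k = (\<lambda>z. if z \<in> \<bbbD> then \<sigma> (w k) z - w k else 0)" for k
  have fb: "f k \<in> bmoa" "f k holomorphic_on \<bbbD>" for k
    unfolding f_def using disc_aut_function_in_bmoa[OF w] by auto
  have fg: "garsia (f k) b = garsia (\<sigma> (w k)) b" if "b \<in> \<bbbD>" for k b
    unfolding f_def using disc_aut_function_in_bmoa(2)[OF w that] .
  define S where "S N = (\<lambda>z. \<Sum>k<N. f k z)" for N :: nat
  have Sb: "S N \<in> bmoa" for N unfolding S_def by (rule bmoa_sum) (rule fb)
  have Sn: "bmoa_norm (S N) \<le> 8" for N
  proof -
    have "bmoa_norm (S N) \<le> norm (S N 0) + 8"
    proof (rule bmoaI(2)[OF bmoa_holomorphic[OF Sb]])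
      show "garsia (S N) b \<le> ennreal 8" if "b \<in> \<bbbD>" for b
        unfolding S_def by (rule sum_disc_aut_garsia_bounded[OF t(1,2) w dec that fb(2) fg[OF that]])
    qed (use Sb in \<open>auto simp: bmoa_def\<close>)
    also have "S N 0 = 0" by (simp add: S_def f_def)
    finally show ?thesis by simp
  qed
  have TT: "T g \<in> bmoa" if "g \<in> bmoa" for g unfolding T_def by (rule comp_op_bmoa[OF that \<phi>])
  have TS: "T (S N) = (\<lambda>z. \<Sum>k<N. T (f k) z)" for N by (auto simp: T_def comp_op_def S_def)
  have \<Psi>hol: "\<Psi> (a j) holomorphic_on \<bbbD>" "\<Psi> (a j) ` \<bbbD> \<subseteq> \<bbbD>" for j
    unfolding \<Psi>_def by (rule disc_aut_conjugate[OF \<phi> a])+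
  have "\<exists>r. 0 < r \<and> r < 1 \<and> circle_mean2 (\<Psi> (a j)) r > \<epsilon> / 2" for j
  proof -
    have "ennreal (\<epsilon>/2) < ennreal \<epsilon>" using \<epsilon> by (simp add: ennreal_less_iff)
    also note big[of j]
    finally obtain r where "r \<in> {0<..<1}" "ennreal (\<epsilon>/2) < ennreal (circle_mean2 (\<Psi> (a j)) r)"
      unfolding h2_norm_def less_SUP_iff by blast
    then show ?thesis using \<epsilon> by (auto simp: ennreal_less_iff)
  qed
  then obtain r where r: "\<And>j. 0 < r j" "\<And>j. r j < 1" "\<And>j. circle_mean2 (\<Psi> (a j)) (r j) > \<epsilon> / 2" by metis
  \<comment> \<open>At radius r j the quadratic mean of \<psi>_j exceeds \<epsilon> / 2. Pairing
    with \<psi>_j itself makes the value on T (f j) the square of that mean.\<close>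
  define L where "L j = (\<lambda>g. circ_mean (r j) (\<lambda>z. (g (\<sigma> (a j) z) - g (a j)) * cnj (\<Psi> (a j) z)))" for j
  have \<Psi>c: "continuous_on (sphere 0 (r j)) (\<Psi> (a j))" for j
    by (rule holomorphic_continuous_on_sphere[OF \<Psi>hol(1) r(2)])
  have \<Psi>1: "norm (\<Psi> (a j) z) \<le> 1" if "norm z = r j" for j z
    
  proof -
    have "z \<in> \<bbbD>" using r(2)[of j] that by simp
    then have "\<Psi> (a j) z \<in> \<bbbD>" using \<Psi>hol(2)[of j] by blast
    then show ?thesis by simp
  qed
  have Ld: "L j \<in> bmoa_dual" for j
    unfolding L_def by (rule circ_mean_functional_in_dual(1)[of "a j" "r j" "\<Psi> (a j)", OF a r(1) r(2) \<Psi>c \<Psi>1])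
  have Lb: "norm (L j g) \<le> m" if "g \<in> bmoa" "garsia g (a j) \<le> ennreal m" "m \<ge> 0" for j g m
    unfolding L_def by (rule circ_mean_functional_in_dual(2)[of "a j" "r j" "\<Psi> (a j)", OF a r(1) r(2) \<Psi>c \<Psi>1 that])
  have diag: "norm (L j (T (f j))) \<ge> \<epsilon>\<^sup>2 / 4" for j
  proof -
    have "L j (T (f j)) = circ_mean (r j) (\<lambda>z. complex_of_real ((norm (\<Psi> (a j) z))\<^sup>2))"
      unfolding L_def
    proof (rule circ_mean_cong)
      fix z :: complex assume "norm z = r j"
      then have z: "z \<in> \<bbbD>" using r(2)[of j] by simp
      have s: "\<sigma> (a j) z \<in> \<bbbD>" by (rule disc_aut_in_disc(2)[OF a z])
      then have "\<phi> (\<sigma> (a j) z) \<in> \<bbbD>" using \<phi>(2) by blast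
      then have "T (f j) (\<sigma> (a j) z) - T (f j) (a j) = \<Psi> (a j) z"
        using s a[of j] w[of j] by (simp add: T_def comp_op_def f_def \<Psi>_def w_def)
      then show "(T (f j) (\<sigma> (a j) z) - T (f j) (a j)) * cnj (\<Psi> (a j) z) = complex_of_real ((norm (\<Psi> (a j) z))\<^sup>2)"
        by (simp only: complex_norm_square)
    qed (use r(1)[of j] in simp)
    also have "\<dots> = complex_of_real (circ_mean (r j) (\<lambda>z. (norm (\<Psi> (a j) z))\<^sup>2))"
      by (rule circ_mean_bounded_linear[OF bounded_linear_of_real])
         (use \<Psi>c r(1)[of j] in \<open>auto intro!: continuous_intros\<close>)
    finally have "norm (L j (T (f j))) \<ge> circ_mean (r j) (\<lambda>z. (norm (\<Psi> (a j) z))\<^sup>2)" by simp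
    moreover have "(\<epsilon> / 2)\<^sup>2 \<le> circ_mean (r j) (\<lambda>z. (norm (\<Psi> (a j) z))\<^sup>2)"
      using r(3)[of j] \<epsilon> unfolding circle_mean2_eq by (intro sqrt_ge_absD) simp
    ultimately show ?thesis by (simp add: power_divide)
  qed
  define d where "d j k = t ^ (if k < j then j - k else k - j)" for j k
  \<comment> \<open>Composition moves the base point from a_j to w_j, where \<open>f k\<close> has
    small Garsia value because the distances of w_j and w_k to the circle differ by powers of
    t.\<close>
  have off: "norm (L j (T (f k))) \<le> 2 * d j k" for j k
  proof (rule Lb[OF TT[OF fb(1)]])
    have d0: "d j k \<ge> 0" using t by (simp add: d_def)
    then show "2 * d j k \<ge> 0" by simp
    have "garsia (T (f k)) (a j) \<le> garsia (f k) (w j)"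
      unfolding T_def comp_op_garsia[OF a] w_def by (rule garsia_compose[OF fb(2) \<phi> a])
    also have "\<dots> = garsia (\<sigma> (w k)) (w j)" by (rule fg[OF w])
    also have "\<dots> \<le> ennreal (2 * d j k)"
      by (rule garsia_disc_aut_decay[OF w w d0]) (use dec[of k j] dec[of j k] in \<open>auto simp: d_def\<close>)
    finally show "garsia (T (f k)) (a j) \<le> ennreal (2 * d j k)" .
  qed
  have offsum: "norm (\<Sum>k\<in>{..<N} - {j}. L j (T (f k))) \<le> \<epsilon>\<^sup>2 / 16" for N j
  proof -
    have "norm (\<Sum>k\<in>{..<N} - {j}. L j (T (f k))) \<le> (\<Sum>k\<in>{..<N} - {j}. 2 * d j k)"
      by (rule sum_norm_le) (rule off)
    also have "\<dots> = 2 * (\<Sum>k\<in>{..<N} - {j}. d j k)" by (simp add: sum_distrib_left)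
    also have "\<dots> \<le> 2 * (4 * t)"
      unfolding d_def using sum_offdiagonal_geometric_le[of t j N] t by simp
    finally show ?thesis using t(3) by simp
  qed
  have LT: "L j (T (S N)) = (\<Sum>k<N. L j (T (f k)))" for j N
    unfolding TS by (rule bmoa_dual_sum[OF Ld]) (intro TT fb)
  \<comment> \<open>3/16 = 1/4 - 1/16: the diagonal term is present exactly when N > j.\<close>
  have low: "norm (L j (T (S N))) \<ge> 3 * \<epsilon>\<^sup>2 / 16" if "N > j" for j N
  proof -
    have "L j (T (S N)) = L j (T (f j)) + (\<Sum>k\<in>{..<N} - {j}. L j (T (f k)))"
      unfolding LT using that by (intro sum.remove) auto
    then have "norm (L j (T (f j))) \<le> norm (L j (T (S N))) + norm (\<Sum>k\<in>{..<N} - {j}. L j (T (f k)))"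
      using norm_triangle_ineq4[of "L j (T (f j)) + (\<Sum>k\<in>{..<N} - {j}. L j (T (f k)))" "\<Sum>k\<in>{..<N} - {j}. L j (T (f k))"] by simp
    then show ?thesis using diag[of j] offsum[where j = j and N = N] by simp
  qed
  have high: "norm (L j (T (S N))) \<le> \<epsilon>\<^sup>2 / 16" if "N \<le> j" for j N
  proof -
    have "{..<N} - {j} = {..<N}" using that by auto
    then show ?thesis using offsum[where j = j and N = N] unfolding LT by simp
  qed
  have "bmoa_bounded (range S)" unfolding bmoa_bounded_def using Sb Sn by (intro conjI exI[of _ 8]) (simp_all add: image_subset_iff)
  then have comp: "compactin bmoa_weak_topology (bmoa_weak_topology closure_of (T ` range S))"
    using wc unfolding bmoa_weakly_compact_def T_def by blast
  have "T ` range S \<subseteq> bmoa_weak_topology closure_of (T ` range S)"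
    by (rule closure_of_subset) (simp add: image_subset_iff TT Sb)
  then have "T (S N) \<in> bmoa_weak_topology closure_of (T ` range S)" for N by blast
  then obtain x where x: "x \<in> bmoa_weak_topology closure_of (T ` range S)"
    "\<forall>G (C :: complex set) m. continuous_map bmoa_weak_topology euclidean G \<longrightarrow> closed C \<longrightarrow> (\<forall>n\<ge>m. G (T (S n)) \<in> C) \<longrightarrow> G x \<in> C"
    using compactin_sequence_cluster[OF comp, of "\<lambda>N. T (S N)"] by blast
  have xb: "x \<in> bmoa" using x(1) closure_of_subset_topspace[of bmoa_weak_topology] by auto
  have "norm (L j g) \<le> bmoa_norm g" if "g \<in> bmoa" for j g
    by (rule Lb[OF that bmoa_garsia_le[OF that a]]) simp
  then obtain l where l: "l \<in> bmoa_dual"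
    "\<forall>f C m. f \<in> bmoa \<longrightarrow> closed C \<longrightarrow> (\<forall>j\<ge>m. L j f \<in> C) \<longrightarrow> l f \<in> C"
    using bmoa_dual_cluster[of L, OF Ld] by blast
  have closed_ge: "closed {z::complex. c \<le> norm z}" for c by (intro closed_Collect_le continuous_intros)
  \<comment> \<open>Two iterated limits of L j (T (S N)): N before j gives modulus at least 3
    \<epsilon>^2 / 16 for \<open>l x\<close>, the opposite order at most \<epsilon>^2 / 16.\<close>
  have "L j x \<in> {z. 3 * \<epsilon>\<^sup>2 / 16 \<le> norm z}" for j
    by (rule x(2)[rule_format, OF continuous_map_weak_dual[OF Ld] closed_ge, of "Suc j"]) (use low in auto)
  then have "l x \<in> {z. 3 * \<epsilon>\<^sup>2 / 16 \<le> norm z}" by (intro l(2)[rule_format, OF xb closed_ge, of 0])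
  moreover have "l (T (S N)) \<in> cball 0 (\<epsilon>\<^sup>2 / 16)" for N
    by (rule l(2)[rule_format, OF TT[OF Sb] closed_cball, of N]) (use high in auto)
  then have "l x \<in> cball 0 (\<epsilon>\<^sup>2 / 16)" by (intro x(2)[rule_format, OF continuous_map_weak_dual[OF l(1)] closed_cball, of 0])
  moreover have "\<epsilon>\<^sup>2 > 0" using \<epsilon> by simp
  ultimately show False by simp
qed

subsection \<open>Jensen's formula and the counting function\<close>

text \<open>ln |h| is the real part of a holomorphic logarithm of h, so the mean value property
  applies.\<close>

lemma circ_mean_ln_norm:
  assumes h: "h holomorphic_on ball 0 R" "\<And>z. z \<in> ball 0 R \<Longrightarrow> h z \<noteq> 0" and r: "0 \<le> r" "r < R"
  shows "circ_mean r (\<lambda>z. ln (norm (h z))) = ln (norm (h 0))"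
proof -
  obtain k where k: "k holomorphic_on ball 0 R" "\<And>z. z \<in> ball 0 R \<Longrightarrow> exp (k z) = h z"
    using holomorphic_logarithm_exists[of "ball 0 R" h 0] h r by auto
  have ln: "ln (norm (h z)) = Re (k z)" if "z \<in> ball 0 R" for z
    using k(2)[OF that, symmetric] by simp
  have "circ_mean r (\<lambda>z. ln (norm (h z))) = circ_mean r (\<lambda>z. Re (k z))"
    by (rule circ_mean_cong) (use r ln in auto)
  also have "\<dots> = Re (circ_mean r k)"
    by (rule circ_mean_Re[OF holomorphic_continuous_on_sphere[OF k(1) r(2)] r(1)])
  also have "circ_mean r k = k 0" by (rule circ_mean_holomorphic[OF k(1) r])
  finally show ?thesis using ln[of 0] r by simp
qed

text \<open>Zeros on the circle |z| = r are divided out as well. R' does not pass the next modulus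
  of a zero, so g and the product have the same zeros with the same orders on the ball of radius
  R'.\<close>

lemma holomorphic_zero_factorization:
  assumes g: "g holomorphic_on ball 0 R" "g 0 \<noteq> 0" and r: "0 < r" "r < R"
  defines "Z \<equiv> {z \<in> cball 0 r. g z = 0}"
  obtains h R' where "r < R'" "R' \<le> R" "finite Z" "h holomorphic_on ball 0 R'" "\<And>z. z \<in> ball 0 R' \<Longrightarrow> h z \<noteq> 0"
    "\<And>z. z \<in> ball 0 R' \<Longrightarrow> g z = h z * (\<Prod>\<zeta>\<in>Z. (z - \<zeta>) ^ nat (zorder g \<zeta>))"
    "\<And>\<zeta>. \<zeta> \<in> Z \<Longrightarrow> zorder g \<zeta> > 0"
proof -
  have nc: "\<not> g constant_on ball 0 R" if "g z = 0" "z \<in> ball 0 R" for z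
    using that g(2) r unfolding constant_on_def by (metis centre_in_ball order.strict_trans)
  have fin: "finite {z \<in> cball 0 \<rho>. g z = 0}" if "\<rho> < R" for \<rho>
  proof (cases "\<exists>z\<in>ball 0 R. g z = 0")
    case True
    then show ?thesis
      using holomorphic_compact_finite_zeros[OF g(1) open_ball connected_ball compact_cball[of 0 \<rho>]] nc that by force
  next
    case False
    then have eq: "{z \<in> cball 0 \<rho>. g z = 0} = {}" using that by auto
    show ?thesis unfolding eq by simp
  qed
  define r1 where "r1 = (r + R) / 2"
  have r1: "r < r1" "r1 < R" using r by (auto simp: r1_def)
  define E where "E = {z \<in> cball 0 r1. g z = 0 \<and> norm z > r}"
  have finE: "finite E" by (rule finite_subset[OF _ fin[OF r1(2)]]) (auto simp: E_def)
  define R' where "R' = Min (insert r1 (norm ` E))"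
  have R': "r < R'" "R' \<le> r1" using finE r1 by (auto simp: R'_def E_def)
  have R'E: "R' \<le> norm z" if "z \<in> E" for z using finE that by (auto simp: R'_def)
  have finZ: "finite Z" unfolding Z_def by (rule fin[OF r(2)])
  have zero_iff: "g z = 0 \<longleftrightarrow> z \<in> Z" if "z \<in> ball 0 R'" for z
  proof
    assume "g z = 0"
    moreover from this have "\<not> norm z > r" using that R'E[of z] R' by (auto simp: E_def)
    ultimately show "z \<in> Z" by (simp add: Z_def)
  qed (simp add: Z_def)
  have sub: "ball 0 R' \<subseteq> ball (0::complex) R" using R' r1 by auto
  have gh: "g holomorphic_on ball 0 R'" by (rule holomorphic_on_subset[OF g(1) sub])
  have freq: "frequently (\<lambda>w. g w \<noteq> 0) (at z)" if "z \<in> ball 0 R" for z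
  proof -
    have "eventually (\<lambda>w. g w \<noteq> 0 \<and> w \<in> ball 0 R) (at z)"
      by (rule non_zero_neighbour_alt[OF g(1) open_ball connected_ball that _ g(2)]) (use r in auto)
    then have "eventually (\<lambda>w. g w \<noteq> 0) (at z)" by (rule eventually_mono) auto
    then show ?thesis by (rule eventually_frequently[rotated]) simp
  qed
  have an: "g analytic_on {z}" if "z \<in> ball 0 R" for z
    using g(1) that analytic_at open_ball by blast
  have pos: "zorder g \<zeta> > 0" if "\<zeta> \<in> Z" for \<zeta>
  proof -
    have "\<zeta> \<in> ball 0 R" "g \<zeta> = 0" using that r by (auto simp: Z_def)
    then show ?thesis using zorder_pos_iff'[OF an freq] by auto
  qed
  define P where "P z = (\<Prod>\<zeta>\<in>Z. (z - \<zeta>) ^ nat (zorder g \<zeta>))" for z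
  have P0: "P z = 0 \<longleftrightarrow> z \<in> Z" for z
    unfolding P_def using finZ pos by (auto simp: zero_less_nat_eq)
  have Pord: "zorder P z = zorder g z" if z: "z \<in> ball 0 R'" for z
  proof (cases "z \<in> Z")
    case True
    show ?thesis
    proof (rule zorder_eqI[of UNIV z "\<lambda>x. \<Prod>\<zeta>\<in>Z - {z}. (x - \<zeta>) ^ nat (zorder g \<zeta>)"])
      show "(\<Prod>\<zeta>\<in>Z - {z}. (z - \<zeta>) ^ nat (zorder g \<zeta>)) \<noteq> 0"
        using finZ by auto
      fix x :: complex assume "x \<noteq> z"
      have "P x = (x - z) ^ nat (zorder g z) * (\<Prod>\<zeta>\<in>Z - {z}. (x - \<zeta>) ^ nat (zorder g \<zeta>))"
        unfolding P_def by (rule prod.remove[OF finZ True])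
      then show "P x = (\<Prod>\<zeta>\<in>Z - {z}. (x - \<zeta>) ^ nat (zorder g \<zeta>)) * (x - z) powi zorder g z"
        using pos[OF True] by (simp add: power_int_def)
    qed (auto intro!: holomorphic_intros)
  next
    case False
    have "zorder g z = 0"
      by (rule zorder_eq_0I[OF an]) (use z sub zero_iff[OF z] False in auto)
    moreover have "zorder P z = 0"
      by (rule zorder_eq_0I) (use P0 False in \<open>auto simp: P_def[abs_def] intro!: analytic_intros\<close>)
    ultimately show ?thesis by simp
  qed
  have Ph: "P holomorphic_on ball 0 R'" unfolding P_def by (intro holomorphic_intros)
  obtain h where h: "h holomorphic_on ball 0 R'" "\<And>z. z \<in> ball 0 R' \<Longrightarrow> h z \<noteq> 0" "\<And>z. z \<in> ball 0 R' \<Longrightarrow> g z = h z * P z"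
    by (rule holomorphic_zorder_factorization[OF gh open_ball connected_ball Ph _ Pord]) (use zero_iff P0 in auto)
  show ?thesis
    by (rule that[OF R'(1) _ finZ h(1,2) _ pos]) (use R' r1 h(3) in \<open>auto simp: P_def\<close>)
qed

text \<open>Reflection in the circle, as in a Blaschke factor: for |\<zeta>| < r the factor on the
  right has no zero in the closed disc of radius r.\<close>

lemma norm_diff_on_circle:
  assumes "norm z = r" "r > 0"
  shows "norm (z - \<zeta>) = norm (of_real r - cnj \<zeta> / of_real r * z)"
proof -
  have zz: "z * cnj z = of_real (r\<^sup>2)" using assms complex_norm_square[of z] by simp
  have "of_real r - cnj \<zeta> / of_real r * z = (of_real (r\<^sup>2) - cnj \<zeta> * z) / of_real r"
    using assms by (simp add: field_simps power2_eq_square)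
  also have "\<dots> = (z * cnj z - cnj \<zeta> * z) / of_real r" by (simp only: zz)
  also have "\<dots> = z / of_real r * cnj (z - \<zeta>)" by (simp add: diff_divide_distrib right_diff_distrib mult.commute)
  finally show ?thesis using assms by (simp add: norm_mult norm_divide del: complex_cnj_diff)
qed

text \<open>Jensen's formula (\<open>\<lambda> = 1\<close>), and a continuous majorant of \<open>ln |g|\<close> with almost the same mean (\<open>\<lambda> > 1\<close>)
  when \<open>g\<close> has zeros on the circle.\<close>

lemma jensen_majorant:
  assumes g: "g holomorphic_on ball 0 R" "g 0 \<noteq> 0" and r: "0 < r" "r < R"
    and lam: "lam > 1 \<or> (lam = 1 \<and> (\<forall>z. norm z = r \<longrightarrow> g z \<noteq> 0))"
  defines "Z \<equiv> {z \<in> cball 0 r. g z = 0}"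
  shows "\<exists>\<Lambda>. continuous_on (sphere 0 r) \<Lambda> \<and>
    circ_mean r \<Lambda> = ln (norm (g 0)) + (\<Sum>\<zeta>\<in>Z. of_int (zorder g \<zeta>) * ln (r * lam / norm \<zeta>)) \<and>
    (\<forall>z. norm z = r \<longrightarrow> g z \<noteq> 0 \<longrightarrow> ln (norm (g z)) \<le> \<Lambda> z \<and> (lam = 1 \<longrightarrow> \<Lambda> z = ln (norm (g z))))"
proof -
  obtain h R' where R': "r < R'" "R' \<le> R" and finZ: "finite Z"
    and h: "h holomorphic_on ball 0 R'" "\<And>z. z \<in> ball 0 R' \<Longrightarrow> h z \<noteq> 0"
    and gh: "\<And>z. z \<in> ball 0 R' \<Longrightarrow> g z = h z * (\<Prod>\<zeta>\<in>Z. (z - \<zeta>) ^ nat (zorder g \<zeta>))"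
    and pos: "\<And>\<zeta>. \<zeta> \<in> Z \<Longrightarrow> zorder g \<zeta> > 0"
    unfolding Z_def by (rule holomorphic_zero_factorization[OF g r]) blast
  have lam1: "lam \<ge> 1" using lam by auto
  define n where "n \<zeta> = real_of_int (zorder g \<zeta>)" for \<zeta>
  have n0: "n \<zeta> > 0" "real (nat (zorder g \<zeta>)) = n \<zeta>" if "\<zeta> \<in> Z" for \<zeta> using pos[OF that] by (auto simp: n_def)
  have Znz: "\<zeta> \<noteq> 0" "norm \<zeta> \<le> r" if "\<zeta> \<in> Z" for \<zeta> using that g(2) by (auto simp: Z_def)
  \<comment> \<open>For lam = 1 this is the reflected factor. A larger lam pushes its zero, of
    modulus r^2 lam / |\<zeta>|, off the circle also when |\<zeta>| = r.\<close>
  define q where "q \<zeta> z = of_real (r * lam) - cnj \<zeta> / of_real r * z" for \<zeta> z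
  have qnz: "\<exists>S>r. \<forall>z\<in>ball 0 S. q \<zeta> z \<noteq> 0" if \<zeta>: "\<zeta> \<in> Z" for \<zeta>
  proof -
    have lt: "norm \<zeta> < r * lam"
    proof (cases "lam > 1")
      case True
      then have "r * 1 < r * lam" using r by (intro mult_strict_left_mono) auto
      then show ?thesis using Znz(2)[OF \<zeta>] by simp
    next
      case False
      then have "lam = 1" "norm \<zeta> \<noteq> r" using lam \<zeta> by (auto simp: Z_def)
      then show ?thesis using Znz(2)[OF \<zeta>] by simp
    qed
    define S where "S = r * (r * lam) / norm \<zeta>"
    have "norm \<zeta> * r < r * lam * r" using lt r by (intro mult_strict_right_mono) auto
    then have "S > r" using Znz[OF \<zeta>] by (simp add: S_def field_simps)
    moreover have "q \<zeta> z \<noteq> 0" if "z \<in> ball 0 S" for z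
    proof
      assume "q \<zeta> z = 0"
      then have "norm (cnj \<zeta> / of_real r * z) = norm (complex_of_real (r * lam))" by (simp add: q_def)
      then have "norm \<zeta> * norm z = r * (r * lam)" using r lam1 by (simp add: norm_mult norm_divide field_simps)
      moreover have "norm \<zeta> * norm z < norm \<zeta> * S" using that Znz[OF \<zeta>] by (intro mult_strict_left_mono) auto
      ultimately show False using Znz[OF \<zeta>] by (simp add: S_def)
    qed
    ultimately show ?thesis by blast
  qed
  have qmean: "circ_mean r (\<lambda>z. ln (norm (q \<zeta> z))) = ln (r * lam)" if \<zeta>: "\<zeta> \<in> Z" for \<zeta>
  proof -
    obtain S where S: "S > r" "\<And>z. z \<in> ball 0 S \<Longrightarrow> q \<zeta> z \<noteq> 0" using qnz[OF \<zeta>] by blast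
    have "circ_mean r (\<lambda>z. ln (norm (q \<zeta> z))) = ln (norm (q \<zeta> 0))"
      by (rule circ_mean_ln_norm[of _ S]) (use S r in \<open>auto simp: q_def[abs_def] intro!: holomorphic_intros\<close>)
    then show ?thesis using r lam1 by (simp add: q_def norm_mult)
  qed
  have qcont: "continuous_on (sphere 0 r) (\<lambda>z. ln (norm (q \<zeta> z)))" if "\<zeta> \<in> Z" for \<zeta>
    using qnz[OF that] r unfolding q_def by (intro continuous_intros) force+
  have hcont: "continuous_on (sphere 0 r) (\<lambda>z. ln (norm (h z)))"
    by (intro continuous_on_ln continuous_on_norm holomorphic_continuous_on_sphere[OF h(1) R'(1)]) (use h(2) R' in auto)
  define \<Lambda> where "\<Lambda> z = ln (norm (h z)) + (\<Sum>\<zeta>\<in>Z. n \<zeta> * ln (norm (q \<zeta> z)))" for z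
  have "continuous_on (sphere 0 r) \<Lambda>"
    unfolding \<Lambda>_def by (intro continuous_intros hcont qcont)
  moreover have "circ_mean r \<Lambda> = ln (norm (g 0)) + (\<Sum>\<zeta>\<in>Z. of_int (zorder g \<zeta>) * ln (r * lam / norm \<zeta>))"
  proof -
    have "circ_mean r \<Lambda> = circ_mean r (\<lambda>z. ln (norm (h z))) + circ_mean r (\<lambda>z. \<Sum>\<zeta>\<in>Z. n \<zeta> * ln (norm (q \<zeta> z)))"
      unfolding \<Lambda>_def by (rule circ_mean_add) (use r in \<open>auto intro!: hcont continuous_on_sum continuous_on_mult_left qcont\<close>)
    also have "circ_mean r (\<lambda>z. ln (norm (h z))) = ln (norm (h 0))"
      by (rule circ_mean_ln_norm[OF h]) (use r R' in auto)
    also have "circ_mean r (\<lambda>z. \<Sum>\<zeta>\<in>Z. n \<zeta> * ln (norm (q \<zeta> z))) = (\<Sum>\<zeta>\<in>Z. n \<zeta> * ln (r * lam))"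
      using r by (subst circ_mean_sum) (auto intro!: sum.cong continuous_on_mult_left qcont simp: circ_mean_mult_left qcont qmean)
    finally have 1: "circ_mean r \<Lambda> = ln (norm (h 0)) + (\<Sum>\<zeta>\<in>Z. n \<zeta> * ln (r * lam))" .
    have "norm (g 0) = norm (h 0) * (\<Prod>\<zeta>\<in>Z. norm \<zeta> ^ nat (zorder g \<zeta>))"
      using gh[of 0] r R' by (simp add: norm_mult prod_norm[symmetric] norm_power)
    moreover have "norm (h 0) \<noteq> 0" using h(2)[of 0] r R' by simp
    ultimately have "ln (norm (g 0)) = ln (norm (h 0)) + ln (\<Prod>\<zeta>\<in>Z. norm \<zeta> ^ nat (zorder g \<zeta>))"
      using Znz finZ by (simp add: ln_mult)
    also have "ln (\<Prod>\<zeta>\<in>Z. norm \<zeta> ^ nat (zorder g \<zeta>)) = (\<Sum>\<zeta>\<in>Z. ln (norm \<zeta> ^ nat (zorder g \<zeta>)))"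
      by (rule ln_prod) (use finZ Znz in auto)
    also have "\<dots> = (\<Sum>\<zeta>\<in>Z. n \<zeta> * ln (norm \<zeta>))"
      using Znz n0 by (intro sum.cong) (auto simp: ln_realpow)
    finally have 2: "ln (norm (g 0)) = ln (norm (h 0)) + (\<Sum>\<zeta>\<in>Z. n \<zeta> * ln (norm \<zeta>))" .
    have "(\<Sum>\<zeta>\<in>Z. of_int (zorder g \<zeta>) * ln (r * lam / norm \<zeta>)) = (\<Sum>\<zeta>\<in>Z. n \<zeta> * ln (r * lam) - n \<zeta> * ln (norm \<zeta>))"
      using Znz r lam1 by (intro sum.cong) (auto simp: n_def ln_div right_diff_distrib)
    then show ?thesis using 1 2 by (simp add: sum_subtractf)
  qed
  moreover have "ln (norm (g z)) \<le> \<Lambda> z \<and> (lam = 1 \<longrightarrow> \<Lambda> z = ln (norm (g z)))" if z: "norm z = r" "g z \<noteq> 0" for z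
  proof -
    have zb: "z \<in> ball 0 R'" using z R' by simp
    have ne: "z \<noteq> \<zeta>" if "\<zeta> \<in> Z" for \<zeta> using that z by (auto simp: Z_def)
    have "norm (g z) = norm (h z) * (\<Prod>\<zeta>\<in>Z. norm (z - \<zeta>) ^ nat (zorder g \<zeta>))"
      using gh[OF zb] by (simp add: norm_mult prod_norm[symmetric] norm_power)
    then have "ln (norm (g z)) = ln (norm (h z)) + ln (\<Prod>\<zeta>\<in>Z. norm (z - \<zeta>) ^ nat (zorder g \<zeta>))"
      using h(2)[OF zb] ne finZ by (simp add: ln_mult)
    also have "ln (\<Prod>\<zeta>\<in>Z. norm (z - \<zeta>) ^ nat (zorder g \<zeta>)) = (\<Sum>\<zeta>\<in>Z. ln (norm (z - \<zeta>) ^ nat (zorder g \<zeta>)))"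
      by (rule ln_prod) (use finZ ne in auto)
    also have "\<dots> = (\<Sum>\<zeta>\<in>Z. n \<zeta> * ln (norm (z - \<zeta>)))"
      using ne n0 by (intro sum.cong) (auto simp: ln_realpow)
    finally have lng: "ln (norm (g z)) = ln (norm (h z)) + (\<Sum>\<zeta>\<in>Z. n \<zeta> * ln (norm (z - \<zeta>)))" .
    \<comment> \<open>Moving r out to r * lam increases the distance to every c with |c| <= r; the
      squares differ by at least r^2 (lam - 1)^2.\<close>
    have qz: "norm (z - \<zeta>) \<le> norm (q \<zeta> z)" "lam = 1 \<Longrightarrow> norm (q \<zeta> z) = norm (z - \<zeta>)" if \<zeta>: "\<zeta> \<in> Z" for \<zeta>
    proof -
      define c where "c = cnj \<zeta> / of_real r * z"
      have nc: "norm c \<le> r" using Znz(2)[OF \<zeta>] z r by (simp add: c_def norm_mult norm_divide)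
      have eq: "norm (z - \<zeta>) = norm (of_real r - c)" unfolding c_def by (rule norm_diff_on_circle[OF z(1) r(1)])
      have "(norm (of_real (r * lam) - c))\<^sup>2 - (norm (of_real r - c))\<^sup>2 = (r * lam)\<^sup>2 - r\<^sup>2 - 2 * r * (lam - 1) * Re c"
        by (simp only: cmod_power2) (simp add: power2_eq_square algebra_simps)
      moreover have "2 * r * (lam - 1) * Re c \<le> 2 * r * (lam - 1) * r"
        using complex_Re_le_cmod[of c] nc r lam1 by (intro mult_left_mono) auto
      moreover have "(r * lam)\<^sup>2 - r\<^sup>2 - 2 * r * (lam - 1) * r = r\<^sup>2 * (lam - 1)\<^sup>2"
        by (simp add: power2_eq_square algebra_simps)
      ultimately have "(norm (of_real r - c))\<^sup>2 \<le> (norm (of_real (r * lam) - c))\<^sup>2"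
        using zero_le_power2[of "r * (lam - 1)"] by (simp only: power_mult_distrib)
      then have "norm (of_real r - c) \<le> norm (of_real (r * lam) - c)" by (rule power2_le_imp_le) simp
      then show "norm (z - \<zeta>) \<le> norm (q \<zeta> z)" using eq by (simp add: q_def c_def)
      show "lam = 1 \<Longrightarrow> norm (q \<zeta> z) = norm (z - \<zeta>)" using eq by (simp add: q_def c_def)
    qed
    have "(\<Sum>\<zeta>\<in>Z. n \<zeta> * ln (norm (z - \<zeta>))) \<le> (\<Sum>\<zeta>\<in>Z. n \<zeta> * ln (norm (q \<zeta> z)))"
    proof (intro sum_mono mult_left_mono)
      fix \<zeta> assume \<zeta>: "\<zeta> \<in> Z"
      have "0 < norm (z - \<zeta>)" using ne[OF \<zeta>] by simp
      then show "ln (norm (z - \<zeta>)) \<le> ln (norm (q \<zeta> z))" using qz(1)[OF \<zeta>] by (intro ln_mono) auto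
    qed (use n0 in \<open>auto intro: less_imp_le\<close>)
    then have "ln (norm (g z)) \<le> \<Lambda> z" by (simp add: lng \<Lambda>_def)
    moreover have "\<Lambda> z = ln (norm (g z))" if "lam = 1"
      unfolding lng \<Lambda>_def using qz(2)[OF _ that] by simp
    ultimately show ?thesis by blast
  qed
  ultimately show ?thesis by blast
qed

lemma ln_norm_one_minus_le: "u \<noteq> 1 \<Longrightarrow> ln (norm (1 - u)) \<le> - Re u + (norm u)\<^sup>2 / 2" for u :: complex
proof -
  assume u: "u \<noteq> 1"
  have "(norm (1 - u))\<^sup>2 = 1 + (- 2 * Re u + (norm u)\<^sup>2)"
    by (simp only: cmod_power2) (simp add: power2_eq_square algebra_simps)
  moreover have "ln ((norm (1 - u))\<^sup>2) \<le> (norm (1 - u))\<^sup>2 - 1"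
    by (rule ln_le_minus_one) (use u in simp)
  moreover have "ln ((norm (1 - u))\<^sup>2) = 2 * ln (norm (1 - u))"
    using u by (simp add: ln_realpow)
  ultimately show ?thesis by linarith
qed

lemma zorder_preimage_pos:
  assumes \<psi>: "\<psi> holomorphic_on \<bbbD>" "\<psi> 0 \<noteq> w" and z: "z \<in> \<bbbD>" "\<psi> z = w"
  shows "zorder (\<lambda>u. \<psi> u - w) z > 0" "z \<noteq> 0"
proof -
  define r where "r = (norm z + 1) / 2"
  have r: "0 < r" "r < 1" "norm z < r" using z by (auto simp: r_def add_nonneg_pos)
  have g: "(\<lambda>u. \<psi> u - w) holomorphic_on ball 0 1" by (intro holomorphic_intros \<psi>)
  have g0: "\<psi> 0 - w \<noteq> 0" using \<psi>(2) by simp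
  have "\<forall>\<zeta>\<in>{z \<in> cball 0 r. \<psi> z - w = 0}. zorder (\<lambda>u. \<psi> u - w) \<zeta> > 0"
    by (rule holomorphic_zero_factorization[OF g g0 r(1,2)]) blast
  then show "zorder (\<lambda>u. \<psi> u - w) z > 0" using z r by auto
  show "z \<noteq> 0" using z \<psi>(2) by auto
qed

text \<open>Finitely many zeros in a slightly larger closed disc have finitely many moduli, while
  the interval of candidate radii is infinite.\<close>

lemma good_radius:
  assumes \<psi>: "\<psi> holomorphic_on \<bbbD>" "\<psi> 0 \<noteq> w" and \<rho>: "0 \<le> \<rho>" "\<rho> < 1"
  obtains r where "\<rho> < r" "r < 1" "\<And>z. norm z = r \<Longrightarrow> \<psi> z \<noteq> w"
proof -
  define r1 where "r1 = (\<rho> + 1) / 2"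
  have r1: "0 < r1" "\<rho> < r1" "r1 < 1" using \<rho> by (auto simp: r1_def)
  have g: "(\<lambda>u. \<psi> u - w) holomorphic_on ball 0 1" by (intro holomorphic_intros \<psi>)
  have g0: "\<psi> 0 - w \<noteq> 0" using \<psi>(2) by simp
  have "finite {z \<in> cball 0 r1. \<psi> z - w = 0}"
    by (rule holomorphic_zero_factorization[OF g g0 r1(1,3)]) blast
  then have "finite (norm ` {z \<in> cball 0 r1. \<psi> z - w = 0})" by (rule finite_imageI)
  moreover have "infinite {\<rho><..<r1}" using r1(2) by (rule infinite_Ioo)
  ultimately have "\<not> {\<rho><..<r1} \<subseteq> norm ` {z \<in> cball 0 r1. \<psi> z - w = 0}" by (meson finite_subset)
  then obtain r where r: "r \<in> {\<rho><..<r1}" "r \<notin> norm ` {z \<in> cball 0 r1. \<psi> z - w = 0}" by blast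
  show ?thesis
  proof (rule that[of r])
    fix z :: complex assume "norm z = r"
    then show "\<psi> z \<noteq> w" using r by (auto simp: image_iff)
  qed (use r r1 in auto)
qed

lemma nevanlinna_finite_sum:
  assumes \<psi>: "\<psi> holomorphic_on \<bbbD>" "\<psi> 0 \<noteq> w" and A: "A \<subseteq> {z \<in> \<bbbD>. \<psi> z = w}"
  shows "(\<Sum>z\<in>A. ennreal (of_int (zorder (\<lambda>u. \<psi> u - w) z) * ln (1 / norm z)))
    = ennreal (\<Sum>z\<in>A. of_int (zorder (\<lambda>u. \<psi> u - w) z) * ln (1 / norm z))"
proof (rule sum_ennreal)
  fix z assume "z \<in> A"
  then have z: "z \<in> \<bbbD>" "\<psi> z = w" using A by auto
  have "zorder (\<lambda>u. \<psi> u - w) z > 0" "z \<noteq> 0" by (rule zorder_preimage_pos[OF \<psi> z])+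
  then show "0 \<le> of_int (zorder (\<lambda>u. \<psi> u - w) z) * ln (1 / norm z)"
    using z by (intro mult_nonneg_nonneg) auto
qed

text \<open>Jensen's formula expresses the counting function as a mean of \<open>ln |1 - u|\<close> with \<open>u = \<psi>/w\<close>; since the
  mean of \<open>u\<close> vanishes, \<open>ln |1 - u| \<le> - Re u + |u|\<^sup>2/2\<close> leaves only the quadratic term.\<close>

lemma nevanlinna_le_h2_norm:
  assumes \<psi>: "\<psi> holomorphic_on \<bbbD>" "\<psi> 0 = 0" and w: "w \<noteq> 0"
    and M: "h2_norm \<psi> \<le> ennreal M" "M \<ge> 0"
  shows "nevanlinna \<psi> w \<le> ennreal (M\<^sup>2 / (2 * (norm w)\<^sup>2))"
proof -
  define n where "n z = real_of_int (zorder (\<lambda>u. \<psi> u - w) z)" for z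
  have \<psi>0: "\<psi> 0 \<noteq> w" using \<psi>(2) w by simp
  have npos: "n z > 0" "z \<noteq> 0" if "z \<in> \<bbbD>" "\<psi> z = w" for z
    using zorder_preimage_pos[OF \<psi>(1) \<psi>0 that] by (auto simp: n_def)
  define B where "B = M\<^sup>2 / (2 * (norm w)\<^sup>2)"
  have jensen: "(\<Sum>z\<in>A. n z * ln (r / norm z)) \<le> B"
    if A: "finite A" "A \<subseteq> {z \<in> \<bbbD>. \<psi> z = w}" "\<And>z. z \<in> A \<Longrightarrow> norm z \<le> r"
      and r: "0 < r" "r < 1" "\<And>z. norm z = r \<Longrightarrow> \<psi> z \<noteq> w" for A r
  proof -
    define g where "g u = \<psi> u - w" for u
    have g: "g holomorphic_on ball 0 1" "g 0 \<noteq> 0" unfolding g_def using \<psi> w by (auto intro!: holomorphic_intros)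
    define Z where "Z = {z \<in> cball 0 r. g z = 0}"
    have finZ: "finite Z" unfolding Z_def by (rule holomorphic_zero_factorization[OF g r(1,2)]) blast
    have nz: "\<forall>z. norm z = r \<longrightarrow> g z \<noteq> 0" using r(3) by (simp add: g_def)
    obtain \<Lambda> where \<Lambda>: "continuous_on (sphere 0 r) \<Lambda>"
      "circ_mean r \<Lambda> = ln (norm (g 0)) + (\<Sum>\<zeta>\<in>Z. of_int (zorder g \<zeta>) * ln (r * 1 / norm \<zeta>))"
      "\<forall>z. norm z = r \<longrightarrow> g z \<noteq> 0 \<longrightarrow> ln (norm (g z)) \<le> \<Lambda> z \<and> ((1::real) = 1 \<longrightarrow> \<Lambda> z = ln (norm (g z)))"
      using jensen_majorant[OF g r(1,2), of 1] nz unfolding Z_def by blast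
    have cont: "continuous_on (sphere 0 r) \<psi>" by (rule holomorphic_continuous_on_sphere[OF \<psi>(1) r(2)])
    \<comment> \<open>Zeros missing from A contribute nonnegative terms, as |z| <= r.\<close>
    have "(\<Sum>z\<in>A. n z * ln (r / norm z)) \<le> (\<Sum>z\<in>Z. n z * ln (r / norm z))"
    proof (rule sum_mono2[OF finZ])
      show "A \<subseteq> Z" using A by (auto simp: Z_def g_def)
      fix z assume "z \<in> Z - A"
      then have z: "z \<in> \<bbbD>" "\<psi> z = w" "norm z \<le> r" using r by (auto simp: Z_def g_def)
      then show "0 \<le> n z * ln (r / norm z)" using npos[OF z(1,2)] by (intro mult_nonneg_nonneg) (auto simp: field_simps)
    qed
    also have "\<dots> = circ_mean r \<Lambda> - ln (norm w)"
      using \<Lambda>(2) \<psi>(2) by (simp add: g_def[abs_def] n_def)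
    also have "circ_mean r \<Lambda> \<le> circ_mean r (\<lambda>z. ln (norm w) + (- Re (\<psi> z / w) + (norm (\<psi> z))\<^sup>2 / (2 * (norm w)\<^sup>2)))"
    proof (rule circ_mean_mono[OF \<Lambda>(1)])
      fix z :: complex assume z: "norm z = r"
      have gz: "g z \<noteq> 0" using r(3)[OF z] by (simp add: g_def)
      have "g z = - w * (1 - \<psi> z / w)" using w by (simp add: g_def field_simps)
      then have "norm (g z) = norm w * norm (1 - \<psi> z / w)" by (simp only: norm_mult norm_minus_cancel)
      moreover have "\<psi> z / w \<noteq> 1" using r(3)[OF z] w by simp
      ultimately have "ln (norm (g z)) = ln (norm w) + ln (norm (1 - \<psi> z / w))" using w by (simp add: ln_mult)
      also have "ln (norm (1 - \<psi> z / w)) \<le> - Re (\<psi> z / w) + (norm (\<psi> z / w))\<^sup>2 / 2"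
        by (rule ln_norm_one_minus_le) fact
      finally show "\<Lambda> z \<le> ln (norm w) + (- Re (\<psi> z / w) + (norm (\<psi> z))\<^sup>2 / (2 * (norm w)\<^sup>2))"
        using \<Lambda>(3) z gz by (simp add: norm_divide power_divide)
    qed (use r w in \<open>auto intro!: continuous_intros cont\<close>)
    also have "\<dots> = ln (norm w) + (- circ_mean r (\<lambda>z. Re (\<psi> z / w)) + circ_mean r (\<lambda>z. (norm (\<psi> z))\<^sup>2) / (2 * (norm w)\<^sup>2))"
    proof -
      have c1: "continuous_on (sphere 0 r) (\<lambda>z. Re (\<psi> z / w))" "continuous_on (sphere 0 r) (\<lambda>z. (norm (\<psi> z))\<^sup>2)"
        using w by (auto intro!: continuous_intros cont)
      have "circ_mean r (\<lambda>z. ln (norm w) + (- Re (\<psi> z / w) + (norm (\<psi> z))\<^sup>2 / (2 * (norm w)\<^sup>2)))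
        = circ_mean r (\<lambda>z. ln (norm w)) + circ_mean r (\<lambda>z. - Re (\<psi> z / w) + (norm (\<psi> z))\<^sup>2 / (2 * (norm w)\<^sup>2))"
        by (rule circ_mean_add) (use r w in \<open>auto intro!: continuous_intros cont\<close>)
      also have "circ_mean r (\<lambda>z. - Re (\<psi> z / w) + (norm (\<psi> z))\<^sup>2 / (2 * (norm w)\<^sup>2))
        = circ_mean r (\<lambda>z. - Re (\<psi> z / w)) + circ_mean r (\<lambda>z. (norm (\<psi> z))\<^sup>2 / (2 * (norm w)\<^sup>2))"
        by (rule circ_mean_add) (use r w in \<open>auto intro!: continuous_intros cont\<close>)
      also have "circ_mean r (\<lambda>z. - Re (\<psi> z / w)) = - circ_mean r (\<lambda>z. Re (\<psi> z / w))"
        using circ_mean_mult_left[OF c1(1), of "-1"] r by simp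
      also have "circ_mean r (\<lambda>z. (norm (\<psi> z))\<^sup>2 / (2 * (norm w)\<^sup>2)) = circ_mean r (\<lambda>z. (norm (\<psi> z))\<^sup>2) / (2 * (norm w)\<^sup>2)"
        using circ_mean_mult_left[OF c1(2), of "1 / (2 * (norm w)\<^sup>2)"] r by simp
      finally show ?thesis by simp
    qed
    also have "circ_mean r (\<lambda>z. Re (\<psi> z / w)) = 0"
    proof -
      have "circ_mean r (\<lambda>z. Re (\<psi> z / w)) = Re (circ_mean r (\<lambda>z. \<psi> z / w))"
        by (rule circ_mean_Re) (use r w in \<open>auto intro!: continuous_intros cont\<close>)
      also have "circ_mean r (\<lambda>z. \<psi> z / w) = \<psi> 0 / w"
        by (rule circ_mean_holomorphic[of _ 1]) (use r w \<psi> in \<open>auto intro!: holomorphic_intros\<close>)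
      finally show ?thesis using \<psi>(2) by simp
    qed
    also have "ln (norm w) + (- 0 + circ_mean r (\<lambda>z. (norm (\<psi> z))\<^sup>2) / (2 * (norm w)\<^sup>2)) - ln (norm w)
        = circ_mean r (\<lambda>z. (norm (\<psi> z))\<^sup>2) / (2 * (norm w)\<^sup>2)" by simp
    also have "\<dots> \<le> B"
    proof -
      have "circ_mean r (\<lambda>z. (norm (\<psi> z))\<^sup>2) \<le> M\<^sup>2"
        using circle_mean2_le_h2_norm[OF M r(1,2)] unfolding circle_mean2_eq by (rule sqrt_le_D)
      then show ?thesis unfolding B_def by (intro divide_right_mono) auto
    qed
    finally show ?thesis by simp
  qed
  have fin: "(\<Sum>z\<in>A. n z * ln (1 / norm z)) \<le> B" if A: "finite A" "A \<subseteq> {z \<in> \<bbbD>. \<psi> z = w}" for A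
  proof (rule field_le_epsilon)
    fix e :: real assume e: "e > 0"
    define C where "C = (\<Sum>z\<in>A. n z)"
    have C: "C \<ge> 0" unfolding C_def using npos A by (intro sum_nonneg) (force intro: less_imp_le)
    \<comment> \<open>Besides enclosing A, the radius is so close to 1 that the correction C * (- ln
      r) is at most e; C + 1 covers C = 0.\<close>
    define \<rho> where "\<rho> = Max (insert (exp (- e / (C + 1))) (norm ` A))"
    have "exp (- e / (C + 1)) < 1" using e C by simp
    then have \<rho>1: "\<rho> < 1" unfolding \<rho>_def using A by (subst Max_less_iff) auto
    have \<rho>2: "exp (- e / (C + 1)) \<le> \<rho>" "\<And>z. z \<in> A \<Longrightarrow> norm z \<le> \<rho>" unfolding \<rho>_def using A by auto
    have \<rho>0: "0 \<le> \<rho>" using \<rho>2(1) exp_gt_zero[of "- e / (C + 1)"] by linarith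
    obtain r where r: "\<rho> < r" "r < 1" "\<And>z. norm z = r \<Longrightarrow> \<psi> z \<noteq> w"
      using good_radius[OF \<psi>(1) \<psi>0 \<rho>0 \<rho>1] by blast
    have r0: "r > 0" using r \<rho>0 by simp
    have "- e / (C + 1) \<le> ln r" using \<rho>2(1) r r0 by (simp add: ln_ge_iff)
    then have lr: "- ln r \<le> e / (C + 1)" by simp
    have "(\<Sum>z\<in>A. n z * ln (1 / norm z)) = (\<Sum>z\<in>A. n z * ln (r / norm z) + n z * (- ln r))"
    proof (rule sum.cong)
      fix z assume "z \<in> A"
      then have "z \<noteq> 0" using npos(2) A by auto
      then show "n z * ln (1 / norm z) = n z * ln (r / norm z) + n z * (- ln r)"
        using r0 by (simp add: ln_div algebra_simps)
    qed simp
    also have "\<dots> = (\<Sum>z\<in>A. n z * ln (r / norm z)) + C * (- ln r)"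
      by (simp only: sum.distrib C_def sum_distrib_right)
    also have "(\<Sum>z\<in>A. n z * ln (r / norm z)) \<le> B"
      by (rule jensen[OF A _ r0 r(2,3)]) (use \<rho>2 r in force)
    also have "C * (- ln r) \<le> C * (e / (C + 1))" using lr C by (rule mult_left_mono)
    also have "C * (e / (C + 1)) \<le> e" using C e by (simp add: field_simps)
    finally show "(\<Sum>z\<in>A. n z * ln (1 / norm z)) \<le> B + e" by simp
  qed
  show ?thesis
    unfolding nevanlinna_def
  proof (subst nonneg_infsum_complete, simp, rule SUP_least)
    fix A assume A: "A \<in> {F. finite F \<and> F \<subseteq> {z \<in> \<bbbD>. \<psi> z = w}}"
    then show "(\<Sum>z\<in>A. ennreal (of_int (zorder (\<lambda>u. \<psi> u - w) z) * ln (1 / norm z))) \<le> ennreal (M\<^sup>2 / (2 * (norm w)\<^sup>2))"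
      using fin[of A] by (subst nevanlinna_finite_sum[OF \<psi>(1) \<psi>0]) (auto simp: n_def B_def intro!: ennreal_leI)
  qed
qed

section \<open>Averaging Jensen's formula over a circle of values\<close>

text \<open>ln (1 / |x|) shifted by ln 4, so that it is nonnegative for |x| <= 4 and Tonelli's
  theorem applies. At 0 it takes its limit, which the total real functions would not give.\<close>

definition log_kernel :: "complex \<Rightarrow> ennreal" where
  "log_kernel x = (if x = 0 then \<infinity> else ennreal (ln (4 / norm x)))"

lemma log_kernel_measurable [measurable]: "log_kernel \<in> borel_measurable borel"
  unfolding log_kernel_def by measurable

lemma nn_integral_circle:
  assumes "continuous_on (sphere 0 r) F" "r \<ge> 0" "\<And>z. norm z = r \<Longrightarrow> 0 \<le> F z"
  shows "(\<integral>\<^sup>+t\<in>{0..2*pi}. ennreal (F (of_real r * cis t)) \<partial>lborel) = ennreal (2 * pi * circ_mean r F)"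
proof -
  have "((\<lambda>t. F (of_real r * cis t)) has_integral (2 * pi * circ_mean r F)) {0..2*pi}"
    using integrable_integral[OF integrable_on_circle[OF assms(1,2)]] by (simp add: circ_mean_def)
  from nn_integral_has_integral_lebesgue'[OF _ this] show ?thesis
    using assms by (simp add: norm_mult)
qed

lemma ennreal_of_le_nn_integral_circle:
  fixes F :: "complex \<Rightarrow> real"
  assumes F: "continuous_on (sphere 0 r) F" "r \<ge> 0" and G: "\<And>z. norm z = r \<Longrightarrow> ennreal (F z) \<le> G z"
  shows "ennreal (2 * pi * circ_mean r F) \<le> (\<integral>\<^sup>+t\<in>{0..2*pi}. G (of_real r * cis t) \<partial>lborel)"
proof -
  have "circ_mean r F \<le> circ_mean r (\<lambda>z. max 0 (F z))"
    by (rule circ_mean_mono) (use F in \<open>auto intro!: continuous_on_max continuous_intros\<close>)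
  then have "ennreal (2 * pi * circ_mean r F) \<le> ennreal (2 * pi * circ_mean r (\<lambda>z. max 0 (F z)))"
    by (intro ennreal_leI mult_left_mono) auto
  also have "\<dots> = (\<integral>\<^sup>+t\<in>{0..2*pi}. ennreal (max 0 (F (of_real r * cis t))) \<partial>lborel)"
    by (rule nn_integral_circle[symmetric]) (use F in \<open>auto intro!: continuous_on_max continuous_intros\<close>)
  also have "\<dots> \<le> (\<integral>\<^sup>+t\<in>{0..2*pi}. G (of_real r * cis t) \<partial>lborel)"
  proof (intro nn_integral_mono mult_right_mono)
    fix t
    have "ennreal (F (of_real r * cis t)) \<le> G (of_real r * cis t)"
      by (rule G) (use F in \<open>simp add: norm_mult\<close>)
    then show "ennreal (max 0 (F (of_real r * cis t))) \<le> G (of_real r * cis t)"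
      by (simp add: max_def ennreal_neg)
  qed simp
  finally show ?thesis .
qed

text \<open>The logarithmic potential of the uniform measure on |z| = s: ln |x - z| has mean ln (max
  |x| s), by harmonicity for x outside and by reflection for x inside. The bound 2 on |x| leaves
  room for the perturbation of x used when |x| = s.\<close>

lemma nn_integral_log_kernel_off_circle:
  assumes s: "0 < s" "s < 1" and x: "norm x \<le> 2" "norm x \<noteq> s"
  shows "(\<integral>\<^sup>+t\<in>{0..2*pi}. log_kernel (x - of_real s * cis t) \<partial>lborel) = ennreal (2 * pi * (ln 4 - ln (max (norm x) s)))"
proof -
  have ne: "x - z \<noteq> 0" if "norm z = s" for z using that x by auto
  have cont: "continuous_on (sphere 0 s) (\<lambda>z. ln (norm (x - z)))"
    by (intro continuous_intros) (use ne in auto)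
  have le: "norm (x - z) \<le> 4" if "norm z = s" for z
    using norm_triangle_ineq4[of x z] that x s by simp
  have mean: "circ_mean s (\<lambda>z. ln (norm (x - z))) = ln (max (norm x) s)"
  proof (cases "norm x < s")
    case False
    then have "norm x > s" using x by simp
    then have "circ_mean s (\<lambda>z. ln (norm (x - z))) = ln (norm (x - 0))"
      by (intro circ_mean_ln_norm[of _ "norm x"]) (use s in \<open>auto intro!: holomorphic_intros\<close>)
    then show ?thesis using False x by (simp add: max_def)
  next
    case True
    define R where "R = (if x = 0 then 1 else s * s / norm x)"
    have R: "R > s" using True s by (auto simp: R_def field_simps)
    have nz: "of_real s - cnj x / of_real s * z \<noteq> 0" if "z \<in> ball 0 R" for z
    proof
      assume "of_real s - cnj x / of_real s * z = 0"
      then have "norm (cnj x / of_real s * z) = norm (complex_of_real s)" by simp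
      then have "norm x * norm z = s * s" using s by (simp add: norm_mult norm_divide field_simps)
      moreover have "norm x * norm z < s * s"
      proof (cases "x = 0")
        case False
        then have "norm x * norm z < norm x * R" using that by (intro mult_strict_left_mono) auto
        then show ?thesis using False by (simp add: R_def)
      qed (use s in simp)
      ultimately show False by simp
    qed
    have "circ_mean s (\<lambda>z. ln (norm (x - z))) = circ_mean s (\<lambda>z. ln (norm (of_real s - cnj x / of_real s * z)))"
    proof (rule circ_mean_cong)
      fix z :: complex assume z: "norm z = s"
      show "ln (norm (x - z)) = ln (norm (of_real s - cnj x / of_real s * z))"
        unfolding norm_minus_commute[of x z] norm_diff_on_circle[OF z s(1), of x] ..
    qed (use s in simp)
    also have "\<dots> = ln (norm (of_real s - cnj x / of_real s * 0))"
      by (rule circ_mean_ln_norm[where R = R, OF _ nz]) (use s R in \<open>auto intro!: holomorphic_intros\<close>)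
    finally show ?thesis using True s by (simp add: max_def)
  qed
  have "(\<integral>\<^sup>+t\<in>{0..2*pi}. log_kernel (x - of_real s * cis t) \<partial>lborel)
     = (\<integral>\<^sup>+t\<in>{0..2*pi}. ennreal ((\<lambda>z. ln 4 - ln (norm (x - z))) (of_real s * cis t)) \<partial>lborel)"
  proof (intro nn_integral_cong arg_cong2[where f = "(*)"] refl)
    fix t :: real
    have "x - of_real s * cis t \<noteq> 0" by (rule ne) (use s in \<open>simp add: norm_mult\<close>)
    then show "log_kernel (x - of_real s * cis t) = ennreal ((\<lambda>z. ln 4 - ln (norm (x - z))) (of_real s * cis t))"
      by (simp add: log_kernel_def ln_div)
  qed
  also have "\<dots> = ennreal (2 * pi * circ_mean s (\<lambda>z. ln 4 - ln (norm (x - z))))"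
  proof (rule nn_integral_circle)
    fix z :: complex assume z: "norm z = s"
    have "0 < norm (x - z)" using ne[OF z] by simp
    then show "0 \<le> ln 4 - ln (norm (x - z))" using le[OF z] by simp
  qed (use s in \<open>auto intro!: continuous_intros cont\<close>)
  also have "circ_mean s (\<lambda>z. ln 4 - ln (norm (x - z))) = ln 4 - ln (max (norm x) s)"
    using circ_mean_diff[of s "\<lambda>_. ln 4 :: real" "\<lambda>z. ln (norm (x - z))"] cont s mean by simp
  finally show ?thesis .
qed

text \<open>For \<open>|x| = s\<close> the kernel is singular on the circle and Fatou's lemma gives the inequality that is needed.\<close>

lemma nn_integral_log_kernel_le:
  assumes s: "0 < s" "s < 1" and x: "norm x \<le> 1"
  shows "(\<integral>\<^sup>+t\<in>{0..2*pi}. log_kernel (x - of_real s * cis t) \<partial>lborel) \<le> ennreal (2 * pi * (ln 4 - ln (max (norm x) s)))"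
proof (cases "norm x = s")
  case False
  then show ?thesis using nn_integral_log_kernel_off_circle[OF s _ False] x by simp
next
  case True
  \<comment> \<open>x is moved off the circle radially outwards; l n <= 2 keeps the moved point
    within norm 2.\<close>
  define l where "l n = 1 + inverse (real (Suc n))" for n
  have l: "l n > 1" "l n \<le> 2" for n by (auto simp: l_def field_simps)
  have llim: "l \<longlonglongrightarrow> 1" unfolding l_def[abs_def] using tendsto_add[OF tendsto_const LIMSEQ_inverse_real_of_nat] by simp
  define u where "u n t = log_kernel (of_real (l n) * x - of_real s * cis t) * indicator {0..2*pi} t" for n t
  have [measurable]: "u n \<in> borel_measurable lborel" for n
  proof -
    have "(\<lambda>t. of_real (l n) * x - of_real s * cis t) \<in> borel_measurable borel"
      by (intro borel_measurable_continuous_onI continuous_intros)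
    then show ?thesis unfolding u_def by measurable
  qed
  have conv: "(\<lambda>n. log_kernel (of_real (l n) * x - y)) \<longlonglongrightarrow> log_kernel (x - y)" if y: "norm y = s" for y
  proof (cases "x = y")
    case False
    have c: "(\<lambda>n. of_real (l n) * x - y) \<longlonglongrightarrow> of_real 1 * x - y"
      by (intro tendsto_intros llim)
    have "(\<lambda>n. ennreal (ln (4 / norm (of_real (l n) * x - y)))) \<longlonglongrightarrow> ennreal (ln (4 / norm (of_real 1 * x - y)))"
      by (intro tendsto_ennrealI tendsto_ln tendsto_divide tendsto_norm c tendsto_const) (use False in auto)
    moreover have "of_real (l n) * x - y \<noteq> 0" for n
    proof
      assume "of_real (l n) * x - y = 0"
      then have "norm (of_real (l n) * x) = norm y" by simp
      then show False using True y l[of n] s by (simp add: norm_mult)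
    qed
    ultimately show ?thesis using False by (simp add: log_kernel_def)
  next
    case eq: True
    have "of_real (l n) * x - y = of_real (inverse (real (Suc n))) * x" for n
      by (simp add: l_def eq algebra_simps)
    then have nn: "norm (of_real (l n) * x - y) = s / real (Suc n)" for n
      using True by (simp only: norm_mult norm_of_real) (simp add: divide_inverse mult.commute)
    have "log_kernel (of_real (l n) * x - y) = ennreal (ln (4 * real (Suc n) / s))" for n
    proof -
      have "norm (of_real (l n) * x - y) \<noteq> 0" using nn[of n] s by simp
      then have "of_real (l n) * x - y \<noteq> 0" by (simp only: norm_eq_zero) simp
      then show ?thesis by (simp only: log_kernel_def if_False nn) simp
    qed
    moreover have "filterlim (\<lambda>n. ln (4 * real (Suc n) / s)) at_top sequentially"
    proof (rule filterlim_compose[OF ln_at_top])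
      have "filterlim (\<lambda>n. (4 / s) * real (Suc n)) at_top sequentially"
        using s by (intro filterlim_tendsto_pos_mult_at_top[OF tendsto_const]
            filterlim_compose[OF filterlim_real_sequentially filterlim_Suc]) simp
      then show "filterlim (\<lambda>n. 4 * real (Suc n) / s) at_top sequentially"
        by (simp only: times_divide_eq_left)
    qed
    then have "(\<lambda>n. ennreal (ln (4 * real (Suc n) / s))) \<longlonglongrightarrow> \<infinity>"
      by (simp add: ennreal_tendsto_top_eq_at_top)
    ultimately show ?thesis by (simp add: log_kernel_def eq)
  qed
  have "(\<integral>\<^sup>+t\<in>{0..2*pi}. log_kernel (x - of_real s * cis t) \<partial>lborel) \<le> (\<integral>\<^sup>+t. liminf (\<lambda>n. u n t) \<partial>lborel)"
  proof (rule nn_integral_mono)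
    fix t :: real
    have "(\<lambda>n. u n t) \<longlonglongrightarrow> log_kernel (x - of_real s * cis t) * indicator {0..2*pi} t"
      unfolding u_def using conv[of "of_real s * cis t"] s
      by (cases "t \<in> {0..2*pi}") (simp_all add: norm_mult)
    then show "log_kernel (x - of_real s * cis t) * indicator {0..2*pi} t \<le> liminf (\<lambda>n. u n t)"
      using lim_imp_Liminf[OF sequentially_bot, of "\<lambda>n. u n t"] by simp
  qed
  also have "\<dots> \<le> liminf (\<lambda>n. \<integral>\<^sup>+t. u n t \<partial>lborel)" by (rule nn_integral_liminf) simp
  also have "\<dots> \<le> liminf (\<lambda>n. ennreal (2 * pi * (ln 4 - ln (max (norm x) s))))"
  proof (rule Liminf_mono, rule always_eventually, rule allI)
    fix n
    have nl: "norm (of_real (l n) * x) = l n * s" using True l[of n] by (simp add: norm_mult)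
    have ls: "s < l n * s" "l n * s \<le> 2" using l[of n] s mult_mono[of "l n" 2 s 1] by auto
    have "(\<integral>\<^sup>+t. u n t \<partial>lborel) = ennreal (2 * pi * (ln 4 - ln (max (norm (of_real (l n) * x)) s)))"
      unfolding u_def
    proof (rule nn_integral_log_kernel_off_circle[OF s])
      show "norm (of_real (l n) * x) \<le> 2" unfolding nl by (rule ls(2))
      show "norm (of_real (l n) * x) \<noteq> s" unfolding nl using ls(1) by (rule less_imp_neq[THEN not_sym])
    qed
    also have "\<dots> \<le> ennreal (2 * pi * (ln 4 - ln (max (norm x) s)))"
      unfolding nl using ls s True by (intro ennreal_leI mult_left_mono diff_left_mono) (auto simp: max_def)
    finally show "(\<integral>\<^sup>+t. u n t \<partial>lborel) \<le> ennreal (2 * pi * (ln 4 - ln (max (norm x) s)))" .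
  qed
  also have "\<dots> = ennreal (2 * pi * (ln 4 - ln (max (norm x) s)))" by (simp add: Liminf_const)
  finally show ?thesis .
qed

text \<open>Jensen bounds the mean of ln |\<psi> - w| over |z| = r by ln |w| + N(\<psi>, w), since
  zeros up to radius r with weight ln (r / |z|) contribute at most the counting function. As \<psi>
  may take the value w on the circle, the majorant with lam > 1 is used at cost e.\<close>

lemma nn_integral_log_kernel_ge:
  assumes \<psi>: "\<psi> holomorphic_on \<bbbD>" "\<psi> 0 = 0" and w: "w \<noteq> 0" and r: "0 < r" "r < 1"
    and S: "nevanlinna \<psi> w \<le> ennreal S" "S \<ge> 0" and e: "e > 0"
  shows "ennreal (2 * pi * (ln 4 - ln (norm w) - S - e)) \<le> (\<integral>\<^sup>+t\<in>{0..2*pi}. log_kernel (\<psi> (of_real r * cis t) - w) \<partial>lborel)"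
proof -
  define g where "g u = \<psi> u - w" for u
  have \<psi>0: "\<psi> 0 \<noteq> w" using \<psi>(2) w by simp
  have g: "g holomorphic_on ball 0 1" "g 0 \<noteq> 0" unfolding g_def using \<psi> w by (auto intro!: holomorphic_intros)
  define Z where "Z = {z \<in> cball 0 r. g z = 0}"
  have finZ: "finite Z" unfolding Z_def by (rule holomorphic_zero_factorization[OF g r]) blast
  define n where "n z = real_of_int (zorder g z)" for z
  have Zsub: "Z \<subseteq> {z \<in> \<bbbD>. \<psi> z = w}" using r by (auto simp: Z_def g_def)
  have npos: "n z > 0" "z \<noteq> 0" if "z \<in> Z" for z
    using zorder_preimage_pos[OF \<psi>(1) \<psi>0, of z] that Zsub by (auto simp: n_def g_def[abs_def])
  define C where "C = (\<Sum>z\<in>Z. n z)"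
  have C: "C \<ge> 0" unfolding C_def using npos by (intro sum_nonneg) (auto intro: less_imp_le)
  \<comment> \<open>Each zero pays ln lam = e / (C + 1) per multiplicity, at most e in
    total.\<close>
  define lam where "lam = exp (e / (C + 1))"
  have lam: "lam > 1" using C e by (simp add: lam_def)
  obtain \<Lambda> where \<Lambda>: "continuous_on (sphere 0 r) \<Lambda>"
    "circ_mean r \<Lambda> = ln (norm (g 0)) + (\<Sum>\<zeta>\<in>Z. of_int (zorder g \<zeta>) * ln (r * lam / norm \<zeta>))"
    "\<forall>z. norm z = r \<longrightarrow> g z \<noteq> 0 \<longrightarrow> ln (norm (g z)) \<le> \<Lambda> z \<and> (lam = 1 \<longrightarrow> \<Lambda> z = ln (norm (g z)))"
    using jensen_majorant[OF g r, of lam] lam unfolding Z_def by blast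
  have "(\<Sum>\<zeta>\<in>Z. n \<zeta> * ln (r * lam / norm \<zeta>)) \<le> (\<Sum>\<zeta>\<in>Z. n \<zeta> * ln (1 / norm \<zeta>) + n \<zeta> * (e / (C + 1)))"
  proof (rule sum_mono)
    fix \<zeta> assume \<zeta>: "\<zeta> \<in> Z"
    have "ln (r * lam / norm \<zeta>) = ln r + e / (C + 1) + ln (1 / norm \<zeta>)"
      using r lam npos[OF \<zeta>] by (simp add: ln_div ln_mult lam_def)
    also have "\<dots> \<le> ln (1 / norm \<zeta>) + e / (C + 1)" using r by simp
    finally have "n \<zeta> * ln (r * lam / norm \<zeta>) \<le> n \<zeta> * (ln (1 / norm \<zeta>) + e / (C + 1))"
      using npos[OF \<zeta>] by (intro mult_left_mono) auto
    then show "n \<zeta> * ln (r * lam / norm \<zeta>) \<le> n \<zeta> * ln (1 / norm \<zeta>) + n \<zeta> * (e / (C + 1))" by (simp add: distrib_left)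
  qed
  also have "\<dots> = (\<Sum>\<zeta>\<in>Z. n \<zeta> * ln (1 / norm \<zeta>)) + C * (e / (C + 1))"
    by (simp only: sum.distrib C_def sum_distrib_right)
  also have "C * (e / (C + 1)) \<le> e" using C e by (simp add: field_simps)
  also have "(\<Sum>\<zeta>\<in>Z. n \<zeta> * ln (1 / norm \<zeta>)) \<le> S"
  proof -
    have "ennreal (\<Sum>\<zeta>\<in>Z. n \<zeta> * ln (1 / norm \<zeta>)) = (\<Sum>z\<in>Z. ennreal (of_int (zorder (\<lambda>u. \<psi> u - w) z) * ln (1 / norm z)))"
      unfolding nevanlinna_finite_sum[OF \<psi>(1) \<psi>0 Zsub] by (simp add: n_def g_def[abs_def])
    also have "\<dots> \<le> nevanlinna \<psi> w"
      unfolding nevanlinna_def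
      by (subst nonneg_infsum_complete) (use finZ Zsub in \<open>auto intro!: SUP_upper2[of Z]\<close>)
    also have "\<dots> \<le> ennreal S" by (rule S)
    finally show ?thesis using S(2) by (simp add: ennreal_le_iff)
  qed
  finally have mean: "circ_mean r \<Lambda> \<le> ln (norm w) + S + e"
    using \<Lambda>(2) \<psi>(2) by (simp add: n_def g_def)
  have "circ_mean r (\<lambda>z. ln 4 - \<Lambda> z) = ln 4 - circ_mean r \<Lambda>"
    using circ_mean_diff[of r "\<lambda>_. ln 4 :: real" \<Lambda>] \<Lambda>(1) r by simp
  then have "ennreal (2 * pi * (ln 4 - ln (norm w) - S - e)) \<le> ennreal (2 * pi * circ_mean r (\<lambda>z. ln 4 - \<Lambda> z))"
    using mean by (intro ennreal_leI mult_left_mono) auto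
  also have "\<dots> \<le> (\<integral>\<^sup>+t\<in>{0..2*pi}. (\<lambda>z. log_kernel (g z)) (of_real r * cis t) \<partial>lborel)"
  proof (rule ennreal_of_le_nn_integral_circle)
    fix z :: complex assume z: "norm z = r"
    show "ennreal (ln 4 - \<Lambda> z) \<le> log_kernel (g z)"
      using \<Lambda>(3) z by (cases "g z = 0") (auto simp: log_kernel_def ln_div intro!: ennreal_leI)
  qed (use r \<Lambda>(1) in \<open>auto intro!: continuous_intros\<close>)
  finally show ?thesis by (simp add: g_def)
qed

text \<open>Tonelli's theorem for the kernel at \<psi> (r e^(it)) - s e^(i\<theta>): integration in
  t first gives Jensen's lower bound, integration in \<theta> first gives the potential of the
  circle as an upper bound.\<close>

lemma circ_mean_ln_max_le:
  assumes \<psi>: "\<psi> holomorphic_on \<bbbD>" "\<psi> ` \<bbbD> \<subseteq> \<bbbD>" "\<psi> 0 = 0" and r: "0 < r" "r < 1" and s: "0 < s" "s < 1"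
    and S: "\<And>w. norm w = s \<Longrightarrow> nevanlinna \<psi> w \<le> ennreal S" "S \<ge> 0"
  shows "circ_mean r (\<lambda>z. ln (max (norm (\<psi> z)) s)) \<le> ln s + S"
proof (rule field_le_epsilon)
  fix e :: real assume e: "e > 0"
  have r\<psi>: "norm (\<psi> (of_real r * cis t)) < 1" for t
  proof -
    have "of_real r * cis t \<in> \<bbbD>" using r by (simp add: norm_mult)
    then show ?thesis using \<psi>(2) by (auto simp: image_subset_iff)
  qed
  have cont: "continuous_on (sphere 0 r) \<psi>" by (rule holomorphic_continuous_on_sphere[OF \<psi>(1) r(2)])
  have cont\<psi>: "continuous_on UNIV (\<lambda>t. \<psi> (of_real r * cis t))"
    by (rule continuous_on_circle_sphere[OF cont]) (use r in simp)
  define f where "f t \<theta> = log_kernel (\<psi> (of_real r * cis t) - of_real s * cis \<theta>) * indicator {0..2*pi} t * indicator {0..2*pi} \<theta>" for t \<theta>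
  have meas: "case_prod f \<in> borel_measurable (lborel \<Otimes>\<^sub>M lborel)"
  proof -
    have [measurable]: "(\<lambda>t. \<psi> (of_real r * cis t)) \<in> borel_measurable borel" by (rule borel_measurable_continuous_onI[OF cont\<psi>])
    have [measurable]: "(\<lambda>t. of_real s * cis t) \<in> borel_measurable borel"
      by (intro borel_measurable_continuous_onI continuous_intros)
    show ?thesis unfolding f_def by measurable
  qed
  have fub: "(\<integral>\<^sup>+\<theta>. (\<integral>\<^sup>+t. f t \<theta> \<partial>lborel) \<partial>lborel) = (\<integral>\<^sup>+t. (\<integral>\<^sup>+\<theta>. f t \<theta> \<partial>lborel) \<partial>lborel)"
    by (rule lborel_pair.Fubini'[OF meas])
  define c where "c = 2 * pi * (ln 4 - ln s - S - e)"
  have ind: "(\<integral>\<^sup>+t\<in>{0..2*pi}. k \<partial>lborel) = k * ennreal (2 * pi)" for k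
    by (simp add: nn_integral_cmult_indicator)
  have "ennreal c * ennreal (2 * pi) = (\<integral>\<^sup>+\<theta>. ennreal c * indicator {0..2*pi} \<theta> \<partial>lborel)" by (rule ind[symmetric])
  also have "\<dots> \<le> (\<integral>\<^sup>+\<theta>. (\<integral>\<^sup>+t. f t \<theta> \<partial>lborel) \<partial>lborel)"
  proof (rule nn_integral_mono)
    fix \<theta> :: real
    have ns: "norm (of_real s * cis \<theta>) = s" using s by (simp add: norm_mult)
    have "ennreal c \<le> (\<integral>\<^sup>+t\<in>{0..2*pi}. log_kernel (\<psi> (of_real r * cis t) - of_real s * cis \<theta>) \<partial>lborel)"
      using nn_integral_log_kernel_ge[OF \<psi>(1,3) _ r S(1)[OF ns] S(2) e] s unfolding ns c_def by simp
    then show "ennreal c * indicator {0..2*pi} \<theta> \<le> (\<integral>\<^sup>+t. f t \<theta> \<partial>lborel)"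
      unfolding f_def by (cases "\<theta> \<in> {0..2*pi}") auto
  qed
  also have "\<dots> = (\<integral>\<^sup>+t. (\<integral>\<^sup>+\<theta>. f t \<theta> \<partial>lborel) \<partial>lborel)" by (rule fub)
  also have "\<dots> \<le> (\<integral>\<^sup>+t\<in>{0..2*pi}. ennreal ((\<lambda>z. 2 * pi * (ln 4 - ln (max (norm (\<psi> z)) s))) (of_real r * cis t)) \<partial>lborel)"
  proof (rule nn_integral_mono)
    fix t :: real
    have "(\<integral>\<^sup>+\<theta>. f t \<theta> \<partial>lborel) \<le> ennreal (2 * pi * (ln 4 - ln (max (norm (\<psi> (of_real r * cis t))) s)))" if "t \<in> {0..2*pi}"
      using nn_integral_log_kernel_le[OF s less_imp_le[OF r\<psi>[of t]]] that unfolding f_def by simp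
    then show "(\<integral>\<^sup>+\<theta>. f t \<theta> \<partial>lborel) \<le> ennreal ((\<lambda>z. 2 * pi * (ln 4 - ln (max (norm (\<psi> z)) s))) (of_real r * cis t)) * indicator {0..2*pi} t"
      by (cases "t \<in> {0..2*pi}") (auto simp: f_def)
  qed
  also have "\<dots> = ennreal (2 * pi * circ_mean r (\<lambda>z. 2 * pi * (ln 4 - ln (max (norm (\<psi> z)) s))))"
  proof (rule nn_integral_circle)
    show "continuous_on (sphere 0 r) (\<lambda>z. 2 * pi * (ln 4 - ln (max (norm (\<psi> z)) s)))"
      by (intro continuous_intros continuous_on_max cont) (use s in auto)
    fix z :: complex assume "norm z = r"
    then have "norm (\<psi> z) < 1" using \<psi>(2) r by (auto simp: image_subset_iff)
    then have "max (norm (\<psi> z)) s \<le> 4" "max (norm (\<psi> z)) s > 0" using s by auto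
    then show "0 \<le> 2 * pi * (ln 4 - ln (max (norm (\<psi> z)) s))" by (intro mult_nonneg_nonneg) auto
  qed (use r in simp)
  finally have 1: "ennreal c * ennreal (2 * pi) \<le> ennreal (2 * pi * circ_mean r (\<lambda>z. 2 * pi * (ln 4 - ln (max (norm (\<psi> z)) s))))" .
  define m where "m = circ_mean r (\<lambda>z. ln (max (norm (\<psi> z)) s))"
  have cm: "continuous_on (sphere 0 r) (\<lambda>z. ln (max (norm (\<psi> z)) s))"
    by (intro continuous_intros continuous_on_max cont) (use s in auto)
  have "circ_mean r (\<lambda>z. 2 * pi * (ln 4 - ln (max (norm (\<psi> z)) s))) = 2 * pi * (ln 4 - m)"
    using circ_mean_mult_left[of r "\<lambda>z. ln 4 - ln (max (norm (\<psi> z)) s)" "2 * pi"] circ_mean_diff[of r "\<lambda>_. ln 4 :: real" "\<lambda>z. ln (max (norm (\<psi> z)) s)"] cm r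
    by (simp add: m_def continuous_on_diff)
  with 1 have 2: "ennreal (c * (2 * pi)) \<le> ennreal (2 * pi * (2 * pi * (ln 4 - m)))"
    by (simp add: ennreal_mult''[symmetric])
  \<comment> \<open>\<open>ennreal\<close> sends negative reals to 0, so the comparison returns to
    the reals only once its right side is known to be nonnegative.\<close>
  have "m \<le> circ_mean r (\<lambda>_. ln 1)" unfolding m_def
  proof (rule circ_mean_mono[OF cm])
    fix z :: complex assume "norm z = r"
    then have "norm (\<psi> z) < 1" using \<psi>(2) r by (auto simp: image_subset_iff)
    then show "ln (max (norm (\<psi> z)) s) \<le> ln 1" using s by (intro ln_mono) auto
  qed (use r in auto)
  then have m: "m \<le> 0" by simp
  have "ln (4::real) \<ge> 0" by simp
  with m have "ln 4 - m \<ge> 0" by linarith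
  then have "c * (2 * pi) \<le> 2 * pi * (2 * pi * (ln 4 - m))"
    using 2 by (subst (asm) ennreal_le_iff) auto
  then have "c \<le> 2 * pi * (ln 4 - m)" using pi_gt_zero by (simp add: mult.commute)
  then have "ln 4 - ln s - S - e \<le> ln 4 - m" unfolding c_def using pi_gt_zero by (subst (asm) mult_le_cancel_left_pos) auto
  then show "circ_mean r (\<lambda>z. ln (max (norm (\<psi> z)) s)) \<le> ln s + S + e" by (simp add: m_def)
qed

text \<open>Pointwise |\<psi>|^2 <= 4 s^2 + ln^+ (|\<psi>| / s) / ln 2: up to 2 s the first term
  suffices, beyond it the second is at least 1 while |\<psi>| < 1.\<close>

lemma h2_norm_le_nevanlinna:
  assumes \<psi>: "\<psi> holomorphic_on \<bbbD>" "\<psi> ` \<bbbD> \<subseteq> \<bbbD>" "\<psi> 0 = 0" and s: "0 < s" "s < 1"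
    and S: "\<And>w. norm w = s \<Longrightarrow> nevanlinna \<psi> w \<le> ennreal S" "S \<ge> 0"
  shows "h2_norm \<psi> \<le> ennreal (sqrt (4 * s\<^sup>2 + S / ln 2))"
proof (subst h2_norm_le_iff, simp add: S, intro ballI)
  fix r :: real assume r': "r \<in> {0<..<1}"
  then have r: "0 < r" "r < 1" by auto
  have cont: "continuous_on (sphere 0 r) \<psi>" by (rule holomorphic_continuous_on_sphere[OF \<psi>(1) r(2)])
  have cm: "continuous_on (sphere 0 r) (\<lambda>z. ln (max (norm (\<psi> z)) s))"
    by (intro continuous_intros continuous_on_max cont) (use s in auto)
  have "circ_mean r (\<lambda>z. (norm (\<psi> z))\<^sup>2) \<le> circ_mean r (\<lambda>z. 4 * s\<^sup>2 + (ln (max (norm (\<psi> z)) s) - ln s) / ln 2)"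
  proof (rule circ_mean_mono)
    fix z :: complex assume "norm z = r"
    then have lt: "norm (\<psi> z) < 1" using \<psi>(2) r by (auto simp: image_subset_iff)
    have nn: "0 \<le> (ln (max (norm (\<psi> z)) s) - ln s) / ln 2" using s by (intro divide_nonneg_pos) auto
    show "(norm (\<psi> z))\<^sup>2 \<le> 4 * s\<^sup>2 + (ln (max (norm (\<psi> z)) s) - ln s) / ln 2"
    proof (cases "norm (\<psi> z) \<le> 2 * s")
      case True
      then have "(norm (\<psi> z))\<^sup>2 \<le> (2 * s)\<^sup>2" by (intro power_mono) auto
      then show ?thesis using nn by (simp add: power_mult_distrib)
    next
      case False
      then have "ln (2 * s) \<le> ln (max (norm (\<psi> z)) s)" using s by (intro ln_mono) auto
      then have "1 \<le> (ln (max (norm (\<psi> z)) s) - ln s) / ln 2" using s by (simp add: ln_mult field_simps)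
      moreover have "(norm (\<psi> z))\<^sup>2 \<le> 1" using lt by (simp add: abs_square_le_1)
      ultimately show ?thesis using zero_le_power2[of s] by linarith
    qed
  qed (use r in \<open>auto intro!: continuous_intros cont cm\<close>)
  also have "\<dots> = 4 * s\<^sup>2 + (circ_mean r (\<lambda>z. ln (max (norm (\<psi> z)) s)) - ln s) / ln 2"
  proof -
    have "circ_mean r (\<lambda>z. 4 * s\<^sup>2 + (ln (max (norm (\<psi> z)) s) - ln s) / ln 2)
      = circ_mean r (\<lambda>z. (4 * s\<^sup>2 - ln s / ln 2) + 1 / ln 2 * ln (max (norm (\<psi> z)) s))"
      by (simp add: diff_divide_distrib algebra_simps)
    also have "\<dots> = circ_mean r (\<lambda>z. 4 * s\<^sup>2 - ln s / ln 2) + circ_mean r (\<lambda>z. 1 / ln 2 * ln (max (norm (\<psi> z)) s))"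
      by (rule circ_mean_add) (use r in \<open>auto intro!: continuous_intros cm\<close>)
    also have "circ_mean r (\<lambda>z. 1 / ln 2 * ln (max (norm (\<psi> z)) s)) = 1 / ln 2 * circ_mean r (\<lambda>z. ln (max (norm (\<psi> z)) s))"
      by (rule circ_mean_mult_left[OF cm]) (use r in simp)
    finally show ?thesis by (simp add: diff_divide_distrib)
  qed
  also have "\<dots> \<le> 4 * s\<^sup>2 + S / ln 2"
    using circ_mean_ln_max_le[OF \<psi> r s S] by (intro add_left_mono divide_right_mono) auto
  finally show "circle_mean2 \<psi> r \<le> sqrt (4 * s\<^sup>2 + S / ln 2)" by (simp add: circle_mean2_eq)
qed

section \<open>Transfer between (iii) and (iv)\<close>

lemma h2_vanishing_imp_nevanlinna_vanishing:
  assumes \<phi>: "\<phi> holomorphic_on \<bbbD>" "\<phi> ` \<bbbD> \<subseteq> \<bbbD>"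
    and van: "vanishes_at_image_boundary \<phi> (\<lambda>a. h2_norm (\<sigma> (\<phi> a) \<circ> \<phi> \<circ> \<sigma> a))"
  shows "vanishes_at_image_boundary \<phi> (\<lambda>a. SUP w\<in>{w. 0 < norm w \<and> norm w < 1}.
    ennreal ((norm w)\<^sup>2) * nevanlinna (\<sigma> (\<phi> a) \<circ> \<phi> \<circ> \<sigma> a) w)"
  unfolding vanishes_at_image_boundary_def
proof (intro allI impI)
  fix \<epsilon> :: real assume \<epsilon>: "\<epsilon> > 0"
  \<comment> \<open>The factor 1/2 in the counting estimate turns k^2 = \<epsilon> into \<epsilon> /
    2, which keeps the inequality strict after the supremum.\<close>
  define k where "k = sqrt \<epsilon>"
  have k: "k > 0" "k\<^sup>2 = \<epsilon>" using \<epsilon> by (auto simp: k_def)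
  obtain \<eta> where \<eta>: "\<eta> < 1" "\<forall>a\<in>\<bbbD>. norm (\<phi> a) > \<eta> \<longrightarrow> h2_norm (\<sigma> (\<phi> a) \<circ> \<phi> \<circ> \<sigma> a) < ennreal k"
    using van k(1) unfolding vanishes_at_image_boundary_def by blast
  have "(SUP w\<in>{w. 0 < norm w \<and> norm w < 1}. ennreal ((norm w)\<^sup>2) * nevanlinna (\<sigma> (\<phi> a) \<circ> \<phi> \<circ> \<sigma> a) w) < ennreal \<epsilon>"
    if a: "a \<in> \<bbbD>" "norm (\<phi> a) > \<eta>" for a
  proof -
    have hk: "h2_norm (\<sigma> (\<phi> a) \<circ> \<phi> \<circ> \<sigma> a) \<le> ennreal k" using \<eta>(2) a by (blast intro: less_imp_le)
    have "(SUP w\<in>{w. 0 < norm w \<and> norm w < 1}. ennreal ((norm w)\<^sup>2) * nevanlinna (\<sigma> (\<phi> a) \<circ> \<phi> \<circ> \<sigma> a) w) \<le> ennreal (\<epsilon> / 2)"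
    proof (rule SUP_least)
      fix w :: complex assume w: "w \<in> {w. 0 < norm w \<and> norm w < 1}"
      then have "nevanlinna (\<sigma> (\<phi> a) \<circ> \<phi> \<circ> \<sigma> a) w \<le> ennreal (k\<^sup>2 / (2 * (norm w)\<^sup>2))"
        using disc_aut_conjugate[OF \<phi> a(1)] k(1) hk by (intro nevanlinna_le_h2_norm) auto
      then have "ennreal ((norm w)\<^sup>2) * nevanlinna (\<sigma> (\<phi> a) \<circ> \<phi> \<circ> \<sigma> a) w \<le> ennreal ((norm w)\<^sup>2) * ennreal (k\<^sup>2 / (2 * (norm w)\<^sup>2))"
        by (rule mult_left_mono) simp
      also have "\<dots> = ennreal (\<epsilon> / 2)"
        using w k(2) by (simp add: ennreal_mult'[symmetric])
      finally show "ennreal ((norm w)\<^sup>2) * nevanlinna (\<sigma> (\<phi> a) \<circ> \<phi> \<circ> \<sigma> a) w \<le> ennreal (\<epsilon> / 2)" .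
    qed
    also have "\<dots> < ennreal \<epsilon>" using \<epsilon> by (simp add: ennreal_less_iff)
    finally show ?thesis .
  qed
  then show "\<exists>\<eta><1. \<forall>a\<in>\<bbbD>. norm (\<phi> a) > \<eta> \<longrightarrow> (SUP w\<in>{w. 0 < norm w \<and> norm w < 1}.
     ennreal ((norm w)\<^sup>2) * nevanlinna (\<sigma> (\<phi> a) \<circ> \<phi> \<circ> \<sigma> a) w) < ennreal \<epsilon>"
    using \<eta>(1) by blast
qed

lemma nevanlinna_vanishing_imp_h2_vanishing:
  assumes \<phi>: "\<phi> holomorphic_on \<bbbD>" "\<phi> ` \<bbbD> \<subseteq> \<bbbD>"
    and van: "vanishes_at_image_boundary \<phi> (\<lambda>a. SUP w\<in>{w. 0 < norm w \<and> norm w < 1}.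
      ennreal ((norm w)\<^sup>2) * nevanlinna (\<sigma> (\<phi> a) \<circ> \<phi> \<circ> \<sigma> a) w)"
  shows "vanishes_at_image_boundary \<phi> (\<lambda>a. h2_norm (\<sigma> (\<phi> a) \<circ> \<phi> \<circ> \<sigma> a))"
  unfolding vanishes_at_image_boundary_def
proof (intro allI impI)
  fix \<epsilon> :: real assume \<epsilon>: "\<epsilon> > 0"
  \<comment> \<open>A single circle |w| = s of values is used. With S = ln 2 * s^2 the norm bound is
    sqrt (5 s^2) < 4 s <= \<epsilon>; the threshold S * s^2 compensates the weight |w|^2.\<close>
  define s where "s = min (1/2) (\<epsilon> / 4)"
  have s: "0 < s" "s < 1" "4 * s \<le> \<epsilon>" using \<epsilon> by (auto simp: s_def)
  define S where "S = ln 2 * s\<^sup>2"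
  have S: "S > 0" using s by (simp add: S_def)
  have pos: "S * s\<^sup>2 > 0" using S s by simp
  obtain \<eta> where \<eta>: "\<eta> < 1" "\<forall>a\<in>\<bbbD>. norm (\<phi> a) > \<eta> \<longrightarrow> (SUP w\<in>{w. 0 < norm w \<and> norm w < 1}.
      ennreal ((norm w)\<^sup>2) * nevanlinna (\<sigma> (\<phi> a) \<circ> \<phi> \<circ> \<sigma> a) w) < ennreal (S * s\<^sup>2)"
    using van pos unfolding vanishes_at_image_boundary_def by blast
  have "h2_norm (\<sigma> (\<phi> a) \<circ> \<phi> \<circ> \<sigma> a) < ennreal \<epsilon>" if a: "a \<in> \<bbbD>" "norm (\<phi> a) > \<eta>" for a
  proof -
    define \<psi> where "\<psi> = \<sigma> (\<phi> a) \<circ> \<phi> \<circ> \<sigma> a"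
    have N: "nevanlinna \<psi> w \<le> ennreal S" if w: "norm w = s" for w
    proof -
      have wnz: "w \<noteq> 0" using w s(1) by auto
      have "ennreal ((norm w)\<^sup>2) * nevanlinna \<psi> w \<le> (SUP w\<in>{w. 0 < norm w \<and> norm w < 1}. ennreal ((norm w)\<^sup>2) * nevanlinna \<psi> w)"
        by (rule SUP_upper) (use w wnz s in simp)
      also have "\<dots> \<le> ennreal (S * s\<^sup>2)" using \<eta>(2) a unfolding \<psi>_def by (blast intro: less_imp_le)
      also have "\<dots> = ennreal ((norm w)\<^sup>2) * ennreal S" using S w by (simp add: ennreal_mult'[symmetric] mult.commute)
      finally have le: "ennreal ((norm w)\<^sup>2) * nevanlinna \<psi> w \<le> ennreal ((norm w)\<^sup>2) * ennreal S" .
      have c: "ennreal ((norm w)\<^sup>2) \<noteq> 0" "ennreal ((norm w)\<^sup>2) < top" using wnz by auto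
      show ?thesis using le c by (simp add: ennreal_mult_le_mult_iff)
    qed
    have "h2_norm \<psi> \<le> ennreal (sqrt (4 * s\<^sup>2 + S / ln 2))"
      using disc_aut_conjugate[OF \<phi> a(1)] N S s unfolding \<psi>_def[symmetric] by (intro h2_norm_le_nevanlinna) auto
    also have "4 * s\<^sup>2 + S / ln 2 = 5 * s\<^sup>2" by (simp add: S_def)
    also have "ennreal (sqrt (5 * s\<^sup>2)) < ennreal \<epsilon>"
    proof -
      have "5 * s\<^sup>2 < (4 * s)\<^sup>2" using s by (simp add: power_mult_distrib)
      then have "sqrt (5 * s\<^sup>2) < 4 * s" using s by (intro real_less_lsqrt) auto
      then show ?thesis using s by (simp add: ennreal_less_iff)
    qed
    finally show ?thesis unfolding \<psi>_def .
  qed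
  then show "\<exists>\<eta><1. \<forall>a\<in>\<bbbD>. norm (\<phi> a) > \<eta> \<longrightarrow> h2_norm (\<sigma> (\<phi> a) \<circ> \<phi> \<circ> \<sigma> a) < ennreal \<epsilon>"
    using \<eta>(1) by blast
qed

theorem theorem1:
  fixes \<phi> :: "complex \<Rightarrow> complex"
  assumes "\<phi> holomorphic_on \<bbbD>" and "\<phi> ` \<bbbD> \<subseteq> \<bbbD>"
  shows "(bmoa_compact (comp_op \<phi>) \<longleftrightarrow> bmoa_weakly_compact (comp_op \<phi>)) \<and>
    (bmoa_weakly_compact (comp_op \<phi>) \<longleftrightarrow>
      vanishes_at_image_boundary \<phi> (\<lambda>a. SUP w\<in>{w. 0 < norm w \<and> norm w < 1}.
        ennreal ((norm w)\<^sup>2) * nevanlinna (\<sigma> (\<phi> a) \<circ> \<phi> \<circ> \<sigma> a) w)) \<and>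
    (vanishes_at_image_boundary \<phi> (\<lambda>a. SUP w\<in>{w. 0 < norm w \<and> norm w < 1}.
        ennreal ((norm w)\<^sup>2) * nevanlinna (\<sigma> (\<phi> a) \<circ> \<phi> \<circ> \<sigma> a) w) \<longleftrightarrow>
      vanishes_at_image_boundary \<phi> (\<lambda>a. h2_norm (\<sigma> (\<phi> a) \<circ> \<phi> \<circ> \<sigma> a)))"
  using compact_imp_weakly_compact[of "comp_op \<phi>"] weakly_compact_imp_vanishing[OF assms]
    vanishing_imp_compact[OF assms] h2_vanishing_imp_nevanlinna_vanishing[OF assms]
    nevanlinna_vanishing_imp_h2_vanishing[OF assms]
  by blast

end
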